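(* Let $X$ be a polynomial process on $E\subseteq\mathbb R^d$ with extended generator $\mathcal G$, let $n\in\mathbb N$, let $h_1,\dots,h_{N_n}$ be a basis of $\mathrm{Pol}_n(E)$, let $\mathcal H_n(x)=(h_1(x),\dots,h_{N_n}(x))^\top$, and let $G\in\mathbb R^{N_n\times N_n}$ be the matrix with $\mathcal G\mathcal H_n(x)=G^\top\mathcal H_n(x)$ for $x\in E$. Assume: (a) every nonzero (complex) eigenvalue $\lambda$ of $G$ satisfies $\mathrm{Re}(\lambda)<0$, and $0$ is a simple eigenvalue of $G$ (algebraic multiplicity $1$); consequently the asymptotic moments $\mu_j=\lim_{t\to\infty}\mathbb E_x[h_j(X_t)]$, $j=1,\dots,N_n$, exist and do not depend on $x\in E$; (b) there are points $x_1,\dots,x_M\in E$ and a vector $w\in\mathbb R^M$ with strictly positive entries such that $\mu_j=\sum_{i=1}^M w_i h_j(x_i)$ for all $j=1,\dots,N_n$; (c) for these points, the matrix $H\in\mathbb R^{M\times N_n}$ with entries $H_{ij}=h_j(x_i)$ satisfies $\mathrm{rank}(H)=N_n$. Then, for all sufficiently large $\Delta>0$, there exists an $n$-Markov cubature rule for $X$ on $\mathbf T=\{l\Delta: l\in\mathbb N\}$ with state space $E^Y=\{x_1,\dots,x_M\}$.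
   Context: $\mathbb N$ is the set of positive integers. Let $E\subseteq\mathbb R^d$. A polynomial on $E$ is the restriction to $E$ of a polynomial on $\mathbb R^d$; its degree is the minimal degree of a polynomial on $\mathbb R^d$ restricting to it. $\mathrm{Pol}(E)$ is the algebra of polynomials on $E$, $\mathrm{Pol}_n(E)$ the vector space of those of degree at most $n$, and $N_n=\dim\mathrm{Pol}_n(E)$. Setting: $X$ is a càdlàg adapted process on a filtered measurable space $(\Omega,\mathcal F,\mathcal F_t)$ with a family of probability measures $\mathbb P_x$, $x\in E$, such that under each $\mathbb P_x$, $X$ is an $E$-valued Markov process with $X_0=x$ (the Markov property reading $\mathbb E_x[f(X_t)\mid\mathcal F_s]=\mathbb E_{X_s}[f(X_{t-s})]$). $X$ admits an extended generator $\mathcal G$, a linear operator whose domain contains all polynomials: for every $x\in E$ and polynomial $p$, $p(X_t)-\int_0^t\mathcal Gp(X_s)\,ds$ is a $\mathbb P_x$-local martingale. The positive maximum principle holds (if $p(x)=\max_E p$ with $x\in E$, then $\mathcal Gp(x)\le0$), so $\mathcal G$ is well defined on $\mathrm{Pol}(E)$. $X$ is a polynomial process if $\mathcal G\,\mathrm{Pol}_m(E)\subseteq\mathrm{Pol}_m(E)$ for all $m\in\mathbb N$. A time-homogeneous Markov process $Y$ with finite state space $E^Y=\{x_1,\dots,x_M\}\subseteq E$ (with laws $\mathbb P^Y_{x_i}$, $Y_0=x_i$) defines an $n$-Markov cubature rule for $X$ on $\mathbf T\subseteq[0,\infty)$ if $\mathbb E_{x_i}[p(X_t)]=\mathbb E_{x_i}[p(Y_t)]$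 for all $i=1,\dots,M$, $t\in\mathbf T$, $p\in\mathrm{Pol}_n(E)$, the left expectation being under $\mathbb P_{x_i}$ and the right one under $\mathbb P^Y_{x_i}$. For $\mathbf T=\{l\Delta:l\in\mathbb N\}$, $Y$ is a discrete-time process indexed by $\{0\}\cup\mathbf T$, i.e. a time-homogeneous Markov chain with time step $\Delta$. The points $x_1,\dots,x_M$ are pairwise distinct. *)

theory Defs
  imports
    "HOL-Probability.Probability"
    "HOL-Library.Function_Algebras"
    "Jordan_Normal_Form.Char_Poly"
    "Jordan_Normal_Form.DL_Rank"
begin

section \<open>Polynomials on a subset of Euclidean space\<close>

interpretation fun_space: vector_space "\<lambda>(c::real) (f :: 'a \<Rightarrow> real) x. c * f x"
  by unfold_locales (auto simp: fun_eq_iff algebra_simps)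

text \<open>Polynomial functions on the whole space are the library's \<^const>\<open>real_polynomial_function\<close>,
  which comes without a notion of degree.\<close>

definition polynomial_degree_le :: "nat \<Rightarrow> (real^'d \<Rightarrow> real) \<Rightarrow> bool" where
  "polynomial_degree_le k p \<longleftrightarrow>
     (\<exists>c :: ('d \<Rightarrow> nat) \<Rightarrow> real.
        p = (\<lambda>x. \<Sum>\<alpha> | (\<Sum>i\<in>UNIV. \<alpha> i) \<le> k. c \<alpha> * (\<Prod>i\<in>UNIV. vec_nth x i ^ \<alpha> i)))"

lemma finite_multi_indices: "finite {\<alpha> :: 'd::finite \<Rightarrow> nat. (\<Sum>i\<in>UNIV. \<alpha> i) \<le> k}"
proof (rule finite_subset)
  have "\<alpha> i \<le> k" if "(\<Sum>i\<in>UNIV. \<alpha> i) \<le> k" for \<alpha> :: "'d \<Rightarrow> nat" and i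
    using member_le_sum[of i UNIV \<alpha>] that by simp
  thus "{\<alpha> :: 'd \<Rightarrow> nat. (\<Sum>i\<in>UNIV. \<alpha> i) \<le> k} \<subseteq> PiE UNIV (\<lambda>_. {..k})"
    by (auto simp: PiE_def)
qed (auto intro: finite_PiE)

lemma polynomial_degree_le_monomial:
  assumes "(\<Sum>i\<in>UNIV. \<alpha> i) \<le> k"
  shows "polynomial_degree_le k (\<lambda>x :: real^'d. a * (\<Prod>i\<in>UNIV. vec_nth x i ^ \<alpha> i))"
proof -
  have "(\<Sum>\<beta> | (\<Sum>i\<in>UNIV. \<beta> i) \<le> k. (if \<beta> = \<alpha> then a else 0) * (\<Prod>i\<in>UNIV. vec_nth x i ^ \<beta> i))
      = a * (\<Prod>i\<in>UNIV. vec_nth x i ^ \<alpha> i)" for x :: "real^'d"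
    using assms finite_multi_indices[of k, where ?'d = 'd]
    by (subst sum.mono_neutral_right[where S = "{\<alpha>}"]) auto
  thus ?thesis
    unfolding polynomial_degree_le_def
    by (intro exI[of _ "\<lambda>\<beta>. if \<beta> = \<alpha> then a else 0"]) auto
qed

lemma polynomial_degree_le_add:
  assumes "polynomial_degree_le k p" "polynomial_degree_le k q"
  shows "polynomial_degree_le k (\<lambda>x. p x + q x)"
proof -
  obtain b c where
    "p = (\<lambda>x. \<Sum>\<alpha> | (\<Sum>i\<in>UNIV. \<alpha> i) \<le> k. b \<alpha> * (\<Prod>i\<in>UNIV. vec_nth x i ^ \<alpha> i))"
    "q = (\<lambda>x. \<Sum>\<alpha> | (\<Sum>i\<in>UNIV. \<alpha> i) \<le> k. c \<alpha> * (\<Prod>i\<in>UNIV. vec_nth x i ^ \<alpha> i))"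
    using assms unfolding polynomial_degree_le_def by blast
  thus ?thesis
    unfolding polynomial_degree_le_def
    by (intro exI[of _ "\<lambda>\<alpha>. b \<alpha> + c \<alpha>"]) (auto simp: sum.distrib algebra_simps)
qed

lemma polynomial_degree_le_sum:
  assumes "\<And>a. a \<in> S \<Longrightarrow> polynomial_degree_le k (p a)"
  shows "polynomial_degree_le k (\<lambda>x :: real^'d. \<Sum>a\<in>S. p a x)"
proof -
  have zero: "polynomial_degree_le k (\<lambda>x :: real^'d. 0)"
    using polynomial_degree_le_monomial[of "\<lambda>_. 0" k 0] by simp
  show ?thesis
    using assms by (induction S rule: infinite_finite_induct) (auto intro: polynomial_degree_le_add zero)
qed

lemma polynomial_degree_le_mono:
  assumes "polynomial_degree_le k p" "k \<le> l"
  shows "polynomial_degree_le l p"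
proof -
  obtain c where
    p: "p = (\<lambda>x. \<Sum>\<alpha> | (\<Sum>i\<in>UNIV. \<alpha> i) \<le> k. c \<alpha> * (\<Prod>i\<in>UNIV. vec_nth x i ^ \<alpha> i))"
    using assms unfolding polynomial_degree_le_def by blast
  show ?thesis unfolding p
    by (rule polynomial_degree_le_sum) (use assms in \<open>auto intro!: polynomial_degree_le_monomial\<close>)
qed

lemma polynomial_degree_le_mult:
  assumes "polynomial_degree_le k p" "polynomial_degree_le l q"
  shows "polynomial_degree_le (k + l) (\<lambda>x. p x * q x)"
proof -
  obtain b c where
    p: "p = (\<lambda>x. \<Sum>\<alpha> | (\<Sum>i\<in>UNIV. \<alpha> i) \<le> k. b \<alpha> * (\<Prod>i\<in>UNIV. vec_nth x i ^ \<alpha> i))" and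
    q: "q = (\<lambda>x. \<Sum>\<beta> | (\<Sum>i\<in>UNIV. \<beta> i) \<le> l. c \<beta> * (\<Prod>i\<in>UNIV. vec_nth x i ^ \<beta> i))"
    using assms unfolding polynomial_degree_le_def by blast
  have "(\<lambda>x. p x * q x) = (\<lambda>x. \<Sum>\<alpha> | (\<Sum>i\<in>UNIV. \<alpha> i) \<le> k. \<Sum>\<beta> | (\<Sum>i\<in>UNIV. \<beta> i) \<le> l.
          (b \<alpha> * c \<beta>) * (\<Prod>i\<in>UNIV. vec_nth x i ^ (\<alpha> i + \<beta> i)))"
    unfolding p q by (auto simp: sum_product power_add prod.distrib algebra_simps intro!: sum.cong)
  moreover have "polynomial_degree_le (k + l) \<dots>"
    by (intro polynomial_degree_le_sum polynomial_degree_le_monomial) (auto simp: sum.distrib)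
  ultimately show ?thesis by simp
qed

text \<open>Having some finite degree is the same as being a polynomial function.\<close>

lemma real_polynomial_function_iff_degree_le:
  fixes p :: "real^'d \<Rightarrow> real"
  shows "real_polynomial_function p \<longleftrightarrow> (\<exists>k. polynomial_degree_le k p)"
proof
  assume "real_polynomial_function p"
  thus "\<exists>k. polynomial_degree_le k p"
  proof induction
    case (linear f)
    interpret bounded_linear f by fact
    have "f = (\<lambda>x. \<Sum>j\<in>UNIV. f (axis j 1) * (\<Prod>i\<in>UNIV. vec_nth x i ^ (if i = j then 1 else 0)))"
    proof
      fix x :: "real^'d"
      have "f x = f (\<Sum>j\<in>UNIV. vec_nth x j *\<^sub>R axis j 1)"
        using basis_expansion[of x] by (simp add: scalar_mult_eq_scaleR)
      also have "\<dots> = (\<Sum>j\<in>UNIV. f (axis j 1) * vec_nth x j)"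
        by (simp add: sum scaleR mult.commute)
      also have "\<dots> = (\<Sum>j\<in>UNIV. f (axis j 1) *
                          (\<Prod>i\<in>UNIV. vec_nth x i ^ (if i = j then 1 else 0)))"
      proof (rule sum.cong, goal_cases)
        case (2 j)
        have "(\<Prod>i\<in>UNIV. vec_nth x i ^ (if i = j then 1 else 0))
            = (\<Prod>i\<in>UNIV. if i = j then vec_nth x i else 1)"
          by (rule prod.cong) auto
        thus ?case by simp
      qed simp
      finally show "f x = \<dots>" .
    qed
    moreover have "polynomial_degree_le 1 \<dots>"
      by (intro polynomial_degree_le_sum polynomial_degree_le_monomial) simp
    ultimately show ?case by metis
  next
    case (const c)
    show ?case
      using polynomial_degree_le_monomial[of "\<lambda>_. 0" 0 c] by auto
  next
    case (add f g)
    then obtain k l where "polynomial_degree_le k f" "polynomial_degree_le l g" by blast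
    hence "polynomial_degree_le (max k l) f" "polynomial_degree_le (max k l) g"
      by (auto intro: polynomial_degree_le_mono)
    thus ?case by (blast intro: polynomial_degree_le_add)
  next
    case (mult f g)
    thus ?case by (blast intro: polynomial_degree_le_mult)
  qed
next
  assume "\<exists>k. polynomial_degree_le k p"
  then obtain k c where
    p: "p = (\<lambda>x. \<Sum>\<alpha> | (\<Sum>i\<in>UNIV. \<alpha> i) \<le> k. c \<alpha> * (\<Prod>i\<in>UNIV. vec_nth x i ^ \<alpha> i))"
    unfolding polynomial_degree_le_def by blast
  have coord: "real_polynomial_function (\<lambda>x :: real^'d. vec_nth x i)" for i
    by (rule real_polynomial_function.intros(1)) (rule bounded_linear_vec_nth)
  have pow: "real_polynomial_function (\<lambda>x :: real^'d. vec_nth x i ^ m)" for i m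
    by (intro real_polynomial_function_power coord)
  show "real_polynomial_function p" unfolding p
    by (intro real_polynomial_function_sum real_polynomial_function.intros(4)
              real_polynomial_function_prod pow)
       (auto simp: finite_multi_indices)
qed

text \<open>A function on \<open>E\<close> is encoded by its extension by zero, so that functions on \<open>E\<close> form a
  linear subspace of all functions.\<close>

definition restr :: "'a set \<Rightarrow> ('a \<Rightarrow> real) \<Rightarrow> 'a \<Rightarrow> real" where
  "restr E p = (\<lambda>x. if x \<in> E then p x else 0)"

definition Pol :: "(real^'d) set \<Rightarrow> (real^'d \<Rightarrow> real) set" where
  "Pol E = restr E ` {p. real_polynomial_function p}"

definition degree_on :: "(real^'d) set \<Rightarrow> (real^'d \<Rightarrow> real) \<Rightarrow> nat" where
  "degree_on E f = (LEAST k. \<exists>p. polynomial_degree_le k p \<and> restr E p = f)"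

definition Pol_le :: "nat \<Rightarrow> (real^'d) set \<Rightarrow> (real^'d \<Rightarrow> real) set" where
  "Pol_le n E = {f \<in> Pol E. degree_on E f \<le> n}"

lemma Pol_le_iff: "f \<in> Pol_le n E \<longleftrightarrow> (\<exists>p. polynomial_degree_le n p \<and> restr E p = f)"
proof
  assume "f \<in> Pol_le n E"
  hence "\<exists>k p. polynomial_degree_le k p \<and> restr E p = f" and deg: "degree_on E f \<le> n"
    by (auto simp: Pol_le_def Pol_def real_polynomial_function_iff_degree_le)
  from this(1) have "\<exists>p. polynomial_degree_le (degree_on E f) p \<and> restr E p = f"
    unfolding degree_on_def by (rule LeastI_ex)
  thus "\<exists>p. polynomial_degree_le n p \<and> restr E p = f"
    using deg polynomial_degree_le_mono by blast
next
  assume *: "\<exists>p. polynomial_degree_le n p \<and> restr E p = f"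
  hence "degree_on E f \<le> n" unfolding degree_on_def by (rule Least_le)
  with * show "f \<in> Pol_le n E"
    by (auto simp: Pol_le_def Pol_def real_polynomial_function_iff_degree_le)
qed


section \<open>Martingales and Markov processes\<close>

text \<open>Time is a real number, and processes and filtrations are only relevant at nonnegative times.
  That a \<^locale>\<open>filtration\<close> is also given at negative times is no restriction, since it can be
  continued there by the trivial sigma-algebra.\<close>

definition cadlag :: "(real \<Rightarrow> 'a::topological_space) \<Rightarrow> bool" where
  "cadlag f \<longleftrightarrow> (\<forall>t\<ge>0. (f \<longlongrightarrow> f t) (at_right t)) \<and> (\<forall>t>0. \<exists>l. (f \<longlongrightarrow> l) (at_left t))"

definition martingale ::
  "'w measure \<Rightarrow> (real \<Rightarrow> 'w measure) \<Rightarrow> (real \<Rightarrow> 'w \<Rightarrow> real) \<Rightarrow> bool" where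
  "martingale P F M \<longleftrightarrow>
     (\<forall>t\<ge>0. M t \<in> borel_measurable (F t) \<and> integrable P (M t)) \<and>
     (\<forall>s t. 0 \<le> s \<and> s \<le> t \<longrightarrow> (AE \<omega> in P. real_cond_exp P (F s) (M t) \<omega> = M s \<omega>))"

text \<open>Localizing times may be taken to be finite: replace the \<open>k\<close>-th one by its minimum with \<open>k\<close>.\<close>

definition local_martingale ::
  "'w measure \<Rightarrow> (real \<Rightarrow> 'w measure) \<Rightarrow> (real \<Rightarrow> 'w \<Rightarrow> real) \<Rightarrow> bool" where
  "local_martingale P F M \<longleftrightarrow>
     (\<forall>t\<ge>0. M t \<in> borel_measurable (F t)) \<and>
     (\<exists>\<tau> :: nat \<Rightarrow> 'w \<Rightarrow> real.
        (\<forall>k. stopping_time F (\<tau> k) \<and> (\<forall>\<omega>\<in>space P. 0 \<le> \<tau> k \<omega>)) \<and>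
        (AE \<omega> in P. incseq (\<lambda>k. \<tau> k \<omega>) \<and> filterlim (\<lambda>k. \<tau> k \<omega>) at_top sequentially) \<and>
        (\<forall>k. martingale P F (\<lambda>t \<omega>. M (min t (\<tau> k \<omega>)) \<omega>)))"

text \<open>\<open>I\<close> is the set of times, \<open>S\<close> the state space, \<open>P x\<close> the law under which the process
  starts in \<open>x\<close>. Closure of \<open>I\<close> under differences makes the time-homogeneous Markov property
  meaningful for every pair of times.\<close>

locale markov_process = filtration "space A" F
  for A :: "'w measure" and F :: "real \<Rightarrow> 'w measure" +
  fixes I :: "real set" and S :: "'s::topological_space set"
    and P :: "'s \<Rightarrow> 'w measure" and X :: "real \<Rightarrow> 'w \<Rightarrow> 's"
  assumes times: "0 \<in> I" "I \<subseteq> {0..}" "\<And>s t. s \<in> I \<Longrightarrow> t \<in> I \<Longrightarrow> s \<le> t \<Longrightarrow> t - s \<in> I"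
    and sets_F_subset: "\<And>t. sets (F t) \<subseteq> sets A"
    and prob_space_P: "\<And>x. x \<in> S \<Longrightarrow> prob_space (P x)"
    and sets_P: "\<And>x. x \<in> S \<Longrightarrow> sets (P x) = sets A"
    and adapted: "\<And>t. t \<in> I \<Longrightarrow> X t \<in> F t \<rightarrow>\<^sub>M borel"
    and state_space: "\<And>t \<omega>. t \<in> I \<Longrightarrow> \<omega> \<in> space A \<Longrightarrow> X t \<omega> \<in> S"
    and start: "\<And>x. x \<in> S \<Longrightarrow> AE \<omega> in P x. X 0 \<omega> = x"
    and markov_property:
      "\<And>x s t f. x \<in> S \<Longrightarrow> s \<in> I \<Longrightarrow> t \<in> I \<Longrightarrow> s \<le> t \<Longrightarrow>
         f \<in> borel_measurable (restrict_space borel S) \<Longrightarrow> bounded (f ` S) \<Longrightarrow>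
         AE \<omega> in P x. real_cond_exp (P x) (F s) (\<lambda>\<omega>. f (X t \<omega>)) \<omega>
                       = (\<integral>\<omega>'. f (X (t - s) \<omega>') \<partial>P (X s \<omega>))"


section \<open>Polynomial processes\<close>

text \<open>\<open>D\<close> is the domain of the generator \<open>\<G>\<close>; its values matter on the state space only.\<close>

locale extended_generator = markov_process A F "{0..}" E P X
  for A :: "'w measure" and F and E :: "(real^'d) set" and P and X +
  fixes D :: "(real^'d \<Rightarrow> real) set" and \<G> :: "(real^'d \<Rightarrow> real) \<Rightarrow> real^'d \<Rightarrow> real"
  assumes cadlag_paths: "\<And>\<omega>. \<omega> \<in> space A \<Longrightarrow> cadlag (\<lambda>t. X t \<omega>)"
    and domain_subspace: "fun_space.subspace D"
    and polynomials_in_domain: "{p. real_polynomial_function p} \<subseteq> D"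
    and generator_add:
      "\<And>f g x. f \<in> D \<Longrightarrow> g \<in> D \<Longrightarrow> x \<in> E \<Longrightarrow> \<G> (\<lambda>y. f y + g y) x = \<G> f x + \<G> g x"
    and generator_scale:
      "\<And>c f x. f \<in> D \<Longrightarrow> x \<in> E \<Longrightarrow> \<G> (\<lambda>y. c * f y) x = c * \<G> f x"
    and generator_integrable:
      "\<And>p x. real_polynomial_function p \<Longrightarrow> x \<in> E \<Longrightarrow>
         AE \<omega> in P x. \<forall>t\<ge>0. set_integrable lborel {0..t} (\<lambda>s. \<G> p (X s \<omega>))"
    and generator_local_martingale:
      "\<And>p x. real_polynomial_function p \<Longrightarrow> x \<in> E \<Longrightarrow>
         local_martingale (P x) F (\<lambda>t \<omega>. p (X t \<omega>) - (LBINT s:{0..t}. \<G> p (X s \<omega>)))"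
    and positive_maximum_principle:
      "\<And>p x. real_polynomial_function p \<Longrightarrow> x \<in> E \<Longrightarrow> (\<And>y. y \<in> E \<Longrightarrow> p y \<le> p x) \<Longrightarrow> \<G> p x \<le> 0"

definition generator_on ::
  "(real^'d) set \<Rightarrow> ((real^'d \<Rightarrow> real) \<Rightarrow> real^'d \<Rightarrow> real) \<Rightarrow> (real^'d \<Rightarrow> real) \<Rightarrow> real^'d \<Rightarrow> real" where
  "generator_on E \<G> f = restr E (\<G> (SOME p. real_polynomial_function p \<and> restr E p = f))"

text \<open>The choice of the representative is immaterial by the positive maximum principle.\<close>

lemma (in extended_generator) generator_on_restr:
  assumes p: "real_polynomial_function p"
  shows "generator_on E \<G> (restr E p) = restr E (\<G> p)"
proof -
  define q where "q = (SOME q. real_polynomial_function q \<and> restr E q = restr E p)"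
  have "real_polynomial_function q \<and> restr E q = restr E p"
    unfolding q_def by (rule someI[of _ p]) (simp add: p)
  hence q: "real_polynomial_function q" "restr E q = restr E p" by auto
  have eq: "q y = p y" if "y \<in> E" for y
    using fun_cong[OF q(2), of y] that by (simp add: restr_def)
  have le: "\<G> f x \<le> \<G> g x"
    if f: "real_polynomial_function f" and g: "real_polynomial_function g"
      and fg: "\<And>y. y \<in> E \<Longrightarrow> f y = g y" and x: "x \<in> E" for f g x
  proof -
    have m: "real_polynomial_function (\<lambda>y. - 1 * g y)"
      by (rule real_polynomial_function.intros(4)[OF real_polynomial_function.intros(2) g])
    have "\<G> (\<lambda>y. f y + - 1 * g y) x \<le> 0"
      using fg x
      by (intro positive_maximum_principle real_polynomial_function.intros(3) f m) auto
    also have "\<G> (\<lambda>y. f y + - 1 * g y) x = \<G> f x + \<G> (\<lambda>y. - 1 * g y) x"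
      using f m x polynomials_in_domain by (intro generator_add) auto
    also have "\<G> (\<lambda>y. - 1 * g y) x = - 1 * \<G> g x"
      using g x polynomials_in_domain by (intro generator_scale) auto
    finally show ?thesis by simp
  qed
  have "\<G> q x = \<G> p x" if "x \<in> E" for x
    by (rule antisym) (rule le; simp add: q(1) p eq that)+
  thus ?thesis
    unfolding generator_on_def q_def[symmetric] by (auto simp: restr_def)
qed

locale polynomial_process = extended_generator A F E P X D \<G>
  for A :: "'w measure" and F and E :: "(real^'d) set" and P and X and D and \<G> +
  assumes generator_Pol_le: "\<And>m. 0 < m \<Longrightarrow> generator_on E \<G> ` Pol_le m E \<subseteq> Pol_le m E"

definition asymptotic_moment ::
  "'s set \<Rightarrow> ('s \<Rightarrow> 'w measure) \<Rightarrow> (real \<Rightarrow> 'w \<Rightarrow> 's) \<Rightarrow> ('s \<Rightarrow> real) \<Rightarrow> real" where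
  "asymptotic_moment E P X f =
     (THE m. \<forall>x\<in>E. ((\<lambda>t. \<integral>\<omega>. f (X t \<omega>) \<partial>P x) \<longlongrightarrow> m) at_top)"

text \<open>The Bochner integral of a non-integrable function is 0, so integrability is required
  explicitly.\<close>

definition markov_cubature ::
  "nat \<Rightarrow> (real^'d) set \<Rightarrow> (real^'d \<Rightarrow> 'w measure) \<Rightarrow> (real \<Rightarrow> 'w \<Rightarrow> real^'d) \<Rightarrow> real set \<Rightarrow>
   (real^'d) set \<Rightarrow> 'v measure \<Rightarrow> (real \<Rightarrow> 'v measure) \<Rightarrow> (real^'d \<Rightarrow> 'v measure) \<Rightarrow>
   (real \<Rightarrow> 'v \<Rightarrow> real^'d) \<Rightarrow> bool" where
  "markov_cubature n E P X T S A\<^sub>Y F\<^sub>Y P\<^sub>Y Y \<longleftrightarrow>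
     finite S \<and> S \<subseteq> E \<and> markov_process A\<^sub>Y F\<^sub>Y (insert 0 T) S P\<^sub>Y Y \<and>
     (\<forall>x\<in>S. \<forall>t\<in>T. \<forall>p\<in>Pol_le n E.
        integrable (P x) (\<lambda>\<omega>. p (X t \<omega>)) \<and> integrable (P\<^sub>Y x) (\<lambda>\<omega>. p (Y t \<omega>)) \<and>
        (\<integral>\<omega>. p (X t \<omega>) \<partial>P x) = (\<integral>\<omega>. p (Y t \<omega>) \<partial>P\<^sub>Y x))"

end

theory Submission
  imports Defs "Jordan_Normal_Form.Schur_Decomposition"
begin

text \<open>
  Write \<open>u y j t\<close> for the moment of \<open>h j\<close> at time \<open>t\<close> when the process starts in \<open>y\<close>. The proof has
  three independent ingredients.

  Moments solve a linear differential equation. Because \<open>\<G>\<close> maps polynomials to polynomials of no larger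
  degree, Dynkin's formula turns into \<open>(u y)' = G\<^sup>T (u y)\<close> with \<open>u y 0 = h y\<close>. The work is to replace
  the local martingale by its expectation. A weight \<open>(1 + |y|\<^sup>2) ^ m\<close> satisfies \<open>\<G> f \<le> C f\<close>, and a pathwise
  Gronwall inequality for the stopped process bounds its moments by a multiple of \<open>exp (C t)\<close>
  (\<open>exponential_moment_bound\<close>). Hence all polynomial moments are finite. For a nonnegative polynomial
  \<open>q\<close>, Fatou's lemma gives one half of Dynkin's formula (\<open>supermartingale_inequality\<close>). Applied
  to \<open>q = \<epsilon> p\<^sup>2 - p + 1 / (4 \<epsilon>)\<close>, which is a square up to a positive factor, it becomes the opposite
  inequality for \<open>p\<close> as \<open>\<epsilon>\<close> tends to \<open>0\<close> (\<open>dynkin_inequality\<close>); with \<open>- p\<close> in place of \<open>p\<close> one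
  gets both inequalities for every polynomial.

  The equation forgets its initial value. In a Schur basis of \<open>G\<close> that lists the eigenvalue \<open>0\<close> first,
  the first coordinate is constant and every other one is a stable scalar equation driven by the
  previous ones. So every solution converges, and its limit is a fixed vector times a linear
  functional of the initial value (\<open>linear_system_tendsto_rank_one\<close>). The constant function \<open>1\<close> is a
  combination of the \<open>h j\<close> and keeps expectation \<open>1\<close>; this fixes the value of that functional, and
  so the limit \<open>\<mu>\<close> does not depend on the starting point.

  Cubature. Let \<open>L\<close> be a left inverse of \<open>H\<close>, and let \<open>U \<Delta>\<close> be the matrix of the moments
  \<open>u (x i) j \<Delta>\<close>. The matrix \<open>q \<Delta> = 1 w\<^sup>T + (U \<Delta> - 1 \<mu>\<^sup>T) L\<close> satisfies \<open>q \<Delta> H = U \<Delta>\<close> because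
  \<open>w\<^sup>T H = \<mu>\<^sup>T\<close>. Its rows sum to \<open>1\<close> because constants are polynomials, and as \<open>\<Delta>\<close> grows its entries
  tend to those of \<open>w\<close>, which are positive. So \<open>q \<Delta>\<close> is a stochastic matrix for all large \<open>\<Delta>\<close>. Both
  \<open>u (x i) (\<Delta> + t)\<close> and \<open>\<Sum>k. q \<Delta> i k * u (x k) t\<close> solve the moment equation with the same
  initial value, so they agree; iterating, \<open>q \<Delta> ^ l H = U (l \<Delta>)\<close>, which says that the Markov chain
  with transition matrix \<open>q \<Delta>\<close> matches the moments at every time \<open>l \<Delta>\<close>.
\<close>

section \<open>Linear differential equations with a simple neutral direction\<close>

text \<open>From the time on at which the forcing term stays below \<open>a e / 2\<close>, the function
  \<open>exp (a t) (y t - e / 2)\<close> is nonincreasing, so \<open>y\<close> is eventually below \<open>e\<close>.\<close>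

lemma damped_inequality_tendsto_0:
  fixes y y' \<delta> :: "real \<Rightarrow> real"
  assumes deriv: "\<And>t. 0 < t \<Longrightarrow> (y has_real_derivative y' t) (at t)"
    and y': "\<And>t. 0 < t \<Longrightarrow> y' t \<le> - a * y t + \<delta> t"
    and nonneg: "\<And>t. 0 < t \<Longrightarrow> 0 \<le> y t"
    and a: "0 < a" and \<delta>: "(\<delta> \<longlongrightarrow> 0) at_top"
  shows "(y \<longlongrightarrow> 0) at_top"
proof (rule order_tendstoI)
  fix e :: real assume "e < 0"
  with nonneg have "e < y t" if "0 < t" for t using that by force
  thus "\<forall>\<^sub>F t in at_top. e < y t"
    by (rule eventually_mono[OF eventually_gt_at_top[of 0]])
next
  fix e :: real assume e: "0 < e"
  have "\<forall>\<^sub>F t in at_top. \<delta> t < a * e / 2"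
    using \<delta> e a by (intro order_tendstoD(2)[OF \<delta>]) simp
  then obtain T0 where T0: "\<And>t. T0 \<le> t \<Longrightarrow> \<delta> t < a * e / 2"
    by (auto simp: eventually_at_top_linorder)
  define T where "T = max T0 1"
  have T: "0 < T" "\<And>t. T \<le> t \<Longrightarrow> \<delta> t \<le> a * e / 2"
    using T0 by (auto simp: T_def less_imp_le)
  let ?z = "\<lambda>t. exp (a * t) * (y t - e / 2)"
  have decay: "?z t \<le> ?z T" if t: "T \<le> t" for t
  proof (rule DERIV_nonpos_imp_nonincreasing[OF t])
    fix s assume s: "T \<le> s" "s \<le> t"
    have "(?z has_real_derivative exp (a * s) * (a * (y s - e / 2) + y' s)) (at s)"
      using s T by (auto intro!: derivative_eq_intros deriv simp: algebra_simps)
    moreover have "a * (y s - e / 2) + y' s \<le> 0"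
      using y'[of s] T(2)[OF s(1)] s T(1) by (simp add: algebra_simps)
    ultimately show "\<exists>d. (?z has_real_derivative d) (at s) \<and> d \<le> 0"
      by (blast intro: mult_nonneg_nonpos exp_ge_zero)
  qed
  have "((\<lambda>t. ?z T * exp (- a * t)) \<longlongrightarrow> ?z T * 0) at_top"
    using a by (intro tendsto_intros filterlim_compose[OF exp_at_bot]
       filterlim_tendsto_neg_mult_at_bot[OF tendsto_const _ filterlim_ident]) auto
  hence "\<forall>\<^sub>F t in at_top. ?z T * exp (- a * t) < e / 2"
    using e by (intro order_tendstoD(2)) auto
  thus "\<forall>\<^sub>F t in at_top. y t < e"
    using eventually_ge_at_top[of T]
  proof eventually_elim
    case (elim t)
    have "y t - e / 2 = ?z t * exp (- a * t)"
      by (simp add: exp_minus field_simps)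
    also have "\<dots> \<le> ?z T * exp (- a * t)"
      using decay[OF elim(2)] by (intro mult_right_mono) auto
    finally show ?case using elim(1) by simp
  qed
qed

text \<open>The squared distance from \<open>v\<close> to the equilibrium \<open>- g0 / c\<close> satisfies a damped inequality: the cross
  term with the vanishing part of \<open>g\<close> is absorbed by Young's inequality at the cost of half the
  damping.\<close>

lemma stable_scalar_ode_tendsto:
  fixes v g :: "real \<Rightarrow> complex"
  assumes deriv: "\<And>t. 0 < t \<Longrightarrow> (v has_vector_derivative c * v t + g t) (at t)"
    and g: "(g \<longlongrightarrow> g0) at_top" and c: "Re c < 0"
  shows "(v \<longlongrightarrow> - g0 / c) at_top"
proof -
  define z where "z t = v t + g0 / c" for t
  define r where "r t = g t - g0" for t
  have c0: "c \<noteq> 0" using c by auto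
  have dz: "(z has_vector_derivative c * z t + r t) (at t)" if "0 < t" for t
    unfolding z_def r_def using c0
    by (auto intro!: derivative_eq_intros deriv that simp: field_simps)
  let ?a = "- Re c"
  have "((\<lambda>t. z t \<bullet> z t) \<longlongrightarrow> 0) at_top"
  proof (rule damped_inequality_tendsto_0)
    show "((\<lambda>t. z t \<bullet> z t) has_real_derivative 2 * (z t \<bullet> (c * z t + r t))) (at t)" if "0 < t" for t
      using bounded_bilinear.has_vector_derivative[OF bounded_bilinear_inner dz[OF that] dz[OF that]]
      by (simp add: has_real_derivative_iff_has_vector_derivative inner_commute)
    show "2 * (z t \<bullet> (c * z t + r t)) \<le> - ?a * (z t \<bullet> z t) + (norm (r t))\<^sup>2 / ?a" for t
    proof -
      have "2 * (z t \<bullet> r t) \<le> 2 * (norm (z t) * norm (r t))"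
        using norm_cauchy_schwarz by simp
      also have "\<dots> \<le> ?a * (norm (z t))\<^sup>2 + (norm (r t))\<^sup>2 / ?a"
      proof -
        have "0 \<le> (?a * norm (z t) - norm (r t))\<^sup>2 / ?a"
          using c by (intro divide_nonneg_pos) auto
        also have "\<dots> = ?a * (norm (z t))\<^sup>2 + (norm (r t))\<^sup>2 / ?a - 2 * (norm (z t) * norm (r t))"
          using c by (simp add: power2_eq_square field_simps)
        finally show ?thesis by simp
      qed
      finally have "2 * (z t \<bullet> r t) \<le> ?a * (z t \<bullet> z t) + (norm (r t))\<^sup>2 / ?a"
        by (simp add: power2_norm_eq_inner)
      moreover have "z t \<bullet> (c * z t) = Re c * (z t \<bullet> z t)"
        by (simp add: inner_complex_def algebra_simps)
      ultimately show ?thesis by (simp add: inner_add_right algebra_simps)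
    qed
    have "((\<lambda>t. (norm (r t))\<^sup>2 / ?a) \<longlongrightarrow> (norm (g0 - g0))\<^sup>2 / ?a) at_top"
      unfolding r_def using c by (intro tendsto_intros g) auto
    thus "((\<lambda>t. (norm (r t))\<^sup>2 / ?a) \<longlongrightarrow> 0) at_top" by simp
    show "0 < ?a" using c by simp
    show "0 \<le> z t \<bullet> z t" for t by simp
  qed
  hence "((\<lambda>t. sqrt (z t \<bullet> z t)) \<longlongrightarrow> sqrt 0) at_top" by (rule tendsto_real_sqrt)
  hence "(z \<longlongrightarrow> 0) at_top"
    by (simp add: norm_eq_sqrt_inner[symmetric] tendsto_norm_zero_iff)
  hence "((\<lambda>t. z t - g0 / c) \<longlongrightarrow> 0 - g0 / c) at_top" by (intro tendsto_intros)
  thus ?thesis by (simp add: z_def)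
qed

text \<open>The coefficients \<open>c\<close> are the same for all solutions, which only enter through \<open>\<phi> 0 0\<close>. This
  uniformity later makes the limit independent of the starting point.\<close>

lemma triangular_system_tendsto:
  fixes T :: "nat \<Rightarrow> nat \<Rightarrow> complex"
  assumes T0: "T 0 0 = 0" and stable: "\<And>i. 0 < i \<Longrightarrow> i < n \<Longrightarrow> Re (T i i) < 0"
  shows "\<exists>c. \<forall>\<phi>. (\<forall>i<n. continuous_on {0..} (\<phi> i) \<and>
             (\<forall>t>0. (\<phi> i has_vector_derivative (\<Sum>k\<le>i. T k i * \<phi> k t)) (at t))) \<longrightarrow>
           (\<forall>i<n. (\<phi> i \<longlongrightarrow> c i * \<phi> 0 0) at_top)"
  using stable
proof (induction n)
  case 0
  show ?case by simp
next
  case (Suc n)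
  have "\<exists>c. \<forall>\<phi>. (\<forall>i<n. continuous_on {0..} (\<phi> i) \<and>
        (\<forall>t>0. (\<phi> i has_vector_derivative (\<Sum>k\<le>i. T k i * \<phi> k t)) (at t))) \<longrightarrow>
        (\<forall>i<n. (\<phi> i \<longlongrightarrow> c i * \<phi> 0 0) at_top)"
    by (rule Suc.IH) (rule Suc.prems, simp_all)
  then obtain c where c: "\<And>\<phi>. (\<forall>i<n. continuous_on {0..} (\<phi> i) \<and>
        (\<forall>t>0. (\<phi> i has_vector_derivative (\<Sum>k\<le>i. T k i * \<phi> k t)) (at t))) \<Longrightarrow>
        (\<forall>i<n. (\<phi> i \<longlongrightarrow> c i * \<phi> 0 0) at_top)"
    by blast
  define d where "d = (if n = 0 then 1 else - (\<Sum>k<n. T k n * c k) / T n n)"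
  show ?case
  proof (intro exI[of _ "c(n := d)"] allI impI)
    fix \<phi> i
    assume sol: "\<forall>i<Suc n. continuous_on {0..} (\<phi> i) \<and>
      (\<forall>t>0. (\<phi> i has_vector_derivative (\<Sum>k\<le>i. T k i * \<phi> k t)) (at t))" and i: "i < Suc n"
    have IH: "(\<phi> i \<longlongrightarrow> c i * \<phi> 0 0) at_top" if "i < n" for i
      using c[of \<phi>, THEN spec, of i] sol that by (simp add: less_Suc_eq)
    have "(\<phi> n \<longlongrightarrow> d * \<phi> 0 0) at_top"
    proof (cases "n = 0")
      case True
      have sol0: "continuous_on {0..} (\<phi> 0)"
          "\<And>t. 0 < t \<Longrightarrow> (\<phi> 0 has_vector_derivative 0) (at t)"
        using sol[THEN spec, of 0] T0 by simp_all
      have "\<phi> 0 t = \<phi> 0 0" if "0 \<le> t" for t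
      proof (rule has_derivative_zero_unique_strong_interval[of "{0}" 0 t "\<phi> 0" "\<phi> 0 0" t])
        show "finite {0 :: real}" "\<phi> 0 0 = \<phi> 0 0" "t \<in> {0..t}" using that by simp_all
        show "continuous_on {0..t} (\<phi> 0)"
          by (rule continuous_on_subset[OF sol0(1)]) auto
        fix s assume "s \<in> {0..t} - {0}"
        hence "(\<phi> 0 has_vector_derivative 0) (at s)"
          by (intro sol0(2)) auto
        thus "(\<phi> 0 has_derivative (\<lambda>h. 0)) (at s within {0..t})"
          by (simp add: has_vector_derivative_def has_derivative_at_withinI)
      qed
      hence "\<forall>\<^sub>F t in at_top. \<phi> 0 t = \<phi> 0 0"
        by (intro eventually_mono[OF eventually_ge_at_top[of 0]])
      thus ?thesis using True by (simp add: d_def tendsto_eventually)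
    next
      case False
      have "(\<phi> n \<longlongrightarrow> - (\<Sum>k<n. T k n * (c k * \<phi> 0 0)) / T n n) at_top"
      proof (rule stable_scalar_ode_tendsto)
        fix t :: real assume "0 < t"
        thus "(\<phi> n has_vector_derivative T n n * \<phi> n t + (\<Sum>k<n. T k n * \<phi> k t)) (at t)"
          using sol[THEN spec, of n] by (simp add: lessThan_Suc_atMost[symmetric] add.commute)
      next
        show "((\<lambda>t. \<Sum>k<n. T k n * \<phi> k t) \<longlongrightarrow> (\<Sum>k<n. T k n * (c k * \<phi> 0 0))) at_top"
          by (intro tendsto_intros IH) auto
        show "Re (T n n) < 0" using Suc.prems False by simp
      qed
      thus ?thesis using False by (simp add: d_def sum_distrib_right mult.assoc)
    qed
    thus "(\<phi> i \<longlongrightarrow> (c(n := d)) i * \<phi> 0 0) at_top"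
      using IH i by (auto simp: less_Suc_eq)
  qed
qed

text \<open>The Schur decomposition realises the eigenvalues on the diagonal in any prescribed order. With \<open>0\<close>
  in front, the neutral direction is not driven by anything and stays constant.\<close>

lemma schur_with_leading_zero:
  fixes A :: "complex mat"
  assumes A: "A \<in> carrier_mat n n"
    and simple: "Polynomial.order 0 (char_poly A) = 1"
    and stable: "\<And>z. eigenvalue A z \<Longrightarrow> z \<noteq> 0 \<Longrightarrow> Re z < 0"
  obtains B P Q where "similar_mat_wit A B P Q" "upper_triangular B"
    "0 < n" "B $$ (0, 0) = 0" "\<And>i. 0 < i \<Longrightarrow> i < n \<Longrightarrow> Re (B $$ (i, i)) < 0"
proof -
  obtain as where as: "char_poly A = (\<Prod>a\<leftarrow>as. [:- a, 1:])" and len: "length as = n"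
    using char_poly_factorized[OF A] by auto
  have root: "eigenvalue A z \<longleftrightarrow> z \<in> set as" for z
    by (auto simp: eigenvalue_root_char_poly[OF A] as poly_prod_list prod_list_zero_iff)
  have nz: "char_poly A \<noteq> 0" using degree_monic_char_poly[OF A] by auto
  have "poly (char_poly A) 0 = 0"
    using simple nz order_root by fastforce
  hence "0 \<in> set as" by (auto simp: as poly_prod_list prod_list_zero_iff)
  define bs where "bs = remove1 0 as"
  have perm: "mset as = mset (0 # bs)"
    using \<open>0 \<in> set as\<close> by (simp add: bs_def)
  \<comment> \<open>The characteristic polynomial does not see the order of its roots, so \<open>0\<close> may be moved to the front.\<close>
  have cp: "char_poly A = (\<Prod>a\<leftarrow>0 # bs. [:- a, 1:])"
  proof -
    have "mset (map (\<lambda>a. [:- a, 1:]) as) = mset (map (\<lambda>a. [:- a, 1:]) (0 # bs))"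
      using perm by simp
    thus ?thesis unfolding as by (metis prod_mset_prod_list)
  qed
  let ?q = "\<Prod>a\<leftarrow>bs. [:- a, 1:]"
  have "[:0, 1:] * ?q \<noteq> 0" using nz cp by simp
  hence "Polynomial.order 0 (char_poly A) = Polynomial.order 0 [:0, 1 :: complex:] + Polynomial.order 0 ?q"
    unfolding cp list.map prod_list.Cons by (subst order_mult) simp_all
  moreover have "Polynomial.order 0 [:0, 1 :: complex:] = 1"
    using order_power_n_n[of "0 :: complex" 1] by simp
  ultimately have "Polynomial.order 0 ?q = 0" using simple by simp
  hence "poly ?q 0 \<noteq> 0" using nz cp order_root[of ?q 0] by auto
  hence "0 \<notin> set bs" by (auto simp: poly_prod_list prod_list_zero_iff)
  have neg: "Re z < 0" if "z \<in> set bs" for z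
  proof -
    have "set as = insert 0 (set bs)" using arg_cong[OF perm, of set_mset] by simp
    hence "eigenvalue A z" using that root by simp
    thus ?thesis using stable \<open>0 \<notin> set bs\<close> that by metis
  qed
  obtain B P Q where dec: "schur_decomposition A (0 # bs) = (B, P, Q)"
    by (cases "schur_decomposition A (0 # bs)") auto
  note S = schur_decomposition[OF A cp dec]
  have B: "B \<in> carrier_mat n n" using S similar_mat_witD2[OF A] by blast
  have "length (0 # bs) = n" using perm len by (metis mset_eq_length)
  hence diag: "B $$ (i, i) = (0 # bs) ! i" if "i < n" for i
    using S B that by (metis carrier_matD(1) diag_mat_def add.left_neutral diff_zero nth_map_upt)
  have n0: "0 < n" using \<open>length (0 # bs) = n\<close> by auto
  show ?thesis
  proof (rule that)
    show "Re (B $$ (i, i)) < 0" if "0 < i" "i < n" for i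
      using that diag[of i] \<open>length (0 # bs) = n\<close> by (auto intro!: neg simp: nth_Cons')
    show "similar_mat_wit A B P Q" "upper_triangular B" using S by blast+
    show "0 < n" by (rule n0)
    show "B $$ (0, 0) = 0" using diag[OF n0] by simp
  qed
qed

text \<open>Pairing a solution with the columns of the Schur basis \<open>P\<close> gives a solution of a triangular system; its
  first coordinate at time \<open>0\<close> is the functional \<open>\<alpha>\<close>.\<close>

lemma linear_system_tendsto_rank_one:
  fixes G :: "real mat"
  assumes G: "G \<in> carrier_mat n n"
    and stable: "\<And>z. eigenvalue (map_mat complex_of_real G) z \<Longrightarrow> z \<noteq> 0 \<Longrightarrow> Re z < 0"
    and simple: "Polynomial.order 0 (char_poly (map_mat complex_of_real G)) = 1"
  shows "\<exists>\<kappa> \<alpha>. \<forall>u.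
    (\<forall>j<n. continuous_on {0..} (u j) \<and>
       (\<forall>t>0. (u j has_real_derivative (\<Sum>i<n. G $$ (i, j) * u i t)) (at t))) \<longrightarrow>
    (\<forall>j<n. ((\<lambda>t. complex_of_real (u j t)) \<longlongrightarrow> \<kappa> j * (\<Sum>i<n. \<alpha> i * of_real (u i 0))) at_top)"
proof -
  let ?A = "map_mat complex_of_real G"
  have A: "?A \<in> carrier_mat n n" using G by simp
  obtain B P Q where sim: "similar_mat_wit ?A B P Q" and B: "upper_triangular B"
    "0 < n" "B $$ (0, 0) = 0" "\<And>i. 0 < i \<Longrightarrow> i < n \<Longrightarrow> Re (B $$ (i, i)) < 0"
    using schur_with_leading_zero[OF A simple stable] by blast
  note S = similar_mat_witD2[OF A sim]
  have "?A * P = P * B * Q * P" using S(3) by simp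
  also have "\<dots> = P * B * (Q * P)"
    using S by (intro assoc_mult_mat[of _ n n _ n _ n] mult_carrier_mat)
  also have "\<dots> = P * B"
    unfolding S(2) by (rule right_mult_one_mat[of _ n n]) (use S in auto)
  finally have "?A * P = P * B" .
  have AP: "(\<Sum>l<n. of_real (G $$ (m, l)) * P $$ (l, i)) = (\<Sum>k\<le>i. P $$ (m, k) * B $$ (k, i))"
    if "m < n" "i < n" for m i
  proof -
    have "(\<Sum>l<n. of_real (G $$ (m, l)) * P $$ (l, i)) = (?A * P) $$ (m, i)"
      using S(6) that G by (auto simp: scalar_prod_def atLeast0LessThan intro!: sum.cong)
    also have "\<dots> = (\<Sum>k<n. P $$ (m, k) * B $$ (k, i))"
      unfolding \<open>?A * P = P * B\<close> using S(5,6) that by (auto simp: scalar_prod_def atLeast0LessThan intro!: sum.cong)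
    also have "\<dots> = (\<Sum>k\<le>i. P $$ (m, k) * B $$ (k, i))"
      using that B(1) S by (intro sum.mono_neutral_right) (auto simp: upper_triangular_def)
    finally show ?thesis .
  qed
  have PQ: "(\<Sum>i<n. P $$ (l, i) * Q $$ (i, j)) = (if l = j then 1 else 0)" if "l < n" "j < n" for l j
  proof -
    have "(\<Sum>i<n. P $$ (l, i) * Q $$ (i, j)) = (P * Q) $$ (l, j)"
      using S(6,7) that by (auto simp: scalar_prod_def atLeast0LessThan intro!: sum.cong)
    thus ?thesis using S(1) that by simp
  qed
  obtain c where c: "\<And>\<phi>. (\<forall>i<n. continuous_on {0..} (\<phi> i) \<and>
             (\<forall>t>0. (\<phi> i has_vector_derivative (\<Sum>k\<le>i. B $$ (k, i) * \<phi> k t)) (at t))) \<Longrightarrow>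
           (\<forall>i<n. (\<phi> i \<longlongrightarrow> c i * \<phi> 0 0) at_top)"
    using triangular_system_tendsto[of "\<lambda>k i. B $$ (k, i)" n] B by blast
  show ?thesis
  proof (rule exI[of _ "\<lambda>j. \<Sum>i<n. Q $$ (i, j) * c i"], rule exI[of _ "\<lambda>l. P $$ (l, 0)"],
      intro allI impI)
    fix u :: "nat \<Rightarrow> real \<Rightarrow> real" and j
    assume sol: "\<forall>j<n. continuous_on {0..} (u j) \<and>
       (\<forall>t>0. (u j has_real_derivative (\<Sum>i<n. G $$ (i, j) * u i t)) (at t))" and j: "j < n"
    have cont: "continuous_on {0..} (u j)"
      and deriv: "0 < t \<Longrightarrow> (u j has_real_derivative (\<Sum>i<n. G $$ (i, j) * u i t)) (at t)"
      if "j < n" for j t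
      using sol that by blast+
    define \<phi> where "\<phi> i t = (\<Sum>l<n. P $$ (l, i) * complex_of_real (u l t))" for i t
    have "\<forall>i<n. (\<phi> i \<longlongrightarrow> c i * \<phi> 0 0) at_top"
    proof (rule c, intro allI impI conjI)
      fix i assume i: "i < n"
      show "continuous_on {0..} (\<phi> i)"
        unfolding \<phi>_def by (intro continuous_intros cont) auto
      fix t :: real assume t: "0 < t"
      have "(\<phi> i has_vector_derivative
              (\<Sum>l<n. P $$ (l, i) * of_real (\<Sum>m<n. G $$ (m, l) * u m t))) (at t)"
        unfolding \<phi>_def using t
        by (intro has_vector_derivative_sum has_vector_derivative_mult_right
             has_vector_derivative_of_real deriv) auto
      also have "(\<Sum>l<n. P $$ (l, i) * of_real (\<Sum>m<n. G $$ (m, l) * u m t))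
        = (\<Sum>m<n. (\<Sum>l<n. of_real (G $$ (m, l)) * P $$ (l, i)) * of_real (u m t))"
        by (simp add: sum_distrib_left sum_distrib_right, subst sum.swap) (simp add: mult_ac)
      also have "\<dots> = (\<Sum>m<n. (\<Sum>k\<le>i. P $$ (m, k) * B $$ (k, i)) * of_real (u m t))"
        using i by (intro sum.cong) (auto simp: AP)
      also have "\<dots> = (\<Sum>k\<le>i. B $$ (k, i) * \<phi> k t)"
        unfolding \<phi>_def by (simp add: sum_distrib_left sum_distrib_right, subst sum.swap) (simp add: mult_ac)
      finally show "(\<phi> i has_vector_derivative (\<Sum>k\<le>i. B $$ (k, i) * \<phi> k t)) (at t)" .
    qed
    hence "((\<lambda>t. \<Sum>i<n. Q $$ (i, j) * \<phi> i t) \<longlongrightarrow> (\<Sum>i<n. Q $$ (i, j) * (c i * \<phi> 0 0))) at_top"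
      by (intro tendsto_intros) auto
    moreover have "(\<Sum>i<n. Q $$ (i, j) * \<phi> i t) = of_real (u j t)" for t
    proof -
      have "(\<Sum>i<n. Q $$ (i, j) * \<phi> i t) = (\<Sum>l<n. (\<Sum>i<n. P $$ (l, i) * Q $$ (i, j)) * of_real (u l t))"
        unfolding \<phi>_def by (simp add: sum_distrib_left sum_distrib_right, subst sum.swap) (simp add: mult_ac)
      also have "\<dots> = (\<Sum>l<n. if l = j then of_real (u l t) else 0)"
        using j by (intro sum.cong) (auto simp: PQ)
      finally show ?thesis using j by simp
    qed
    ultimately show "((\<lambda>t. complex_of_real (u j t)) \<longlongrightarrow>
        (\<Sum>i<n. Q $$ (i, j) * c i) * (\<Sum>i<n. P $$ (i, 0) * of_real (u i 0))) at_top"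
      by (simp add: \<phi>_def sum_distrib_right mult.assoc)
  qed
qed

text \<open>Gronwall's argument: the squared norm of the difference of two solutions, discounted at a suitable
  exponential rate, is nonincreasing and starts at \<open>0\<close>.\<close>

lemma linear_system_unique:
  fixes u v :: "nat \<Rightarrow> real \<Rightarrow> real" and g :: "nat \<Rightarrow> nat \<Rightarrow> real"
  assumes cont: "\<And>j. j < n \<Longrightarrow> continuous_on {0..} (u j)" "\<And>j. j < n \<Longrightarrow> continuous_on {0..} (v j)"
    and deriv: "\<And>j t. j < n \<Longrightarrow> 0 < t \<Longrightarrow> (u j has_real_derivative (\<Sum>i<n. g i j * u i t)) (at t)"
      "\<And>j t. j < n \<Longrightarrow> 0 < t \<Longrightarrow> (v j has_real_derivative (\<Sum>i<n. g i j * v i t)) (at t)"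
    and init: "\<And>j. j < n \<Longrightarrow> u j 0 = v j 0" and j: "j < n" and t: "0 \<le> t"
  shows "u j t = v j t"
proof -
  define d where "d j t = u j t - v j t" for j t
  have dd: "(d j has_real_derivative (\<Sum>i<n. g i j * d i t)) (at t)" if "j < n" "0 < t" for j t
    unfolding d_def using deriv(1)[OF that] deriv(2)[OF that]
    by (auto intro!: derivative_eq_intros simp: sum_subtractf algebra_simps)
  define K where "K = (\<Sum>i<n. \<Sum>j<n. \<bar>g i j\<bar>)"
  have gK: "\<bar>g i j\<bar> \<le> K" if "i < n" "j < n" for i j
  proof -
    have "\<bar>g i j\<bar> \<le> (\<Sum>j<n. \<bar>g i j\<bar>)" using that by (intro member_le_sum) auto
    also have "\<dots> \<le> K" unfolding K_def
      using that by (intro member_le_sum[of i _ "\<lambda>i. \<Sum>j<n. \<bar>g i j\<bar>"]) (auto intro: sum_nonneg)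
    finally show ?thesis .
  qed
  have K0: "0 \<le> K" unfolding K_def by (intro sum_nonneg) auto
  define y where "y t = (\<Sum>j<n. (d j t)\<^sup>2)" for t
  define y' where "y' t = (\<Sum>j<n. 2 * d j t * (\<Sum>i<n. g i j * d i t))" for t
  have dy: "(y has_real_derivative y' t) (at t)" if "0 < t" for t
    unfolding y_def y'_def
    by (rule DERIV_sum) (auto intro!: derivative_eq_intros dd that simp: algebra_simps)
  have y': "y' t \<le> 2 * n * K * y t" for t
  proof -
    have "y' t = (\<Sum>j<n. \<Sum>i<n. g i j * (2 * d j t * d i t))"
      unfolding y'_def by (simp add: sum_distrib_left algebra_simps)
    also have "\<dots> \<le> (\<Sum>j<n. \<Sum>i<n. K * ((d j t)\<^sup>2 + (d i t)\<^sup>2))"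
    proof (intro sum_mono)
      fix i j assume "j \<in> {..<n}" "i \<in> {..<n}"
      have "g i j * (2 * d j t * d i t) \<le> \<bar>g i j\<bar> * \<bar>2 * d j t * d i t\<bar>"
        by (metis abs_ge_self abs_mult)
      also have "\<dots> \<le> K * ((d j t)\<^sup>2 + (d i t)\<^sup>2)"
      proof (rule mult_mono)
        show "\<bar>2 * d j t * d i t\<bar> \<le> (d j t)\<^sup>2 + (d i t)\<^sup>2"
          using sum_squares_bound[of "\<bar>d j t\<bar>" "\<bar>d i t\<bar>"] by (simp add: abs_mult)
      qed (use gK K0 \<open>j \<in> _\<close> \<open>i \<in> _\<close> in auto)
      finally show "g i j * (2 * d j t * d i t) \<le> K * ((d j t)\<^sup>2 + (d i t)\<^sup>2)" .
    qed
    also have "\<dots> = 2 * n * K * y t"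
      by (simp add: y_def distrib_left sum.distrib sum_distrib_left[symmetric])
    finally show ?thesis .
  qed
  let ?z = "\<lambda>t. exp (- (2 * n * K * t)) * y t"
  have "?z t \<le> ?z 0"
  proof (cases "t = 0")
    case False
    show ?thesis
    proof (rule DERIV_nonpos_imp_decreasing_open[of 0 t ?z])
      show "0 \<le> t" by fact
      have "continuous_on {0..t} (d j)" if "j < n" for j
        unfolding d_def
        by (intro continuous_on_diff continuous_on_subset[OF cont(1)[OF that]]
              continuous_on_subset[OF cont(2)[OF that]]) auto
      hence "continuous_on {0..t} y" unfolding y_def
        by (intro continuous_on_sum continuous_on_power) auto
      thus "continuous_on {0..t} ?z"
        by (intro continuous_on_mult continuous_intros) auto
      fix s assume s: "0 < s" "s < t"
      have "(?z has_real_derivative exp (- (2 * n * K * s)) * (y' s - 2 * n * K * y s)) (at s)"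
        using s by (auto intro!: derivative_eq_intros dy simp: right_diff_distrib)
      moreover have "exp (- (2 * n * K * s)) * (y' s - 2 * n * K * y s) \<le> 0"
        using y'[of s] by (intro mult_nonneg_nonpos) auto
      ultimately show "\<exists>d. (?z has_real_derivative d) (at s) \<and> d \<le> 0" by blast
    qed
  qed simp
  moreover have "?z 0 = 0" using init by (simp add: y_def d_def)
  ultimately have "y t \<le> 0" by (simp add: mult_le_0_iff)
  moreover have "(d j t)\<^sup>2 \<le> y t"
    unfolding y_def using j by (intro member_le_sum) auto
  ultimately have "(d j t)\<^sup>2 \<le> 0" by linarith
  thus ?thesis by (simp add: d_def)
qed

section \<open>Markov chains with a finite state space\<close>

locale finite_stochastic_matrix =
  fixes S :: "'s set" and q :: "'s \<Rightarrow> 's \<Rightarrow> real"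
  assumes finite_states: "finite S" and states_nonempty: "S \<noteq> {}"
    and nonneg: "\<And>x y. x \<in> S \<Longrightarrow> y \<in> S \<Longrightarrow> 0 \<le> q x y"
    and row_sum: "\<And>x. x \<in> S \<Longrightarrow> (\<Sum>y\<in>S. q x y) = 1"
begin

definition transition :: "('s \<Rightarrow> real) \<Rightarrow> 's \<Rightarrow> real" where
  "transition f x = (\<Sum>y\<in>S. q x y * f y)"

definition kernel :: "'s \<Rightarrow> 's measure" where
  "kernel x = point_measure S (\<lambda>y. ennreal (q x y))"

definition paths :: "(nat \<Rightarrow> 's) measure" where
  "paths = PiM UNIV (\<lambda>_. count_space S)"

abbreviation past :: "nat \<Rightarrow> (nat \<Rightarrow> 's) measure" where
  "past n \<equiv> PiM {0..<n} (\<lambda>_. count_space S)"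

lemma past_eq: "past n = count_space (PiE {0..<n} (\<lambda>_. S))"
  by (rule count_space_PiM_finite) (auto intro: finite_states countable_finite)

lemma finite_PiE_states: "finite (PiE {0..<n :: nat} (\<lambda>_. S))"
  by (intro finite_PiE) (auto intro: finite_states)

lemma space_kernel [simp]: "space (kernel x) = S"
  and sets_kernel [simp]: "sets (kernel x) = Pow S"
  by (auto simp: kernel_def space_point_measure sets_point_measure)

lemma prob_space_kernel: "x \<in> S \<Longrightarrow> prob_space (kernel x)"
  by (rule prob_spaceI)
     (simp add: kernel_def emeasure_point_measure_finite finite_states space_point_measure sum_ennreal
        nonneg row_sum)

lemma integral_kernel:
  assumes "x \<in> S"
  shows "(\<integral>y. f y \<partial>kernel x) = transition f x"
  unfolding kernel_def transition_def using assms nonneg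
  by (subst lebesgue_integral_point_measure_finite) (auto simp: finite_states)

lemma measurable_kernel: "kernel \<in> count_space S \<rightarrow>\<^sub>M subprob_algebra (count_space S)"
  by (auto simp: space_subprob_algebra intro!: prob_space_imp_subprob_space prob_space_kernel)

text \<open>The law of the chain comes from the Ionescu-Tulcea theorem. The last property is the Markov property
  for one step: since \<open>S\<close> is finite, every function of the first \<open>n + 1\<close> coordinates is a measurable
  test function.\<close>

lemma markov_law_exists:
  assumes x: "x \<in> S"
  obtains L where "prob_space L" "sets L = sets paths" "AE \<omega> in L. \<omega> 0 = x"
    "\<And>n \<phi> f. (\<integral>\<omega>. \<phi> (restrict \<omega> {0..<Suc n}) * f (\<omega> (Suc n)) \<partial>L)
             = (\<integral>\<omega>. \<phi> (restrict \<omega> {0..<Suc n}) * transition f (\<omega> n) \<partial>L :: real)"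
proof -
  \<comment> \<open>Step \<open>0\<close> puts the chain at \<open>x\<close>; every later step depends on the previous state only.\<close>
  define R where "R n \<omega> = (if n = 0 then return (count_space S) x else kernel (\<omega> (n - 1)))"
    for n :: nat and \<omega> :: "nat \<Rightarrow> 's"
  interpret IT: Ionescu_Tulcea R "\<lambda>_. count_space S"
  proof (rule Ionescu_Tulcea.intro)
    fix i :: nat
    show "R i \<in> measurable (past i) (subprob_algebra (count_space S))"
    proof (cases i)
      case 0
      thus ?thesis using x
        by (auto simp: R_def[abs_def] space_subprob_algebra
          intro!: measurable_const prob_space_imp_subprob_space prob_space_return)
    next
      case (Suc m)
      have "(\<lambda>\<omega>. kernel (\<omega> m)) \<in> measurable (past i) (subprob_algebra (count_space S))"
        by (rule measurable_compose[OF _ measurable_kernel], rule measurable_component_singleton)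
           (simp add: Suc)
      thus ?thesis by (simp add: R_def[abs_def] Suc)
    qed
    fix \<omega> assume "\<omega> \<in> space (past i)"
    thus "prob_space (R i \<omega>)" using x by (cases i)
        (auto simp: R_def space_PiM PiE_iff intro!: prob_space_return prob_space_kernel)
  qed
  let ?L = "IT.PF.lim" and ?C = "\<lambda>n. IT.C 0 n (\<lambda>_. undefined)"
  have sets: "sets ?L = sets paths" by (simp add: paths_def)
  have undef: "(\<lambda>_. undefined) \<in> space (past 0)" by (simp add: space_PiM)
  \<comment> \<open>The marginals of the limit measure are the iterated kernels, so expectations of functions of finitely many coordinates can be computed step by step.\<close>
  have marginal: "distr ?L (past m) (\<lambda>\<omega>. restrict \<omega> {0..<m}) = ?C m" for m
  proof -
    have up: "IT.up_to {0..<m} = m"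
      using IT.up_to_iff[of "{0..<m}" m] IT.up_to_iff[of "{0..<m}" "IT.up_to {0..<m}"]
      by (intro antisym) (auto simp: not_less[symmetric])
    have "distr ?L (past m) (\<lambda>\<omega>. restrict \<omega> {0..<m}) = IT.CI {0..<m}"
      by (rule IT.distr_lim) simp
    also have "\<dots> = ?C m"
      using IT.distr_C[of m m "\<lambda>_. undefined" 0] undef by (simp add: IT.CI_def up)
    finally show ?thesis .
  qed
  have meas: "(\<lambda>\<omega>. restrict \<omega> {0..<m}) \<in> measurable ?L (past m)" for m
    by (simp add: measurable_cong_sets[OF IT.PF.sets_lim refl] measurable_restrict)
  have prob: "prob_space ?L"
  proof (rule prob_space_distrD[OF meas[of 0]])
    show "prob_space (distr ?L (past 0) (\<lambda>\<omega>. restrict \<omega> {0..<0}))"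
      unfolding marginal by (rule IT.prob_space_C[OF undef])
  qed
  have int: "(\<integral>\<omega>. g (restrict \<omega> {0..<m}) \<partial>?L) = (\<integral>\<omega>. g \<omega> \<partial>?C m)" for m and g :: "_ \<Rightarrow> real"
    unfolding marginal[symmetric]
    by (rule integral_distr[OF meas, symmetric]) (simp add: past_eq)
  have start: "AE \<omega> in ?L. \<omega> 0 = x"
  proof -
    have "?C 1 = IT.eP 0 (\<lambda>_. undefined)"
      using bind_return[OF IT.measurable_eP[of 0] undef] by simp
    moreover have "AE \<omega> in IT.eP 0 (\<lambda>_. undefined). \<omega> 0 = x"
    proof -
      have upd: "fun_upd (\<lambda>_. undefined) 0 \<in> measurable (R 0 (\<lambda>_. undefined)) (past (Suc 0))"
        using x by (auto simp: R_def space_PiM PiE_iff extensional_def past_eq)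
      have "AE y in return (count_space S) x. y = x"
        using x by (subst AE_return) auto
      moreover have "R 0 (\<lambda>_. undefined) = return (count_space S) x" by (simp add: R_def)
      ultimately have "AE y in R 0 (\<lambda>_. undefined). y = x" by (simp only:)
      thus ?thesis
        unfolding IT.eP_def by (subst AE_distr_iff[OF upd]) (simp_all add: past_eq)
    qed
    ultimately have "AE \<omega> in ?C 1. \<omega> 0 = x" by (simp only:)
    hence "AE \<omega> in distr ?L (past 1) (\<lambda>\<omega>. restrict \<omega> {0..<1}). \<omega> 0 = x"
      by (simp only: marginal)
    thus ?thesis by (subst (asm) AE_distr_iff[OF meas]) (auto simp: past_eq)
  qed
  have step: "(\<integral>\<omega>. \<phi> (restrict \<omega> {0..<Suc n}) * f (\<omega> (Suc n)) \<partial>?L)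
            = (\<integral>\<omega>. \<phi> (restrict \<omega> {0..<Suc n}) * transition f (\<omega> n) \<partial>?L)"
    for n and \<phi> :: "_ \<Rightarrow> real" and f
  proof -
    let ?g = "\<lambda>\<omega>. \<phi> (restrict \<omega> {0..<Suc n}) * f (\<omega> (Suc n))"
    have "(\<integral>\<omega>. ?g \<omega> \<partial>?L) = (\<integral>\<omega>. ?g (restrict \<omega> {0..<Suc (Suc n)}) \<partial>?L)"
      by (simp add: Int_absorb2)
    also have "\<dots> = (\<integral>\<omega>. ?g \<omega> \<partial>?C (Suc (Suc n)))" by (rule int)
    also have "\<dots> = (\<integral>\<omega>. \<integral>\<omega>'. ?g \<omega>' \<partial>IT.eP (Suc n) \<omega> \<partial>?C (Suc n))"
    proof -
      have "?C (Suc (Suc n)) = ?C (Suc n) \<bind> IT.eP (Suc n)" by simp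
      moreover have "(\<integral>\<omega>. ?g \<omega> \<partial>(?C (Suc n) \<bind> IT.eP (Suc n))) = (\<integral>\<omega>. \<integral>\<omega>'. ?g \<omega>' \<partial>IT.eP (Suc n) \<omega> \<partial>?C (Suc n))"
      proof (rule integral_bind[where K = "past (Suc (Suc n))" and B' = 1
              and B = "Max ((\<lambda>\<omega>. \<bar>?g \<omega>\<bar>) ` space (past (Suc (Suc n))))"])
        show "?g \<in> borel_measurable (past (Suc (Suc n)))" by (simp add: past_eq)
        show "\<bar>?g \<omega>\<bar> \<le> Max ((\<lambda>\<omega>. \<bar>?g \<omega>\<bar>) ` space (past (Suc (Suc n))))"
          if "\<omega> \<in> space (past (Suc (Suc n)))" for \<omega>
          by (rule Max_ge, rule finite_imageI) (use that in \<open>auto simp: past_eq finite_PiE_states\<close>)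
        show "IT.eP (Suc n) \<in> ?C (Suc n) \<rightarrow>\<^sub>M subprob_algebra (past (Suc (Suc n)))"
          using IT.measurable_eP[of "Suc n"] IT.sets_C[OF undef, of "Suc n"]
          by (simp cong: measurable_cong_sets)
        show "finite_measure (?C (Suc n))"
          by (rule prob_space.axioms(1)[OF IT.prob_space_C[OF undef]])
        show "AE \<omega> in ?C (Suc n). emeasure (IT.eP (Suc n) \<omega>) (space (IT.eP (Suc n) \<omega>)) \<le> ennreal 1"
          using IT.prob_space_eP[of _ "Suc n"] IT.space_C[OF undef, of "Suc n"]
          by (intro AE_I2) (simp add: prob_space.emeasure_space_1)
      qed
      ultimately show ?thesis by metis
    qed
    also have "\<dots> = (\<integral>\<omega>. \<phi> \<omega> * transition f (\<omega> n) \<partial>?C (Suc n))"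
    proof (rule Bochner_Integration.integral_cong)
      fix \<omega> assume "\<omega> \<in> space (?C (Suc n))"
      hence \<omega>: "\<omega> \<in> space (past (Suc n))" using IT.space_C[OF undef, of "Suc n"] by simp
      show "(\<integral>\<omega>'. ?g \<omega>' \<partial>IT.eP (Suc n) \<omega>) = \<phi> \<omega> * transition f (\<omega> n)"
      proof -
        have state: "\<omega> n \<in> S" using \<omega> by (auto simp: space_PiM)
        have R: "R (Suc n) \<omega> = kernel (\<omega> n)" by (simp add: R_def)
        have upd: "fun_upd \<omega> (Suc n) \<in> measurable (kernel (\<omega> n)) (past (Suc (Suc n)))"
        proof -
          have "fun_upd \<omega> (Suc n) \<in> count_space S \<rightarrow>\<^sub>M past (Suc (Suc n))"
            using \<omega> by (auto simp: past_eq PiE_iff extensional_def)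
          thus ?thesis by (subst measurable_cong_sets[of _ "count_space S" _ "past (Suc (Suc n))"]) simp_all
        qed
        have "restrict (fun_upd \<omega> (Suc n) y) {0..<Suc n} = \<omega>" for y
          using \<omega> by (auto simp: space_PiM PiE_iff extensional_def restrict_def)
        hence "(\<integral>\<omega>'. ?g \<omega>' \<partial>IT.eP (Suc n) \<omega>) = (\<integral>y. \<phi> \<omega> * f y \<partial>kernel (\<omega> n))"
          unfolding IT.eP_def R by (subst integral_distr[OF upd]) (simp_all add: past_eq)
        also have "\<dots> = \<phi> \<omega> * transition f (\<omega> n)"
          using integral_kernel[OF state] by simp
        finally show ?thesis .
      qed
    qed simp
    also have "\<dots> = (\<integral>\<omega>. \<phi> (restrict \<omega> {0..<Suc n}) * transition f (\<omega> n) \<partial>?L)"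
      by (subst int[symmetric]) simp
    finally show ?thesis .
  qed
  show ?thesis by (rule that[OF prob sets start step])
qed

text \<open>Functions of the first \<open>n + 1\<close> coordinates are also functions of the first \<open>n + m + 1\<close> ones, so the one-step
  property can be applied \<open>m\<close> times.\<close>

lemma transition_power_in_expectation:
  fixes \<phi> :: "_ \<Rightarrow> real"
  assumes step: "\<And>n \<phi> f. (\<integral>\<omega>. \<phi> (restrict \<omega> {0..<Suc n}) * f (\<omega> (Suc n)) \<partial>L)
             = (\<integral>\<omega>. \<phi> (restrict \<omega> {0..<Suc n}) * transition f (\<omega> n) \<partial>L :: real)"
  shows "(\<integral>\<omega>. \<phi> (restrict \<omega> {0..<Suc n}) * f (\<omega> (n + m)) \<partial>L)
           = (\<integral>\<omega>. \<phi> (restrict \<omega> {0..<Suc n}) * (transition ^^ m) f (\<omega> n) \<partial>L)"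
proof (induction m arbitrary: f)
  case (Suc m)
  have "(\<integral>\<omega>. \<phi> (restrict \<omega> {0..<Suc n}) * f (\<omega> (n + Suc m)) \<partial>L)
      = (\<integral>\<omega>. \<phi> (restrict \<omega> {0..<Suc n}) * transition f (\<omega> (n + m)) \<partial>L)"
    using step[of "\<lambda>\<omega>. \<phi> (restrict \<omega> {0..<Suc n})" "n + m" f]
    by (simp add: Int_absorb1)
  also note Suc.IH[of "transition f"]
  finally show ?case by (simp only: funpow_Suc_right o_apply)
qed simp


definition history :: "nat \<Rightarrow> (nat \<Rightarrow> 's) measure" where
  "history n = vimage_algebra (space paths) (\<lambda>\<omega>. restrict \<omega> {0..<Suc n}) (past (Suc n))"

lemma restrict_in_past: "\<omega> \<in> space paths \<Longrightarrow> restrict \<omega> {0..<n} \<in> space (past n)"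
  by (auto simp: paths_def space_PiM)

lemma space_history [simp]: "space (history n) = space paths"
  by (simp add: history_def)

text \<open>All subsets of the finite set of histories are measurable, hence \<open>B'\<close> is an arbitrary set.\<close>

lemma sets_history:
  "B \<in> sets (history n) \<longleftrightarrow> (\<exists>B'. B = {\<omega> \<in> space paths. restrict \<omega> {0..<Suc n} \<in> B'})"
proof
  assume "B \<in> sets (history n)"
  moreover have "(\<lambda>\<omega>. restrict \<omega> {0..<Suc n}) \<in> space paths \<rightarrow> space (past (Suc n))"
    using restrict_in_past by blast
  ultimately obtain B' where "B = (\<lambda>\<omega>. restrict \<omega> {0..<Suc n}) -` B' \<inter> space paths"
    unfolding history_def by (auto simp only: sets_vimage_algebra2)
  thus "\<exists>B'. B = {\<omega> \<in> space paths. restrict \<omega> {0..<Suc n} \<in> B'}"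
    by (intro exI[of _ B']) blast
next
  assume "\<exists>B'. B = {\<omega> \<in> space paths. restrict \<omega> {0..<Suc n} \<in> B'}"
  then obtain B' where "B = {\<omega> \<in> space paths. restrict \<omega> {0..<Suc n} \<in> B'}" by blast
  hence B: "B = (\<lambda>\<omega>. restrict \<omega> {0..<Suc n}) -` (B' \<inter> space (past (Suc n))) \<inter> space paths"
    using restrict_in_past by auto
  show "B \<in> sets (history n)"
    unfolding history_def B by (rule in_vimage_algebra) (simp add: past_eq)
qed

lemma sets_history_mono: "m \<le> n \<Longrightarrow> sets (history m) \<subseteq> sets (history n)"
proof
  fix B assume mn: "m \<le> n" and "B \<in> sets (history m)"
  then obtain B' where B: "B = {\<omega> \<in> space paths. restrict \<omega> {0..<Suc m} \<in> B'}"
    by (auto simp: sets_history)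
  have "restrict (restrict \<omega> {0..<Suc n}) {0..<Suc m} = restrict \<omega> {0..<Suc m}" for \<omega> :: "nat \<Rightarrow> 's"
    using mn by (simp add: Int_absorb1)
  hence "B = {\<omega> \<in> space paths. restrict \<omega> {0..<Suc n} \<in> {\<eta>. restrict \<eta> {0..<Suc m} \<in> B'}}"
    unfolding B by (simp del: restrict_restrict)
  thus "B \<in> sets (history n)" unfolding sets_history by blast
qed

lemma sets_history_subset: "sets (history n) \<subseteq> sets paths"
  unfolding history_def paths_def
  by (intro sets_image_in_sets measurable_restrict measurable_component_singleton) auto

lemma measurable_coordinate_history: "(\<lambda>\<omega>. \<omega> n) \<in> history n \<rightarrow>\<^sub>M count_space S"
proof -
  have "(\<lambda>\<omega>. restrict \<omega> {0..<Suc n}) \<in> history n \<rightarrow>\<^sub>M past (Suc n)"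
    unfolding history_def by (rule measurable_vimage_algebra1) (use restrict_in_past in auto)
  moreover have "(\<lambda>\<eta>. \<eta> n) \<in> past (Suc n) \<rightarrow>\<^sub>M count_space S"
    by (rule measurable_component_singleton) simp
  ultimately have "(\<lambda>\<omega>. restrict \<omega> {0..<Suc n} n) \<in> history n \<rightarrow>\<^sub>M count_space S"
    by (rule measurable_compose)
  thus ?thesis by simp
qed

lemma coordinate_in_states: "\<omega> \<in> space paths \<Longrightarrow> \<omega> n \<in> S"
  by (auto simp: paths_def space_PiM)

end

text \<open>The chain at time index \<open>l\<close> is observed at the real time \<open>l \<Delta>\<close>. The filtration is indexed by all real
  times, so time is rounded down to a multiple of \<open>\<Delta>\<close> (and negative times to \<open>0\<close>).\<close>

lemma markov_process_of_stochastic_matrix: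
  fixes S :: "'s::topological_space set" and \<Delta> :: real
  assumes "finite_stochastic_matrix S q" and \<Delta>: "0 < \<Delta>"
  obtains A :: "(nat \<Rightarrow> 's) measure" and F P Y where
    "markov_process A F (insert 0 {real l * \<Delta> | l. 0 < l}) S P Y"
    "\<And>x l (f :: 's \<Rightarrow> real). x \<in> S \<Longrightarrow> integrable (P x) (\<lambda>\<omega>. f (Y (real l * \<Delta>) \<omega>))"
    "\<And>x l f. x \<in> S \<Longrightarrow> (\<integral>\<omega>. f (Y (real l * \<Delta>) \<omega>) \<partial>P x)
        = (finite_stochastic_matrix.transition S q ^^ l) f x"
proof -
  interpret finite_stochastic_matrix S q by fact
  define is_law where "is_law x L \<longleftrightarrow> prob_space L \<and> sets L = sets paths \<and> (AE \<omega> in L. \<omega> 0 = x) \<and>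
      (\<forall>n \<phi> f. (\<integral>\<omega>. \<phi> (restrict \<omega> {0..<Suc n}) * f (\<omega> (Suc n)) \<partial>L)
             = (\<integral>\<omega>. \<phi> (restrict \<omega> {0..<Suc n}) * transition f (\<omega> n) \<partial>L :: real))" for x L
  have "\<exists>L. is_law x L" if "x \<in> S" for x
    by (rule markov_law_exists[OF that], rule exI) (unfold is_law_def, intro conjI allI)
  then obtain L where "\<And>x. x \<in> S \<Longrightarrow> is_law x (L x)"
    by metis
  hence L: "\<And>x. x \<in> S \<Longrightarrow> prob_space (L x)" "\<And>x. x \<in> S \<Longrightarrow> sets (L x) = sets paths"
      "\<And>x. x \<in> S \<Longrightarrow> AE \<omega> in L x. \<omega> 0 = x"
      "\<And>x n \<phi> f. x \<in> S \<Longrightarrow> (\<integral>\<omega>. \<phi> (restrict \<omega> {0..<Suc n}) * f (\<omega> (Suc n)) \<partial>L x)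
             = (\<integral>\<omega>. \<phi> (restrict \<omega> {0..<Suc n}) * transition f (\<omega> n) \<partial>L x :: real)"
    by (simp_all add: is_law_def)
  have space_L: "space (L x) = space paths" if "x \<in> S" for x
    using L(2)[OF that] by (rule sets_eq_imp_space_eq)
  have coord: "(\<lambda>\<omega>. \<omega> n) \<in> paths \<rightarrow>\<^sub>M count_space S" for n
    unfolding paths_def by (rule measurable_component_singleton) simp
  have integrable: "integrable (L x) (\<lambda>\<omega>. f (\<omega> n))" if x: "x \<in> S" for x n and f :: "'s \<Rightarrow> real"
  proof -
    interpret prob_space "L x" by (rule L(1)[OF x])
    show ?thesis
    proof (rule integrable_const_bound)
      show "AE \<omega> in L x. norm (f (\<omega> n)) \<le> Max ((\<lambda>y. norm (f y)) ` S)"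
        using coordinate_in_states[of _ n] finite_states by (intro AE_I2) (auto simp: space_L[OF x])
      have "(\<lambda>\<omega>. f (\<omega> n)) \<in> borel_measurable paths"
        by (rule measurable_compose[OF coord]) simp
      thus "(\<lambda>\<omega>. f (\<omega> n)) \<in> borel_measurable (L x)"
        by (simp add: measurable_cong_sets[OF L(2)[OF x] refl])
    qed
  qed
  have multistep: "(\<integral>\<omega>. \<phi> (restrict \<omega> {0..<Suc n}) * f (\<omega> (n + m)) \<partial>L x)
      = (\<integral>\<omega>. \<phi> (restrict \<omega> {0..<Suc n}) * (transition ^^ m) f (\<omega> n) \<partial>L x)"
    if "x \<in> S" for x n m f and \<phi> :: "_ \<Rightarrow> real"
    by (rule transition_power_in_expectation) (rule L(4)[OF that])
  have law: "(\<integral>\<omega>. f (\<omega> m) \<partial>L x) = (transition ^^ m) f x" if x: "x \<in> S" for x m f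
  proof -
    interpret prob_space "L x" by (rule L(1)[OF x])
    have "(\<integral>\<omega>. f (\<omega> m) \<partial>L x) = (\<integral>\<omega>. (transition ^^ m) f (\<omega> 0) \<partial>L x)"
      using multistep[OF x, of "\<lambda>_. 1" 0 f m] by simp
    also have "\<dots> = (\<integral>\<omega>. (transition ^^ m) f x \<partial>L x)"
      using L(3)[OF x] integrable[OF x, of "(transition ^^ m) f" 0]
      by (intro integral_cong_AE) (auto dest: borel_measurable_integrable)
    finally show ?thesis by (simp add: prob_space)
  qed
  define step where "step t = nat \<lfloor>t / \<Delta>\<rfloor>" for t
  have step_mult [simp]: "step (real l * \<Delta>) = l" for l
    using \<Delta> by (simp add: step_def)
  have step_mono: "s \<le> t \<Longrightarrow> step s \<le> step t" for s t
    unfolding step_def using \<Delta> by (intro nat_mono floor_mono divide_right_mono) auto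
  define I where "I = insert 0 {real l * \<Delta> | l. 0 < l}"
  have I: "t \<in> I \<longleftrightarrow> (\<exists>l. t = real l * \<Delta>)" for t
  proof
    assume "\<exists>l. t = real l * \<Delta>"
    then obtain l where "t = real l * \<Delta>" by blast
    thus "t \<in> I" by (cases "l = 0") (auto simp: I_def)
  qed (auto simp: I_def intro: exI[of _ 0])
  have "markov_process paths (\<lambda>t. history (step t)) I S L (\<lambda>t \<omega>. \<omega> (step t))"
  proof (intro markov_process.intro markov_process_axioms.intro filtration.intro)
    show "prob_space (L x)" "sets (L x) = sets paths" if "x \<in> S" for x
      using L that by simp_all
    show "space (history (step t)) = space paths" for t by simp
    show "sets (history (step s)) \<subseteq> sets (history (step t))" if "s \<le> t" for s t :: real
      by (intro sets_history_mono step_mono that)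
    show "0 \<in> I" "I \<subseteq> {0..}" using \<Delta> by (auto simp: I_def)
    show "t - s \<in> I" if st: "s \<in> I" "t \<in> I" "s \<le> t" for s t
    proof -
      obtain k l where "s = real k * \<Delta>" "t = real l * \<Delta>" using st I by blast
      moreover from this have "k \<le> l" using st(3) \<Delta> by simp
      ultimately have "t - s = real (l - k) * \<Delta>" by (simp add: of_nat_diff algebra_simps)
      thus ?thesis using I by blast
    qed
    show "sets (history (step t)) \<subseteq> sets paths" for t by (rule sets_history_subset)
    show "(\<lambda>\<omega>. \<omega> (step t)) \<in> history (step t) \<rightarrow>\<^sub>M borel" for t
      by (rule measurable_compose[OF measurable_coordinate_history]) simp
    show "\<omega> (step t) \<in> S" if "\<omega> \<in> space paths" for t \<omega>
      using that by (rule coordinate_in_states)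
    show "AE \<omega> in L x. \<omega> (step 0) = x" if "x \<in> S" for x
      using L(3)[OF that] by (simp add: step_def)
    show "AE \<omega> in L x. real_cond_exp (L x) (history (step s)) (\<lambda>\<omega>. f (\<omega> (step t))) \<omega>
              = (\<integral>\<omega>'. f (\<omega>' (step (t - s))) \<partial>L (\<omega> (step s)))"
      if x: "x \<in> S" and st: "s \<in> I" "t \<in> I" "s \<le> t" for x s t and f :: "'s \<Rightarrow> real"
    proof -
      obtain n k where n: "s = real n * \<Delta>" and k: "t = real k * \<Delta>" using st I by blast
      define m where "m = k - n"
      have nk: "n \<le> k" using st(3) \<Delta> by (simp add: n k)
      hence ts: "t - s = real m * \<Delta>" by (simp add: n k m_def of_nat_diff algebra_simps)
      have k': "k = n + m" using nk by (simp add: m_def)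
      interpret prob_space "L x" by (rule L(1)[OF x])
      have sub: "subalgebra (L x) (history n)"
        by (auto simp: subalgebra_def space_L[OF x] L(2)[OF x] dest: subsetD[OF sets_history_subset])
      interpret finite_measure_subalgebra "L x" "history n"
        by unfold_locales (rule sub)
      have "AE \<omega> in L x. real_cond_exp (L x) (history n) (\<lambda>\<omega>. f (\<omega> k)) \<omega> = (transition ^^ m) f (\<omega> n)"
      proof (rule real_cond_exp_charact[where f = "\<lambda>\<omega>. f (\<omega> k)" and g = "\<lambda>\<omega>. (transition ^^ m) f (\<omega> n)"])
        fix B assume "B \<in> sets (history n)"
        then obtain B' where B: "B = {\<omega> \<in> space paths. restrict \<omega> {0..<Suc n} \<in> B'}"
          by (auto simp: sets_history)
        have ind: "(\<integral>\<omega>\<in>B. g \<omega> \<partial>L x) = (\<integral>\<omega>. indicator B' (restrict \<omega> {0..<Suc n}) * g \<omega> \<partial>L x)"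
          for g :: "_ \<Rightarrow> real"
          unfolding set_lebesgue_integral_def
          by (rule Bochner_Integration.integral_cong) (auto simp: B space_L[OF x] indicator_def)
        show "(\<integral>\<omega>\<in>B. f (\<omega> k) \<partial>L x) = (\<integral>\<omega>\<in>B. (transition ^^ m) f (\<omega> n) \<partial>L x)"
          unfolding ind k' by (rule multistep[OF x])
      next
        show "(\<lambda>\<omega>. (transition ^^ m) f (\<omega> n)) \<in> borel_measurable (history n)"
          by (rule measurable_compose[OF measurable_coordinate_history]) simp
      qed (rule integrable[OF x])+
      moreover have "AE \<omega> in L x. (transition ^^ m) f (\<omega> n) = (\<integral>\<omega>'. f (\<omega>' m) \<partial>L (\<omega> n))"
        by (rule AE_I2) (simp add: law coordinate_in_states space_L[OF x])
      ultimately show ?thesis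
        unfolding ts by (simp add: n k) (auto elim: AE_mp)
    qed
  qed
  thus ?thesis
    by (intro that[of paths "\<lambda>t. history (step t)" L "\<lambda>t \<omega>. \<omega> (step t)"])
       (simp_all add: I_def integrable law)
qed

section \<open>Right-continuous processes, martingales and Gronwall\<close>

text \<open>Evaluating the process at the next grid point strictly to the right of \<open>t\<close> gives approximations that take
  countably many times only; right continuity makes them converge as the grid is refined.\<close>

lemma right_continuous_jointly_measurable:
  fixes Y :: "real \<Rightarrow> 'w \<Rightarrow> 'b::metric_space"
  assumes meas: "\<And>t. 0 \<le> t \<Longrightarrow> Y t \<in> borel_measurable A"
    and right: "\<And>\<omega> t. \<omega> \<in> space A \<Longrightarrow> 0 \<le> t \<Longrightarrow> ((\<lambda>s. Y s \<omega>) \<longlongrightarrow> Y t \<omega>) (at_right t)"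
  shows "(\<lambda>(t, \<omega>). Y (max 0 t) \<omega>) \<in> borel_measurable (borel \<Otimes>\<^sub>M A)"
proof -
  \<comment> \<open>The time \<open>r n t\<close> is the first multiple of \<open>1 / (n + 1)\<close> that exceeds \<open>max 0 t\<close>.\<close>
  define k where "k n t = nat \<lfloor>max 0 t * real (Suc n)\<rfloor>" for n t
  define r where "r n t = real (Suc (k n t)) / real (Suc n)" for n t
  have r_gt: "max 0 t < r n t" and r_le: "r n t \<le> max 0 t + 1 / real (Suc n)" for n t
  proof -
    have k: "real (k n t) = of_int \<lfloor>max 0 t * real (Suc n)\<rfloor>"
      unfolding k_def by (subst of_nat_nat) auto
    have "max 0 t * real (Suc n) < real (Suc (k n t))"
      using k by linarith
    thus "max 0 t < r n t" unfolding r_def by (simp only: pos_less_divide_eq of_nat_0_less_iff zero_less_Suc)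
    have "real (k n t) \<le> max 0 t * real (Suc n)"
      using k by linarith
    hence "real (Suc (k n t)) \<le> (max 0 t + 1 / real (Suc n)) * real (Suc n)"
      by (simp add: distrib_right)
    thus "r n t \<le> max 0 t + 1 / real (Suc n)"
      unfolding r_def by (subst pos_divide_le_eq) auto
  qed
  show ?thesis
  proof (rule borel_measurable_LIMSEQ_metric)
    fix n
    have "(\<lambda>p. (\<lambda>p. Y (real (Suc i) / real (Suc n)) (snd p)) p) \<in> borel_measurable (borel \<Otimes>\<^sub>M A)" for i
      by (rule measurable_compose[OF measurable_snd meas]) simp
    moreover have "(\<lambda>p. k n (fst p)) \<in> borel \<Otimes>\<^sub>M A \<rightarrow>\<^sub>M count_space UNIV"
      unfolding k_def by measurable
    ultimately have "(\<lambda>p. Y (real (Suc (k n (fst p))) / real (Suc n)) (snd p)) \<in> borel_measurable (borel \<Otimes>\<^sub>M A)"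
      by (rule measurable_compose_countable)
    thus "(\<lambda>p. Y (r n (fst p)) (snd p)) \<in> borel_measurable (borel \<Otimes>\<^sub>M A)"
      by (simp add: r_def)
  next
    fix p assume "p \<in> space ((borel :: real measure) \<Otimes>\<^sub>M A)"
    then obtain t \<omega> where p: "p = (t, \<omega>)" and \<omega>: "\<omega> \<in> space A"
      by (auto simp: space_pair_measure)
    have "(\<lambda>n. r n t) \<longlonglongrightarrow> max 0 t"
    proof (rule tendsto_sandwich[of "\<lambda>_. max 0 t" _ _ "\<lambda>n. max 0 t + 1 / real (Suc n)"])
      show "(\<lambda>n. max 0 t + 1 / real (Suc n)) \<longlonglongrightarrow> max 0 t"
        using tendsto_add[OF tendsto_const[of "max 0 t"] LIMSEQ_inverse_real_of_nat]
        by (simp add: inverse_eq_divide)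
    qed (use r_gt r_le in \<open>auto simp: less_imp_le intro!: always_eventually\<close>)
    hence "filterlim (\<lambda>n. r n t) (at_right (max 0 t)) sequentially"
      using r_gt[of t, THEN less_imp_neq, THEN not_sym] r_gt[of t]
      by (simp only: filterlim_at) (auto intro!: always_eventually simp: less_imp_le simp del: max_less_iff_conj)
    from filterlim_compose[OF right[OF \<omega>, of "max 0 t"] this]
    show "(\<lambda>n. Y (r n (fst p)) (snd p)) \<longlonglongrightarrow> (case p of (t, \<omega>) \<Rightarrow> Y (max 0 t) \<omega>)"
      by (simp add: p)
  qed
qed

text \<open>One-sided limits bound the function near every point, and bisection glues the local bounds together.\<close>

lemma cadlag_bounded:
  fixes f :: "real \<Rightarrow> 'a::real_normed_vector"
  assumes "cadlag f" and "0 \<le> t"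
  shows "bounded (f ` {0..t})"
proof -
  define Q where "Q a b \<longleftrightarrow> bounded (f ` ({a..b} \<inter> {0..}))" for a b :: real
  have locally: "\<exists>B. \<forall>\<^sub>F s in F. norm (f s) \<le> B" if "(f \<longlongrightarrow> l) F" for F l
  proof -
    have "\<forall>\<^sub>F s in F. dist (f s) l < 1" using that by (rule tendstoD) simp
    hence "\<forall>\<^sub>F s in F. norm (f s) \<le> norm l + 1"
      by eventually_elim (metis add.commute add_le_cancel_left diff_add_cancel dist_norm less_imp_le norm_triangle_sub order_trans add_left_mono)
    thus ?thesis by blast
  qed
  have "Q 0 t" using \<open>0 \<le> t\<close>
  proof (induction rule: Bolzano)
    case (trans a b c)
    have "{a..c} \<inter> {0..} \<subseteq> ({a..b} \<inter> {0..}) \<union> ({b..c} \<inter> {0..})" by auto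
    thus ?case using trans unfolding Q_def
      by (metis bounded_Un bounded_subset image_Un image_mono)
  next
    case (local s)
    obtain B1 where "\<forall>\<^sub>F r in at_right s. norm (f r) \<le> B1"
      using locally assms(1) local unfolding cadlag_def by blast
    then obtain u where u: "s < u" "\<And>r. s < r \<Longrightarrow> r < u \<Longrightarrow> norm (f r) \<le> B1"
      by (auto simp: eventually_at_right_field)
    obtain v B2 where v: "v < s" "\<And>r. 0 \<le> r \<Longrightarrow> v < r \<Longrightarrow> r < s \<Longrightarrow> norm (f r) \<le> B2"
    proof (cases "s = 0")
      case True
      thus ?thesis by (intro that[of "-1" 0]) auto
    next
      case False
      hence "0 < s" using local by simp
      then obtain B2 where "\<forall>\<^sub>F r in at_left s. norm (f r) \<le> B2"
        using locally assms(1) unfolding cadlag_def by blast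
      then obtain v where "v < s" "\<And>r. v < r \<Longrightarrow> r < s \<Longrightarrow> norm (f r) \<le> B2"
        by (auto simp: eventually_at_left_field)
      thus ?thesis by (intro that[of v B2]) auto
    qed
    define d where "d = min (u - s) (s - v)"
    have "Q a b" if "a \<le> s" "s \<le> b" "b - a < d" for a b
      unfolding Q_def
    proof (rule boundedI)
      fix y assume "y \<in> f ` ({a..b} \<inter> {0..})"
      then obtain r where r: "y = f r" "0 \<le> r" "a \<le> r" "r \<le> b" by auto
      have "v < r" "r < u" using r that by (auto simp: d_def)
      hence "r = s \<or> norm (f r) \<le> B1 \<or> norm (f r) \<le> B2"
        using u(2)[of r] v(2)[of r] r by (cases r s rule: linorder_cases) auto
      thus "norm y \<le> max (norm (f s)) (max B1 B2)" using r by auto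
    qed
    moreover have "0 < d" using u v by (simp add: d_def)
    ultimately show ?case by blast
  qed
  moreover have "{0..t} \<inter> {0..} = {0..t}" by auto
  ultimately show ?thesis by (simp add: Q_def)
qed

text \<open>The second inequality tests the martingale property against the sign of \<open>M s\<close>.\<close>

lemma martingale_expectation:
  assumes P: "prob_space P" and F: "subalgebra P (F s)" and M: "martingale P F M"
    and st: "0 \<le> s" "s \<le> t"
  shows "(\<integral>\<omega>. M s \<omega> \<partial>P) = (\<integral>\<omega>. M t \<omega> \<partial>P)"
    and "(\<integral>\<omega>. \<bar>M s \<omega>\<bar> \<partial>P) \<le> (\<integral>\<omega>. \<bar>M t \<omega>\<bar> \<partial>P)"
proof -
  interpret prob_space P by fact
  interpret finite_measure_subalgebra P "F s" by unfold_locales (rule F)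
  have int: "integrable P (M s)" "integrable P (M t)" and meas: "M s \<in> borel_measurable (F s)"
    using M st unfolding martingale_def by auto
  have cond: "AE \<omega> in P. real_cond_exp P (F s) (M t) \<omega> = M s \<omega>"
    using M st unfolding martingale_def by auto
  have meas_t: "M t \<in> borel_measurable P" using int(2) by auto
  have "(\<integral>\<omega>. M s \<omega> \<partial>P) = (\<integral>\<omega>. real_cond_exp P (F s) (M t) \<omega> \<partial>P)"
    using cond int by (intro integral_cong_AE) auto
  also have "\<dots> = (\<integral>\<omega>. M t \<omega> \<partial>P)" using real_cond_exp_int(2)[OF int(2)] .
  finally show "(\<integral>\<omega>. M s \<omega> \<partial>P) = (\<integral>\<omega>. M t \<omega> \<partial>P)" .
  have sgn_meas: "(\<lambda>\<omega>. sgn (M s \<omega>)) \<in> borel_measurable (F s)"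
    using meas by measurable
  have sgn_meas': "(\<lambda>\<omega>. sgn (M s \<omega>)) \<in> borel_measurable P"
    using measurable_from_subalg[OF F sgn_meas] .
  have sgn_int: "integrable P (\<lambda>\<omega>. sgn (M s \<omega>) * M t \<omega>)"
    using sgn_meas' meas_t
    by (intro Bochner_Integration.integrable_bound[OF int(2)]) (auto simp: abs_mult sgn_if)
  have "(\<integral>\<omega>. \<bar>M s \<omega>\<bar> \<partial>P) = (\<integral>\<omega>. sgn (M s \<omega>) * real_cond_exp P (F s) (M t) \<omega> \<partial>P)"
    using cond int sgn_meas' by (intro integral_cong_AE) (auto simp: abs_sgn mult.commute)
  also have "\<dots> = (\<integral>\<omega>. sgn (M s \<omega>) * M t \<omega> \<partial>P)"
    by (rule real_cond_exp_intg(2)[OF sgn_int sgn_meas meas_t])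
  also have "\<dots> \<le> (\<integral>\<omega>. \<bar>M t \<omega>\<bar> \<partial>P)"
    using sgn_int int(2) by (intro integral_mono) (auto simp: sgn_if)
  finally show "(\<integral>\<omega>. \<bar>M s \<omega>\<bar> \<partial>P) \<le> (\<integral>\<omega>. \<bar>M t \<omega>\<bar> \<partial>P)" .
qed

text \<open>Gronwall's inequality for integrable functions, with a free term \<open>m\<close> of arbitrary sign. With
  \<open>\<Phi> s\<close> the integral of \<open>\<phi>\<close> up to \<open>s\<close>, the weight \<open>C exp (C (t - s))\<close> integrates
  \<open>\<phi> s - C \<Phi> s\<close> to \<open>C \<Phi> t\<close>. This is integration by parts for \<open>\<Phi>\<close>, carried out by
  Fubini's theorem.\<close>

lemma gronwall_integrable:
  fixes \<phi> m :: "real \<Rightarrow> real"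
  assumes C: "0 < C" and t: "0 \<le> t"
    and \<phi>: "set_integrable lborel {0..t} \<phi>" and m: "set_integrable lborel {0..t} m"
    and le: "\<And>s. 0 \<le> s \<Longrightarrow> s \<le> t \<Longrightarrow> \<phi> s \<le> m s + C * (LBINT r:{0..s}. \<phi> r)"
  shows "\<phi> t \<le> m t + (LBINT s:{0..t}. C * exp (C * (t - s)) * m s)"
proof -
  define g where "g r = indicator {0..t} r * \<phi> r" for r
  have g: "integrable lborel g" using \<phi> by (simp add: set_integrable_def g_def[abs_def])
  have [measurable]: "g \<in> borel_measurable borel" using borel_measurable_integrable[OF g] by simp
  define W where "W s = indicator {0..t} s * (C * exp (C * (t - s)))" for s
  have [measurable]: "W \<in> borel_measurable borel" unfolding W_def[abs_def] by measurable
  have W: "0 \<le> W s" "W s \<le> C * exp (C * t)" for s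
    using C t by (auto simp: W_def indicator_def mult_left_mono)
  have "integrable lborel (\<lambda>s. indicator {0..t} s *\<^sub>R (C * exp (C * (t - s))))"
    by (intro borel_integrable_compact continuous_intros) simp
  hence W_int: "integrable lborel W" by (simp add: W_def[abs_def])
  define \<Phi> where "\<Phi> s = (\<integral>r. indicator {..s} r * g r \<partial>lborel)" for s
  have \<Phi>_eq: "\<Phi> s = (LBINT r:{0..s}. \<phi> r)" if "s \<le> t" for s
    unfolding \<Phi>_def set_lebesgue_integral_def g_def
    using that by (intro Bochner_Integration.integral_cong) (auto simp: indicator_def)
  have ind_int: "integrable lborel (\<lambda>r. indicator {..s} r * g r)" for s
    by (subst mult.commute, rule integrable_real_mult_indicator[OF _ g]) simp
  have W_mult: "integrable lborel (\<lambda>s. W s * k s)" if "integrable lborel k" for k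
    using W borel_measurable_integrable[OF that]
    by (intro Bochner_Integration.integrable_bound[OF integrable_mult_right[OF that, of "C * exp (C * t)"]])
       (use C in \<open>auto simp: abs_mult intro!: mult_right_mono\<close>)
  have Wg: "integrable lborel (\<lambda>s. W s * g s)" using g by (rule W_mult)
  have Wm: "integrable lborel (\<lambda>s. W s * (indicator {0..t} s * m s))"
    by (rule W_mult) (use m in \<open>simp add: set_integrable_def\<close>)
  have Fub: "integrable (lborel \<Otimes>\<^sub>M lborel) (\<lambda>(s, r). W s * (indicator {..s} r * g r))"
  proof (rule lborel_pair.Fubini_integrable)
    show "(\<lambda>(s, r). W s * (indicator {..s} r * g r)) \<in> borel_measurable (lborel \<Otimes>\<^sub>M lborel)"
      unfolding indicator_def atMost_iff of_bool_def by measurable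
    show "AE s in lborel. integrable lborel (\<lambda>r. case (s, r) of (s, r) \<Rightarrow> W s * (indicator {..s} r * g r))"
      using ind_int by auto
    have "(\<lambda>s. \<integral>r. norm (W s * (indicator {..s} r * g r)) \<partial>lborel) \<in> borel_measurable lborel"
      unfolding indicator_def atMost_iff of_bool_def by measurable
    moreover have "norm (\<integral>r. norm (W s * (indicator {..s} r * g r)) \<partial>lborel) \<le> norm (W s * (\<integral>r. norm (g r) \<partial>lborel))" for s
    proof -
      have "(\<integral>r. norm (W s * (indicator {..s} r * g r)) \<partial>lborel) = W s * (\<integral>r. norm (indicator {..s} r * g r) \<partial>lborel)"
        using W(1)[of s] by (simp add: abs_mult)
      also have "\<dots> \<le> W s * (\<integral>r. norm (g r) \<partial>lborel)"
        using W(1)[of s] ind_int[of s] g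
        by (intro mult_left_mono integral_mono) (auto simp: indicator_def)
      finally show ?thesis by (auto intro: order_trans[OF _ abs_ge_self])
    qed
    ultimately show "integrable lborel (\<lambda>s. \<integral>r. norm (case (s, r) of (s, r) \<Rightarrow> W s * (indicator {..s} r * g r)) \<partial>lborel)"
      by (intro Bochner_Integration.integrable_bound[OF integrable_mult_left[OF W_int, of "\<integral>r. norm (g r) \<partial>lborel"]]) auto
  qed
  have inner: "(\<integral>s. W s * (indicator {..s} r * g r) \<partial>lborel) = (exp (C * (t - r)) - 1) * g r" for r
  proof (cases "r \<in> {0..t}")
    case True
    have "(\<integral>s. W s * (indicator {..s} r * g r) \<partial>lborel)
        = (\<integral>s. (C * exp (C * (t - s))) * indicator {r..t} s \<partial>lborel) * g r"
      unfolding W_def using True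
      by (subst integral_mult_left_zero[symmetric], intro Bochner_Integration.integral_cong)
        (auto simp: indicator_def)
    also have "(\<integral>s. (C * exp (C * (t - s))) * indicator {r..t} s \<partial>lborel)
        = - exp (C * (t - t)) - (- exp (C * (t - r)))"
      using True by (intro integral_FTC_Icc_real) (auto intro!: derivative_eq_intros continuous_intros)
    finally show ?thesis by simp
  qed (simp add: g_def)
  have "(\<integral>s. W s * \<Phi> s \<partial>lborel) = (\<integral>s. (\<integral>r. W s * (indicator {..s} r * g r) \<partial>lborel) \<partial>lborel)"
    by (simp add: \<Phi>_def)
  also have "\<dots> = (\<integral>r. (\<integral>s. W s * (indicator {..s} r * g r) \<partial>lborel) \<partial>lborel)"
    using lborel_pair.Fubini_integral[OF Fub] by simp
  also have "\<dots> = (\<integral>r. exp (C * (t - r)) * g r - g r \<partial>lborel)"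
    by (simp only: inner left_diff_distrib mult_1)
  also have "\<dots> = (\<integral>r. W r * g r / C - g r \<partial>lborel)"
    using C by (intro Bochner_Integration.integral_cong) (auto simp: W_def g_def indicator_def)
  also have "\<dots> = (\<integral>r. W r * g r \<partial>lborel) / C - (\<integral>r. g r \<partial>lborel)"
    using Wg g by simp
  also have "(\<integral>r. g r \<partial>lborel) = \<Phi> t"
    unfolding \<Phi>_def by (intro Bochner_Integration.integral_cong) (auto simp: g_def indicator_def)
  finally have parts: "(\<integral>s. W s * g s \<partial>lborel) - C * (\<integral>s. W s * \<Phi> s \<partial>lborel) = C * \<Phi> t"
    using C by (simp add: field_simps)
  have W\<Phi>: "integrable lborel (\<lambda>s. W s * \<Phi> s)"
    using lborel_pair.integrable_fst'[OF Fub] by (simp add: \<Phi>_def)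
  have "C * \<Phi> t = (\<integral>s. W s * g s - C * (W s * \<Phi> s) \<partial>lborel)"
    using Wg W\<Phi> parts by simp
  also have "\<dots> \<le> (\<integral>s. W s * (indicator {0..t} s * m s) \<partial>lborel)"
  proof (rule integral_mono)
    show "W s * g s - C * (W s * \<Phi> s) \<le> W s * (indicator {0..t} s * m s)" for s
    proof (cases "s \<in> {0..t}")
      case True
      hence "W s * (\<phi> s - C * \<Phi> s) \<le> W s * m s"
        using le[of s] \<Phi>_eq[of s] W(1)[of s] by (intro mult_left_mono) auto
      thus ?thesis using True by (simp add: g_def algebra_simps)
    qed (simp add: W_def)
  qed (use Wg W\<Phi> Wm in auto)
  also have "\<dots> = (LBINT s:{0..t}. C * exp (C * (t - s)) * m s)"
    unfolding set_lebesgue_integral_def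
    by (intro Bochner_Integration.integral_cong) (auto simp: W_def indicator_def)
  finally show ?thesis using le[of t] t \<Phi>_eq[of t] by simp
qed

section \<open>Stopping the extended generator\<close>

text \<open>Fatou's lemma for localised expectations: along almost every path the stopped quantity eventually equals
  the unstopped one.\<close>

lemma fatou_limit_bound:
  fixes u :: "nat \<Rightarrow> 'a \<Rightarrow> ennreal"
  assumes "\<And>k. u k \<in> borel_measurable M"
    and "AE \<omega> in M. \<forall>\<^sub>F k in sequentially. u k \<omega> = v \<omega>"
    and "\<And>k. (\<integral>\<^sup>+\<omega>. u k \<omega> \<partial>M) \<le> B k" and "B \<longlonglongrightarrow> b"
  shows "(\<integral>\<^sup>+\<omega>. v \<omega> \<partial>M) \<le> b"
proof -
  have "(\<integral>\<^sup>+\<omega>. v \<omega> \<partial>M) = (\<integral>\<^sup>+\<omega>. liminf (\<lambda>k. u k \<omega>) \<partial>M)"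
  proof (rule nn_integral_cong_AE)
    show "AE \<omega> in M. v \<omega> = liminf (\<lambda>k. u k \<omega>)"
      using assms(2) by eventually_elim (auto intro: lim_imp_Liminf[symmetric] tendsto_eventually)
  qed
  also have "\<dots> \<le> liminf (\<lambda>k. \<integral>\<^sup>+\<omega>. u k \<omega> \<partial>M)"
    by (rule nn_integral_liminf) (rule assms(1))
  also have "\<dots> \<le> liminf B" by (intro Liminf_mono always_eventually allI assms(3))
  also have "\<dots> = b" using assms(4) by (intro lim_imp_Liminf) auto
  finally show ?thesis .
qed

lemma bounded_measurable_set_integrable:
  fixes f :: "real \<Rightarrow> real"
  assumes f: "(\<lambda>s. f (max 0 s)) \<in> borel_measurable borel" and b: "bounded (f ` {0..t})"
  shows "set_integrable lborel {0..t} f"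
proof -
  obtain B where B: "\<And>s. s \<in> {0..t} \<Longrightarrow> \<bar>f s\<bar> \<le> B"
    using b unfolding bounded_iff by (auto simp del: atLeastAtMost_iff)
  have eq: "indicator {0..t} s *\<^sub>R f s = indicator {0..t} s * f (max 0 s)" for s
    by (auto simp: indicator_def)
  have "integrable lborel (\<lambda>s. indicator {0..t} s * f (max 0 s))"
  proof (rule Bochner_Integration.integrable_bound)
    show "integrable lborel (\<lambda>s. indicator {0..t} s *\<^sub>R B)"
      by (intro borel_integrable_compact) auto
    show "(\<lambda>s. indicator {0..t} s * f (max 0 s)) \<in> borel_measurable lborel"
      using f by measurable
    show "AE s in lborel. norm (indicator {0..t} s * f (max 0 s)) \<le> norm (indicator {0..t} s *\<^sub>R B)"
      using B by (intro AE_I2) (auto simp: indicator_def max_def intro: order_trans[OF _ abs_ge_self])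
  qed
  thus ?thesis unfolding set_integrable_def eq .
qed

lemma polynomial_function_borel:
  "real_polynomial_function p \<Longrightarrow> p \<in> borel_measurable borel"
  by (intro borel_measurable_continuous_onI continuous_at_imp_continuous_on ballI
      continuous_real_polymonial_function)

context extended_generator
begin

lemma X_measurable: "0 \<le> t \<Longrightarrow> X t \<in> borel_measurable A"
  by (rule measurable_from_subalg[OF _ adapted[of t]]) (auto simp: subalgebra_def space_F sets_F_subset dest: subsetD[OF sets_F_subset])

lemma space_P: "x \<in> E \<Longrightarrow> space (P x) = space A"
  using sets_P by (rule sets_eq_imp_space_eq)

lemma X_jointly_measurable:
  "(\<lambda>(t, \<omega>). X (max 0 t) \<omega>) \<in> borel_measurable (borel \<Otimes>\<^sub>M A)"
  by (rule right_continuous_jointly_measurable)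
     (use X_measurable cadlag_paths in \<open>auto simp: cadlag_def\<close>)

lemma X_at_random_time_measurable:
  assumes g: "g \<in> borel_measurable borel" and T: "T \<in> borel_measurable A"
  shows "(\<lambda>\<omega>. g (X (max 0 (T \<omega>)) \<omega>) :: real) \<in> borel_measurable A"
proof -
  have "(\<lambda>\<omega>. (T \<omega>, \<omega>)) \<in> A \<rightarrow>\<^sub>M borel \<Otimes>\<^sub>M A" using T by measurable
  from measurable_compose[OF measurable_compose[OF this X_jointly_measurable] g]
  show ?thesis by simp
qed

lemma path_measurable:
  assumes g: "g \<in> borel_measurable borel" and \<omega>: "\<omega> \<in> space A"
  shows "(\<lambda>s. g (X (max 0 s) \<omega>) :: real) \<in> borel_measurable borel"
proof -
  have "(\<lambda>s. (s, \<omega>)) \<in> borel \<rightarrow>\<^sub>M borel \<Otimes>\<^sub>M A" using \<omega> by measurable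
  from measurable_compose[OF measurable_compose[OF this X_jointly_measurable] g]
  show ?thesis by simp
qed

lemma path_bounded:
  assumes p: "real_polynomial_function p" and \<omega>: "\<omega> \<in> space A" and t: "0 \<le> t"
  shows "bounded ((\<lambda>s. p (X s \<omega>)) ` {0..t})"
proof (rule cadlag_bounded[OF _ t])
  have "isCont p y" for y using p by (rule continuous_real_polymonial_function)
  hence lim: "((\<lambda>s. p (X s \<omega>)) \<longlongrightarrow> p y) F" if "((\<lambda>s. X s \<omega>) \<longlongrightarrow> y) F" for F y
    using that by (rule isCont_tendsto_compose)
  show "cadlag (\<lambda>s. p (X s \<omega>))"
    unfolding cadlag_def
  proof (intro conjI allI impI)
    show "((\<lambda>s. p (X s \<omega>)) \<longlongrightarrow> p (X t \<omega>)) (at_right t)" if "0 \<le> t" for t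
      using cadlag_paths[OF \<omega>] that unfolding cadlag_def by (intro lim) simp
    fix t :: real assume "0 < t"
    then obtain l where "((\<lambda>s. X s \<omega>) \<longlongrightarrow> l) (at_left t)"
      using cadlag_paths[OF \<omega>] unfolding cadlag_def by meson
    from lim[OF this] show "\<exists>l. ((\<lambda>s. p (X s \<omega>)) \<longlongrightarrow> l) (at_left t)" by blast
  qed
qed

lemma path_integrable:
  assumes p: "real_polynomial_function p" and \<omega>: "\<omega> \<in> space A" and t: "0 \<le> t"
  shows "set_integrable lborel {0..t} (\<lambda>s. p (X s \<omega>))"
  by (rule bounded_measurable_set_integrable[OF path_measurable[OF polynomial_function_borel[OF p] \<omega>] path_bounded[OF assms]])

definition time_integral :: "(real^'d \<Rightarrow> real) \<Rightarrow> real \<Rightarrow> 'w \<Rightarrow> real" where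
  "time_integral g t \<omega> = (LBINT s:{0..t}. g (X s \<omega>))"

lemma time_integral_eq: "time_integral g t \<omega> = (\<integral>s. indicator {0..t} s * g (X (max 0 s) \<omega>) \<partial>lborel)"
  unfolding time_integral_def set_lebesgue_integral_def
  by (intro Bochner_Integration.integral_cong) (auto simp: indicator_def)

lemma time_integral_jointly_measurable:
  assumes g: "g \<in> borel_measurable borel"
  shows "(\<lambda>(t, \<omega>). time_integral g t \<omega>) \<in> borel_measurable (borel \<Otimes>\<^sub>M A)"
proof -
  have X': "(\<lambda>p. X (max 0 (snd p)) (snd (fst p))) \<in> borel_measurable ((borel \<Otimes>\<^sub>M A) \<Otimes>\<^sub>M (lborel :: real measure))"
  proof -
    have "(\<lambda>p. (snd p, snd (fst p))) \<in> (borel \<Otimes>\<^sub>M A) \<Otimes>\<^sub>M (lborel :: real measure) \<rightarrow>\<^sub>M borel \<Otimes>\<^sub>M A"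
      by measurable
    from measurable_compose[OF this X_jointly_measurable] show ?thesis by simp
  qed
  have "(\<lambda>p. if 0 \<le> snd p \<and> snd p \<le> fst (fst p) then g (X (max 0 (snd p)) (snd (fst p))) else 0)
      \<in> borel_measurable ((borel \<Otimes>\<^sub>M A) \<Otimes>\<^sub>M (lborel :: real measure))"
    using measurable_compose[OF X' g] by measurable
  also have "(\<lambda>p. if 0 \<le> snd p \<and> snd p \<le> fst (fst p) then g (X (max 0 (snd p)) (snd (fst p))) else 0)
      = (\<lambda>(q, s). indicator {0..fst q} s * g (X (max 0 s) (snd q)))"
    by (auto simp: fun_eq_iff indicator_def)
  finally have "(\<lambda>q. \<integral>s. indicator {0..fst q} s * g (X (max 0 s) (snd q)) \<partial>lborel) \<in> borel_measurable (borel \<Otimes>\<^sub>M A)"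
    by (rule lborel.borel_measurable_lebesgue_integral)
  thus ?thesis by (simp add: time_integral_eq[abs_def] case_prod_beta')
qed

lemma time_integral_at_random_time_measurable:
  assumes g: "g \<in> borel_measurable borel" and T: "T \<in> borel_measurable A"
  shows "(\<lambda>\<omega>. time_integral g (T \<omega>) \<omega>) \<in> borel_measurable A"
proof -
  have "(\<lambda>\<omega>. (T \<omega>, \<omega>)) \<in> A \<rightarrow>\<^sub>M borel \<Otimes>\<^sub>M A" using T by measurable
  from measurable_compose[OF this time_integral_jointly_measurable[OF g]] show ?thesis by simp
qed

lemma time_integral_abs_le:
  assumes g: "real_polynomial_function g" and \<omega>: "\<omega> \<in> space A" and t: "s \<le> t" "0 \<le> t"
  shows "\<bar>time_integral g s \<omega>\<bar> \<le> time_integral (\<lambda>y. \<bar>g y\<bar>) t \<omega>"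
proof -
  have int: "set_integrable lborel {0..t} (\<lambda>s. \<bar>g (X s \<omega>)\<bar>)"
    using path_integrable[OF g \<omega> t(2)] by (rule set_integrable_abs)
  have "\<bar>time_integral g s \<omega>\<bar> \<le> (\<integral>r. \<bar>indicator {0..s} r *\<^sub>R g (X r \<omega>)\<bar> \<partial>lborel)"
    unfolding time_integral_def set_lebesgue_integral_def by (rule integral_abs_bound)
  also have "\<dots> \<le> time_integral (\<lambda>y. \<bar>g y\<bar>) t \<omega>"
    unfolding time_integral_def set_lebesgue_integral_def
    using int t by (intro integral_mono') (auto simp: set_integrable_def indicator_def)
  finally show ?thesis .
qed

text \<open>The sequence \<open>\<tau>\<close> turns \<open>p(X\<^sub>t) - \<integral>\<^sub>0\<^sup>t g(X\<^sub>s) ds\<close> into martingales. Of the martingale property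
  only the consequences for first moments are recorded: constant expectation and nondecreasing absolute
  expectation.\<close>

definition reduces :: "(real^'d \<Rightarrow> real) \<Rightarrow> (real^'d \<Rightarrow> real) \<Rightarrow> real^'d \<Rightarrow> (nat \<Rightarrow> 'w \<Rightarrow> real) \<Rightarrow> bool" where
  "reduces p g x \<tau> \<longleftrightarrow>
     (\<forall>k. \<tau> k \<in> borel_measurable A) \<and> (\<forall>k. \<forall>\<omega>\<in>space A. 0 \<le> \<tau> k \<omega>) \<and>
     (AE \<omega> in P x. filterlim (\<lambda>k. \<tau> k \<omega>) at_top sequentially) \<and>
     (\<forall>k. \<forall>t\<ge>0. integrable (P x) (\<lambda>\<omega>. p (X (min t (\<tau> k \<omega>)) \<omega>) - time_integral g (min t (\<tau> k \<omega>)) \<omega>)) \<and>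
     (\<forall>k. \<forall>t\<ge>0. (\<integral>\<omega>. p (X (min t (\<tau> k \<omega>)) \<omega>) - time_integral g (min t (\<tau> k \<omega>)) \<omega> \<partial>P x) = p x) \<and>
     (\<forall>k s t. 0 \<le> s \<longrightarrow> s \<le> t \<longrightarrow>
       (\<integral>\<omega>. \<bar>p (X (min s (\<tau> k \<omega>)) \<omega>) - time_integral g (min s (\<tau> k \<omega>)) \<omega>\<bar> \<partial>P x)
       \<le> (\<integral>\<omega>. \<bar>p (X (min t (\<tau> k \<omega>)) \<omega>) - time_integral g (min t (\<tau> k \<omega>)) \<omega>\<bar> \<partial>P x))"

lemma reducing_sequence_exists:
  assumes p: "real_polynomial_function p"
    and Gp: "\<And>y. y \<in> E \<Longrightarrow> \<G> p y = g y" and x: "x \<in> E"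
  shows "\<exists>\<tau>. reduces p g x \<tau>"
proof -
  interpret Px: prob_space "P x" by (rule prob_space_P[OF x])
  let ?M = "\<lambda>t \<omega>. p (X t \<omega>) - (LBINT s:{0..t}. \<G> p (X s \<omega>))"
  obtain \<tau> where \<tau>: "\<And>k. stopping_time F (\<tau> k)" "\<And>k \<omega>. \<omega> \<in> space (P x) \<Longrightarrow> 0 \<le> \<tau> k \<omega>"
      "AE \<omega> in P x. incseq (\<lambda>k. \<tau> k \<omega>) \<and> filterlim (\<lambda>k. \<tau> k \<omega>) at_top sequentially"
      "\<And>k. martingale (P x) F (\<lambda>t \<omega>. ?M (min t (\<tau> k \<omega>)) \<omega>)"
    using generator_local_martingale[OF p x] unfolding local_martingale_def by blast
  have eq: "?M (min t (\<tau> k \<omega>)) \<omega> = p (X (min t (\<tau> k \<omega>)) \<omega>) - time_integral g (min t (\<tau> k \<omega>)) \<omega>"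
    if "\<omega> \<in> space (P x)" for t k \<omega>
    unfolding time_integral_def using that Gp state_space
    by (intro arg_cong2[where f = minus] refl set_lebesgue_integral_cong) (auto simp: space_P[OF x])
  have sub: "subalgebra (P x) (F t)" for t
    using sets_F_subset by (auto simp: subalgebra_def space_F space_P[OF x] sets_P[OF x])
  show ?thesis
    unfolding reduces_def
  proof (intro exI[of _ \<tau>] conjI allI impI ballI)
    show "\<tau> k \<in> borel_measurable A" for k
      by (rule measurable_stopping_time[OF \<tau>(1) sets_F_subset]) (simp add: space_F)
    show "0 \<le> \<tau> k \<omega>" if "\<omega> \<in> space A" for k \<omega>
      using \<tau>(2) that by (simp add: space_P[OF x])
    show "AE \<omega> in P x. filterlim (\<lambda>k. \<tau> k \<omega>) at_top sequentially"
      using \<tau>(3) by (auto elim: AE_mp)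
    fix k
    have cong: "(\<integral>\<omega>. f (?M (min t (\<tau> k \<omega>)) \<omega>) \<partial>P x) =
        (\<integral>\<omega>. f (p (X (min t (\<tau> k \<omega>)) \<omega>) - time_integral g (min t (\<tau> k \<omega>)) \<omega>) \<partial>P x)"
      for t and f :: "real \<Rightarrow> real"
      by (intro Bochner_Integration.integral_cong refl arg_cong[where f = f] eq)
    show "integrable (P x) (\<lambda>\<omega>. p (X (min t (\<tau> k \<omega>)) \<omega>) - time_integral g (min t (\<tau> k \<omega>)) \<omega>)"
      if "0 \<le> t" for t
    proof -
      have "integrable (P x) (\<lambda>\<omega>. ?M (min t (\<tau> k \<omega>)) \<omega>)"
        using \<tau>(4)[of k] that unfolding martingale_def by blast
      thus ?thesis by (rule Bochner_Integration.integrable_cong[THEN iffD1, rotated 2]) (auto simp: eq)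
    qed
    show "(\<integral>\<omega>. p (X (min t (\<tau> k \<omega>)) \<omega>) - time_integral g (min t (\<tau> k \<omega>)) \<omega> \<partial>P x) = p x"
      if "0 \<le> t" for t
    proof -
      have "(\<integral>\<omega>. ?M (min t (\<tau> k \<omega>)) \<omega> \<partial>P x) = (\<integral>\<omega>. ?M (min 0 (\<tau> k \<omega>)) \<omega> \<partial>P x)"
        using martingale_expectation(1)[OF Px.prob_space_axioms sub \<tau>(4)[of k] order_refl that] by simp
      also have "\<dots> = (\<integral>\<omega>. p x \<partial>P x)"
      proof (rule integral_cong_AE)
        \<comment> \<open>At time \<open>0\<close> the integral runs over a single point, and the process is at its starting point.\<close>
        have zero: "(LBINT s:{0..0}. h s) = 0" for h :: "real \<Rightarrow> real"
          unfolding set_lebesgue_integral_def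
        proof (rule integral_eq_zero_AE)
          show "AE s in lborel. indicator {0..0} s *\<^sub>R h s = 0"
            using AE_lborel_singleton[of 0] by eventually_elim simp
        qed
        have "AE \<omega> in P x. X 0 \<omega> = x" by (rule start[OF x])
        thus "AE \<omega> in P x. ?M (min 0 (\<tau> k \<omega>)) \<omega> = p x"
          using AE_space by eventually_elim (use \<tau>(2)[of _ k] zero in \<open>simp add: min_def\<close>)
        have "integrable (P x) (\<lambda>\<omega>. ?M (min 0 (\<tau> k \<omega>)) \<omega>)"
          using \<tau>(4)[of k] unfolding martingale_def by blast
        thus "(\<lambda>\<omega>. ?M (min 0 (\<tau> k \<omega>)) \<omega>) \<in> borel_measurable (P x)" by (rule borel_measurable_integrable)
      qed simp
      finally show ?thesis using cong[of "\<lambda>y. y" t] by (simp add: Px.prob_space)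
    qed
    show "(\<integral>\<omega>. \<bar>p (X (min s (\<tau> k \<omega>)) \<omega>) - time_integral g (min s (\<tau> k \<omega>)) \<omega>\<bar> \<partial>P x)
       \<le> (\<integral>\<omega>. \<bar>p (X (min t (\<tau> k \<omega>)) \<omega>) - time_integral g (min t (\<tau> k \<omega>)) \<omega>\<bar> \<partial>P x)"
      if "0 \<le> s" "s \<le> t" for s t
      using martingale_expectation(2)[OF Px.prob_space_axioms sub \<tau>(4)[of k] that]
      unfolding cong[of abs] .
  qed
qed

end

context extended_generator
begin

lemma stopped_limit:
  assumes "AE \<omega> in P x. filterlim (\<lambda>k. \<tau> k \<omega>) at_top sequentially"
  shows "AE \<omega> in P x. \<forall>\<^sub>F k in sequentially. min t (\<tau> k \<omega>) = (t :: real)"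
  using assms
proof eventually_elim
  case (elim \<omega>)
  hence "\<forall>\<^sub>F k in sequentially. t \<le> \<tau> k \<omega>" by (simp add: filterlim_at_top)
  thus ?case by eventually_elim simp
qed

lemma measurable_P: "x \<in> E \<Longrightarrow> f \<in> A \<rightarrow>\<^sub>M N \<Longrightarrow> f \<in> P x \<rightarrow>\<^sub>M N"
  by (simp add: measurable_cong_sets[OF sets_P refl])

lemma measurable_pair_P: "x \<in> E \<Longrightarrow> f \<in> borel \<Otimes>\<^sub>M A \<rightarrow>\<^sub>M N \<Longrightarrow> f \<in> lborel \<Otimes>\<^sub>M P x \<rightarrow>\<^sub>M N"
  by (subst measurable_cong_sets[OF sets_pair_measure_cong[OF sets_lborel sets_P] refl])

text \<open>Taking expectations in \<open>f(X\<^sub>t) = f(x) + \<integral>\<^sub>0\<^sup>t g(X\<^sub>s) ds + martingale\<close> and applying Gronwall would presuppose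
  that the moments are finite. Therefore Gronwall is applied along each path of the stopped process
  \<open>\<phi>\<close>, with the martingale \<open>m\<close> as free term. The resulting bound is linear in \<open>m\<close>, whose expectation
  is known, and Fatou's lemma removes the stopping.\<close>

lemma exponential_moment_bound:
  assumes f: "real_polynomial_function f" and g: "real_polynomial_function g"
    and Gf: "\<And>y. y \<in> E \<Longrightarrow> \<G> f y = g y"
    and nonneg: "\<And>y. y \<in> E \<Longrightarrow> 0 \<le> f y" and gf: "\<And>y. y \<in> E \<Longrightarrow> g y \<le> C * f y"
    and C: "0 < C" and x: "x \<in> E" and t: "0 \<le> t"
  shows "(\<integral>\<^sup>+\<omega>. f (X t \<omega>) \<partial>P x) \<le> ennreal (f x * exp (C * t))"
proof -
  interpret Px: prob_space "P x" by (rule prob_space_P[OF x])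
  interpret pair: pair_sigma_finite lborel "P x" by standard
  note fb = polynomial_function_borel[OF f] and gb = polynomial_function_borel[OF g]
  obtain \<tau> where reduces: "reduces f g x \<tau>"
    using reducing_sequence_exists[OF f Gf x] by blast
  have \<tau>: "\<And>k. \<tau> k \<in> borel_measurable A" "\<And>k \<omega>. \<omega> \<in> space A \<Longrightarrow> 0 \<le> \<tau> k \<omega>"
    "AE \<omega> in P x. filterlim (\<lambda>k. \<tau> k \<omega>) at_top sequentially"
    "\<And>k t. 0 \<le> t \<Longrightarrow> integrable (P x) (\<lambda>\<omega>. f (X (min t (\<tau> k \<omega>)) \<omega>) - time_integral g (min t (\<tau> k \<omega>)) \<omega>)"
    "\<And>k t. 0 \<le> t \<Longrightarrow> (\<integral>\<omega>. f (X (min t (\<tau> k \<omega>)) \<omega>) - time_integral g (min t (\<tau> k \<omega>)) \<omega> \<partial>P x) = f x"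
    "\<And>k s t. 0 \<le> s \<Longrightarrow> s \<le> t \<Longrightarrow>
       (\<integral>\<omega>. \<bar>f (X (min s (\<tau> k \<omega>)) \<omega>) - time_integral g (min s (\<tau> k \<omega>)) \<omega>\<bar> \<partial>P x)
       \<le> (\<integral>\<omega>. \<bar>f (X (min t (\<tau> k \<omega>)) \<omega>) - time_integral g (min t (\<tau> k \<omega>)) \<omega>\<bar> \<partial>P x)"
    using reduces unfolding reduces_def by simp_all
  define \<phi> where "\<phi> k s \<omega> = f (X (min s (\<tau> k \<omega>)) \<omega>)" for k s \<omega>
  define m where "m k s \<omega> = \<phi> k s \<omega> - time_integral g (min s (\<tau> k \<omega>)) \<omega>" for k s \<omega>
  have m_joint: "(\<lambda>(s, \<omega>). m k (max 0 s) \<omega>) \<in> borel_measurable (borel \<Otimes>\<^sub>M A)" for k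
  proof -
    have T: "(\<lambda>(s, \<omega>). (min (max 0 s) (\<tau> k \<omega>), \<omega>)) \<in> borel \<Otimes>\<^sub>M A \<rightarrow>\<^sub>M borel \<Otimes>\<^sub>M A"
      using \<tau>(1)[of k] by measurable
    have "(\<lambda>(s, \<omega>). f (X (max 0 (min (max 0 s) (\<tau> k \<omega>))) \<omega>)) \<in> borel_measurable (borel \<Otimes>\<^sub>M A)"
      using measurable_compose[OF measurable_compose[OF T X_jointly_measurable] fb]
      by (simp add: case_prod_beta')
    moreover have "(\<lambda>(s, \<omega>). time_integral g (min (max 0 s) (\<tau> k \<omega>)) \<omega>) \<in> borel_measurable (borel \<Otimes>\<^sub>M A)"
      using measurable_compose[OF T time_integral_jointly_measurable[OF gb]]
      by (simp add: case_prod_beta')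
    ultimately have "(\<lambda>p. (case p of (s, \<omega>) \<Rightarrow> f (X (max 0 (min (max 0 s) (\<tau> k \<omega>))) \<omega>))
          - (case p of (s, \<omega>) \<Rightarrow> time_integral g (min (max 0 s) (\<tau> k \<omega>)) \<omega>)) \<in> borel_measurable (borel \<Otimes>\<^sub>M A)"
      by (rule borel_measurable_diff)
    also have "?this \<longleftrightarrow> ?thesis"
      by (intro measurable_cong) (auto simp: space_pair_measure m_def \<phi>_def \<tau>(2) max_absorb2)
    finally show ?thesis .
  qed
  have bound: "(\<integral>\<^sup>+\<omega>. \<phi> k t \<omega> \<partial>P x) \<le> ennreal (f x * exp (C * t))" for k
  proof -
    let ?W = "\<lambda>s. C * exp (C * (t - s))"
    have path: "\<phi> k t \<omega> \<le> m k t \<omega> + (LBINT s:{0..t}. ?W s * m k s \<omega>)" if \<omega>: "\<omega> \<in> space A" for \<omega>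
    proof (rule gronwall_integrable[OF C t])
      have \<tau>0: "0 \<le> \<tau> k \<omega>" using \<tau>(2) \<omega> .
      have \<phi>_bdd: "bounded ((\<lambda>s. \<phi> k s \<omega>) ` {0..t})"
        by (rule bounded_subset[OF path_bounded[OF f \<omega> t]]) (use \<tau>0 in \<open>auto simp: \<phi>_def min_def\<close>)
      have \<phi>_meas: "(\<lambda>s. \<phi> k (max 0 s) \<omega>) \<in> borel_measurable borel"
      proof -
        have "(\<lambda>s. f (X (max 0 (min (max 0 s) (\<tau> k \<omega>))) \<omega>)) \<in> borel_measurable borel"
          by (rule measurable_compose[OF _ path_measurable[OF fb \<omega>]]) measurable
        thus ?thesis using \<tau>0 by (simp add: \<phi>_def max_absorb2)
      qed
      show \<phi>_int: "set_integrable lborel {0..t} (\<lambda>s. \<phi> k s \<omega>)"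
        by (rule bounded_measurable_set_integrable[OF \<phi>_meas \<phi>_bdd])
      show "set_integrable lborel {0..t} (\<lambda>s. m k s \<omega>)"
      proof (rule bounded_measurable_set_integrable)
        have "(\<lambda>s. (s, \<omega>)) \<in> borel \<rightarrow>\<^sub>M borel \<Otimes>\<^sub>M A" using \<omega> by measurable
        from measurable_compose[OF this m_joint[of k]]
        show "(\<lambda>s. m k (max 0 s) \<omega>) \<in> borel_measurable borel" by simp
        have "bounded ((\<lambda>s. time_integral g (min s (\<tau> k \<omega>)) \<omega>) ` {0..t})"
          using time_integral_abs_le[OF g \<omega>, of _ t] t
          by (intro boundedI[of _ "time_integral (\<lambda>y. \<bar>g y\<bar>) t \<omega>"]) (auto simp: min_def)
        thus "bounded ((\<lambda>s. m k s \<omega>) ` {0..t})"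
          unfolding m_def by (rule bounded_minus_comp[OF \<phi>_bdd])
      qed
      fix s assume s: "0 \<le> s" "s \<le> t"
      \<comment> \<open>Up to the stopping time the stopped path agrees with the path; after it, the right-hand side only gains, since \<open>f\<close> is nonnegative on \<open>E\<close>.\<close>
      have "time_integral g (min s (\<tau> k \<omega>)) \<omega> \<le> (LBINT r:{0..s}. C * \<phi> k r \<omega>)"
        unfolding time_integral_def set_lebesgue_integral_def
      proof (rule integral_mono)
        show "integrable lborel (\<lambda>r. indicat_real {0..min s (\<tau> k \<omega>)} r *\<^sub>R g (X r \<omega>))"
          using path_integrable[OF g \<omega>, of "min s (\<tau> k \<omega>)"] \<tau>0 s by (simp add: set_integrable_def)
        have "set_integrable lborel {0..s} (\<lambda>s. \<phi> k s \<omega>)"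
          by (rule set_integrable_subset[OF \<phi>_int]) (use s in auto)
        thus "integrable lborel (\<lambda>r. indicat_real {0..s} r *\<^sub>R (C * \<phi> k r \<omega>))"
          by (simp add: set_integrable_def mult.left_commute)
        show "indicat_real {0..min s (\<tau> k \<omega>)} r *\<^sub>R g (X r \<omega>) \<le> indicat_real {0..s} r *\<^sub>R (C * \<phi> k r \<omega>)" for r
        proof -
          have "0 \<le> C * \<phi> k r \<omega>" if "0 \<le> r"
            using C \<tau>0 that \<omega> by (auto simp: \<phi>_def intro!: mult_nonneg_nonneg nonneg state_space)
          moreover have "g (X r \<omega>) \<le> C * \<phi> k r \<omega>" if "0 \<le> r" "r \<le> \<tau> k \<omega>"
            using that \<omega> by (auto simp: \<phi>_def min_def intro!: gf state_space)
          ultimately show ?thesis by (auto simp: indicator_def)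
        qed
      qed
      thus "\<phi> k s \<omega> \<le> m k s \<omega> + C * (LBINT r:{0..s}. \<phi> k r \<omega>)"
        by (simp add: m_def)
    qed
    define K where "K = (\<integral>\<omega>. \<bar>m k t \<omega>\<bar> \<partial>P x)"
    have m_int: "integrable (P x) (m k s)" "(\<integral>\<omega>. m k s \<omega> \<partial>P x) = f x"
        "s \<le> t \<Longrightarrow> (\<integral>\<omega>. \<bar>m k s \<omega>\<bar> \<partial>P x) \<le> K" if "0 \<le> s" for s
      using \<tau>(4,5)[OF that, of k] \<tau>(6)[OF that, of t k] by (simp_all add: m_def[abs_def] \<phi>_def K_def)
    define w where "w s = indicator {0..t} s * ?W s" for s
    have "integrable lborel (\<lambda>s. indicator {0..t} s *\<^sub>R ?W s)"
      by (intro borel_integrable_compact continuous_intros) simp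
    hence w_int: "integrable lborel w" unfolding w_def[abs_def] real_scaleR_def .
    have w0: "0 \<le> w s" for s using C by (simp add: w_def)
    have w_meas: "w \<in> borel_measurable borel" unfolding w_def[abs_def] by measurable
    \<comment> \<open>Fubini applies to the martingale because its absolute expectation on \<open>{0..t}\<close> is at most the one at time \<open>t\<close>.\<close>
    have joint: "integrable (lborel \<Otimes>\<^sub>M P x) (\<lambda>(s, \<omega>). w s * m k (max 0 s) \<omega>)"
    proof (rule pair.Fubini_integrable)
      show meas: "(\<lambda>(s, \<omega>). w s * m k (max 0 s) \<omega>) \<in> borel_measurable (lborel \<Otimes>\<^sub>M P x)"
        using w_meas measurable_pair_P[OF x m_joint[of k]] by measurable
      show "AE s in lborel. integrable (P x) (\<lambda>\<omega>. case (s, \<omega>) of (s, \<omega>) \<Rightarrow> w s * m k (max 0 s) \<omega>)"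
        using m_int(1) by (intro AE_I2) simp
      have "(\<lambda>s. \<integral>\<omega>. norm (w s * m k (max 0 s) \<omega>) \<partial>P x) \<in> borel_measurable lborel"
        using meas by (intro Px.borel_measurable_lebesgue_integral) (simp add: case_prod_beta')
      moreover have "norm (\<integral>\<omega>. norm (w s * m k (max 0 s) \<omega>) \<partial>P x) \<le> norm (w s * K)" for s
      proof (cases "s \<in> {0..t}")
        case True
        have "(\<integral>\<omega>. norm (w s * m k (max 0 s) \<omega>) \<partial>P x) = w s * (\<integral>\<omega>. \<bar>m k s \<omega>\<bar> \<partial>P x)"
          using True w0[of s] by (simp add: abs_mult)
        also have "\<dots> \<le> w s * K" using True m_int(3)[of s] w0[of s] by (intro mult_left_mono) auto
        finally show ?thesis by (auto intro: order_trans[OF _ abs_ge_self])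
      next
        case False
        hence "w s = 0" by (simp add: w_def)
        thus ?thesis by simp
      qed
      ultimately show "integrable lborel (\<lambda>s. \<integral>\<omega>. norm (case (s, \<omega>) of (s, \<omega>) \<Rightarrow> w s * m k (max 0 s) \<omega>) \<partial>P x)"
        by (intro Bochner_Integration.integrable_bound[OF integrable_mult_left[OF w_int, of K]]) auto
    qed
    have R: "(LBINT s:{0..t}. ?W s * m k s \<omega>) = (\<integral>s. w s * m k (max 0 s) \<omega> \<partial>lborel)" for \<omega>
      unfolding set_lebesgue_integral_def
      by (intro Bochner_Integration.integral_cong) (auto simp: w_def indicator_def)
    have R_int: "integrable (P x) (\<lambda>\<omega>. LBINT s:{0..t}. ?W s * m k s \<omega>)"
      unfolding R using pair.integrable_snd[of "\<lambda>s \<omega>. w s * m k (max 0 s) \<omega>"] joint by simp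
    have "(\<integral>\<omega>. (LBINT s:{0..t}. ?W s * m k s \<omega>) \<partial>P x) = (\<integral>s. (\<integral>\<omega>. w s * m k (max 0 s) \<omega> \<partial>P x) \<partial>lborel)"
      unfolding R using pair.Fubini_integral[of "\<lambda>s \<omega>. w s * m k (max 0 s) \<omega>"] joint by simp
    also have "\<dots> = (\<integral>s. ?W s * indicator {0..t} s * f x \<partial>lborel)"
    proof (rule Bochner_Integration.integral_cong[OF refl])
      show "(\<integral>\<omega>. w s * m k (max 0 s) \<omega> \<partial>P x) = ?W s * indicator {0..t} s * f x" for s
        using m_int(2)[of "max 0 s"] by (simp add: w_def)
    qed
    also have "\<dots> = (\<integral>s. ?W s * indicator {0..t} s \<partial>lborel) * f x"
      by (rule integral_mult_left_zero)
    also have "(\<integral>s. ?W s * indicator {0..t} s \<partial>lborel) = - exp (C * (t - t)) - (- exp (C * (t - 0)))"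
      using t by (intro integral_FTC_Icc_real) (auto intro!: derivative_eq_intros continuous_intros)
    finally have R_val: "(\<integral>\<omega>. (LBINT s:{0..t}. ?W s * m k s \<omega>) \<partial>P x) = (exp (C * t) - 1) * f x"
      by simp
    have "(\<integral>\<^sup>+\<omega>. \<phi> k t \<omega> \<partial>P x) \<le> (\<integral>\<^sup>+\<omega>. ennreal (m k t \<omega> + (LBINT s:{0..t}. ?W s * m k s \<omega>)) \<partial>P x)"
      using path by (intro nn_integral_mono ennreal_leI) (simp add: space_P[OF x])
    also have "\<dots> = ennreal (\<integral>\<omega>. m k t \<omega> + (LBINT s:{0..t}. ?W s * m k s \<omega>) \<partial>P x)"
    proof (rule nn_integral_eq_integral)
      show "integrable (P x) (\<lambda>\<omega>. m k t \<omega> + (LBINT s:{0..t}. ?W s * m k s \<omega>))"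
        using m_int(1)[OF t] R_int by simp
      have "0 \<le> \<phi> k t \<omega>" if "\<omega> \<in> space A" for \<omega>
        using \<tau>(2)[OF that] t that by (auto simp: \<phi>_def intro!: nonneg state_space)
      thus "AE \<omega> in P x. 0 \<le> m k t \<omega> + (LBINT s:{0..t}. ?W s * m k s \<omega>)"
        by (intro AE_I2 order_trans[OF _ path]) (simp_all add: space_P[OF x])
    qed
    also have "(\<integral>\<omega>. m k t \<omega> + (LBINT s:{0..t}. ?W s * m k s \<omega>) \<partial>P x) = f x * exp (C * t)"
      using m_int[OF t] R_int R_val by (simp add: algebra_simps)
    finally show ?thesis .
  qed
  show ?thesis
  proof (rule fatou_limit_bound[OF _ _ bound])
    show "(\<lambda>\<omega>. ennreal (\<phi> k t \<omega>)) \<in> borel_measurable (P x)" for k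
    proof -
      have "(\<lambda>\<omega>. min t (\<tau> k \<omega>)) \<in> borel_measurable A"
        by (intro borel_measurable_min borel_measurable_const \<tau>(1))
      hence "(\<lambda>\<omega>. f (X (max 0 (min t (\<tau> k \<omega>))) \<omega>)) \<in> borel_measurable A"
        by (rule X_at_random_time_measurable[OF fb])
      hence "(\<lambda>\<omega>. \<phi> k t \<omega>) \<in> borel_measurable A"
        by (rule measurable_cong[THEN iffD1, rotated]) (use t \<tau>(2) in \<open>auto simp: \<phi>_def max_absorb2\<close>)
      from measurable_P[OF x this] show ?thesis by measurable
    qed
    show "AE \<omega> in P x. \<forall>\<^sub>F k in sequentially. ennreal (\<phi> k t \<omega>) = ennreal (f (X t \<omega>))"
      using stopped_limit[OF \<tau>(3), of t] by eventually_elim (auto elim: eventually_mono simp: \<phi>_def)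
    show "(\<lambda>k. ennreal (f x * exp (C * t))) \<longlonglongrightarrow> ennreal (f x * exp (C * t))"
      by (rule tendsto_const)
  qed
qed

end

context extended_generator
begin

text \<open>For a nonnegative polynomial the stopped version of Dynkin's formula passes to the limit on the left by
  Fatou's lemma and on the right by dominated convergence.\<close>

lemma supermartingale_inequality:
  assumes q: "real_polynomial_function q" and g: "real_polynomial_function g"
    and Gq: "\<And>y. y \<in> E \<Longrightarrow> \<G> q y = g y"
    and nonneg: "\<And>y. y \<in> E \<Longrightarrow> 0 \<le> q y" and x: "x \<in> E" and t: "0 \<le> t"
    and int: "integrable (P x) (time_integral (\<lambda>y. \<bar>g y\<bar>) t)"
  shows "(\<integral>\<^sup>+\<omega>. q (X t \<omega>) \<partial>P x) \<le> ennreal (q x + (\<integral>\<omega>. time_integral g t \<omega> \<partial>P x))"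
    and "0 \<le> q x + (\<integral>\<omega>. time_integral g t \<omega> \<partial>P x)"
proof -
  note qb = polynomial_function_borel[OF q] and gb = polynomial_function_borel[OF g]
  obtain \<tau> where reduces: "reduces q g x \<tau>"
    using reducing_sequence_exists[OF q Gq x] by blast
  have \<tau>: "\<And>k. \<tau> k \<in> borel_measurable A" "\<And>k \<omega>. \<omega> \<in> space A \<Longrightarrow> 0 \<le> \<tau> k \<omega>"
    "AE \<omega> in P x. filterlim (\<lambda>k. \<tau> k \<omega>) at_top sequentially"
    "\<And>k t. 0 \<le> t \<Longrightarrow> integrable (P x) (\<lambda>\<omega>. q (X (min t (\<tau> k \<omega>)) \<omega>) - time_integral g (min t (\<tau> k \<omega>)) \<omega>)"
    "\<And>k t. 0 \<le> t \<Longrightarrow> (\<integral>\<omega>. q (X (min t (\<tau> k \<omega>)) \<omega>) - time_integral g (min t (\<tau> k \<omega>)) \<omega> \<partial>P x) = q x"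
    using reduces unfolding reduces_def by simp_all
  let ?I = "\<lambda>k \<omega>. time_integral g (min t (\<tau> k \<omega>)) \<omega>"
  have I_meas: "?I k \<in> borel_measurable (P x)" for k
  proof -
    have "(\<lambda>\<omega>. min t (\<tau> k \<omega>)) \<in> borel_measurable A"
      by (intro borel_measurable_min borel_measurable_const \<tau>(1))
    from measurable_P[OF x time_integral_at_random_time_measurable[OF gb this]] show ?thesis .
  qed
  have I_meas': "time_integral g t \<in> borel_measurable (P x)"
    by (rule measurable_P[OF x time_integral_at_random_time_measurable[OF gb borel_measurable_const[of t]]])
  have I_le: "\<bar>?I k \<omega>\<bar> \<le> time_integral (\<lambda>y. \<bar>g y\<bar>) t \<omega>" if "\<omega> \<in> space A" for k \<omega>
    by (rule time_integral_abs_le[OF g that _ t]) simp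
  have I_int: "integrable (P x) (?I k)" for k
  proof (rule Bochner_Integration.integrable_bound[OF int I_meas], rule AE_I2)
    fix \<omega> assume "\<omega> \<in> space (P x)"
    thus "norm (?I k \<omega>) \<le> norm (time_integral (\<lambda>y. \<bar>g y\<bar>) t \<omega>)"
      using I_le[of \<omega> k] by (simp add: space_P[OF x])
  qed
  have ev: "AE \<omega> in P x. \<forall>\<^sub>F k in sequentially. min t (\<tau> k \<omega>) = t"
    by (rule stopped_limit[OF \<tau>(3)])
  have I_lim: "(\<lambda>k. \<integral>\<omega>. ?I k \<omega> \<partial>P x) \<longlonglongrightarrow> (\<integral>\<omega>. time_integral g t \<omega> \<partial>P x)"
  proof (rule integral_dominated_convergence[OF I_meas' I_meas int])
    show "AE \<omega> in P x. (\<lambda>k. ?I k \<omega>) \<longlonglongrightarrow> time_integral g t \<omega>"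
      using ev by eventually_elim (auto intro!: tendsto_eventually elim: eventually_mono)
    show "AE \<omega> in P x. norm (?I k \<omega>) \<le> time_integral (\<lambda>y. \<bar>g y\<bar>) t \<omega>" for k
      using I_le by (intro AE_I2) (simp add: space_P[OF x])
  qed
  have q_int: "integrable (P x) (\<lambda>\<omega>. q (X (min t (\<tau> k \<omega>)) \<omega>))" for k
    using Bochner_Integration.integrable_add[OF \<tau>(4)[OF t, of k] I_int[of k]] by simp
  have q_expect: "(\<integral>\<omega>. q (X (min t (\<tau> k \<omega>)) \<omega>) \<partial>P x) = q x + (\<integral>\<omega>. ?I k \<omega> \<partial>P x)" for k
    using \<tau>(5)[OF t, of k] q_int I_int[of k] by simp
  have q_nonneg: "AE \<omega> in P x. 0 \<le> q (X (min t (\<tau> k \<omega>)) \<omega>)" for k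
    using t \<tau>(2) by (intro AE_I2 nonneg state_space) (auto simp: space_P[OF x])
  have lim: "(\<lambda>k. q x + (\<integral>\<omega>. ?I k \<omega> \<partial>P x)) \<longlonglongrightarrow> q x + (\<integral>\<omega>. time_integral g t \<omega> \<partial>P x)"
    by (intro tendsto_add tendsto_const I_lim)
  have "0 \<le> q x + (\<integral>\<omega>. ?I k \<omega> \<partial>P x)" for k
    unfolding q_expect[symmetric] by (rule integral_nonneg_AE[OF q_nonneg])
  with lim show "0 \<le> q x + (\<integral>\<omega>. time_integral g t \<omega> \<partial>P x)"
    by (intro LIMSEQ_le_const) auto
  show "(\<integral>\<^sup>+\<omega>. q (X t \<omega>) \<partial>P x) \<le> ennreal (q x + (\<integral>\<omega>. time_integral g t \<omega> \<partial>P x))"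
  proof (rule fatou_limit_bound[where u = "\<lambda>k \<omega>. ennreal (q (X (min t (\<tau> k \<omega>)) \<omega>))"])
    fix k
    show "(\<lambda>\<omega>. ennreal (q (X (min t (\<tau> k \<omega>)) \<omega>))) \<in> borel_measurable (P x)"
      using borel_measurable_integrable[OF q_int] by measurable
    show "(\<integral>\<^sup>+\<omega>. ennreal (q (X (min t (\<tau> k \<omega>)) \<omega>)) \<partial>P x) \<le> ennreal (q x + (\<integral>\<omega>. ?I k \<omega> \<partial>P x))"
      by (subst nn_integral_eq_integral[OF q_int q_nonneg]) (simp add: q_expect)
  next
    show "AE \<omega> in P x. \<forall>\<^sub>F k in sequentially. ennreal (q (X (min t (\<tau> k \<omega>)) \<omega>)) = ennreal (q (X t \<omega>))"
      using ev by eventually_elim (auto elim: eventually_mono)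
    show "(\<lambda>k. ennreal (q x + (\<integral>\<omega>. ?I k \<omega> \<partial>P x))) \<longlonglongrightarrow> ennreal (q x + (\<integral>\<omega>. time_integral g t \<omega> \<partial>P x))"
      by (rule tendsto_ennrealI[OF lim])
  qed
qed

text \<open>Both \<open>c\<close> and \<open>- c\<close> attain their maximum everywhere.\<close>

lemma generator_const: "x \<in> E \<Longrightarrow> \<G> (\<lambda>_. c) x = 0"
proof (rule antisym)
  assume x: "x \<in> E"
  show "\<G> (\<lambda>_. c) x \<le> 0" by (rule positive_maximum_principle) (auto simp: x)
  have "\<G> (\<lambda>_. -1 * c) x \<le> 0" by (rule positive_maximum_principle) (auto simp: x)
  moreover have "\<G> (\<lambda>_. -1 * c) x = -1 * \<G> (\<lambda>_. c) x"
    using polynomials_in_domain x by (intro generator_scale) auto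
  ultimately show "0 \<le> \<G> (\<lambda>_. c) x" by simp
qed

end

section \<open>Dynkin's formula for polynomial processes\<close>

text \<open>A polynomial weight that dominates all polynomials of degree at most \<open>2 m\<close>. Since the
  generator does not raise degrees, it maps the weight to a polynomial that a multiple of the weight
  dominates.\<close>

definition norm_weight :: "nat \<Rightarrow> real^'d \<Rightarrow> real" where
  "norm_weight m y = (1 + (norm y)\<^sup>2) ^ m"

lemma norm_weight_ge_1: "1 \<le> norm_weight m y"
  by (simp add: norm_weight_def one_le_power)

lemma polynomial_degree_le_norm_weight: "polynomial_degree_le (2 * m) (norm_weight m :: real^'d \<Rightarrow> real)"
proof (induction m)
  case 0
  show ?case
    using polynomial_degree_le_monomial[of "\<lambda>_ :: 'd. 0" 0 1] by (simp add: norm_weight_def[abs_def])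
next
  case (Suc m)
  have sq: "polynomial_degree_le 2 (\<lambda>y :: real^'d. (vec_nth y j)\<^sup>2)" for j :: 'd
  proof -
    have "(\<Prod>i\<in>UNIV. vec_nth y i ^ (if i = j then 2 else 0)) = (vec_nth y j)\<^sup>2" for y :: "real^'d"
    proof -
      have "(\<Prod>i\<in>UNIV. vec_nth y i ^ (if i = j then 2 else 0)) = (\<Prod>i\<in>UNIV. if i = j then (vec_nth y i)\<^sup>2 else 1)"
        by (rule prod.cong) auto
      thus ?thesis by simp
    qed
    thus ?thesis
      using polynomial_degree_le_monomial[of "\<lambda>i. if i = j then 2 else 0" 2 1] by simp
  qed
  have one: "polynomial_degree_le 2 (\<lambda>y :: real^'d. 1)"
    using polynomial_degree_le_monomial[of "\<lambda>_ :: 'd. 0" 2 1] by simp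
  have "polynomial_degree_le 2 (\<lambda>y :: real^'d. 1 + (\<Sum>j\<in>UNIV. (vec_nth y j)\<^sup>2))"
    by (intro polynomial_degree_le_add polynomial_degree_le_sum sq one)
  also have "(\<lambda>y :: real^'d. 1 + (\<Sum>j\<in>UNIV. (vec_nth y j)\<^sup>2)) = (\<lambda>y. 1 + (norm y)\<^sup>2)"
    unfolding power2_norm_eq_inner inner_vec_def by (simp add: power2_eq_square)
  finally have "polynomial_degree_le (2 + 2 * m) (\<lambda>y :: real^'d. (1 + (norm y)\<^sup>2) * norm_weight m y)"
    by (rule polynomial_degree_le_mult[OF _ Suc])
  thus ?case by (simp add: norm_weight_def[abs_def])
qed

text \<open>A coordinate is at most \<open>sqrt (1 + |y|\<^sup>2)\<close>, which is at least \<open>1\<close>; so a monomial is at most the power of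
  this root that has its degree.\<close>

lemma polynomial_le_norm_weight:
  fixes p :: "real^'d \<Rightarrow> real"
  assumes "polynomial_degree_le k p" "k \<le> 2 * m"
  obtains K where "0 \<le> K" "\<And>y. \<bar>p y\<bar> \<le> K * norm_weight m y"
proof -
  obtain c where p: "p = (\<lambda>x. \<Sum>\<alpha> | (\<Sum>i\<in>UNIV. \<alpha> i) \<le> k. c \<alpha> * (\<Prod>i\<in>UNIV. vec_nth x i ^ \<alpha> i))"
    using assms unfolding polynomial_degree_le_def by blast
  define K where "K = (\<Sum>\<alpha> | (\<Sum>i\<in>UNIV. \<alpha> i) \<le> k. \<bar>c \<alpha>\<bar>)"
  show ?thesis
  proof (rule that)
    show "0 \<le> K" unfolding K_def by (intro sum_nonneg) auto
    fix y :: "real^'d"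
    define s where "s = sqrt (1 + (norm y)\<^sup>2)"
    have s1: "1 \<le> s" by (simp add: s_def)
    have "norm y \<le> s" unfolding s_def by (rule real_le_rsqrt) simp
    hence comp: "\<bar>vec_nth y i\<bar> \<le> s" for i
      using component_le_norm_cart[of y i] by linarith
    have mono: "\<bar>\<Prod>i\<in>UNIV. vec_nth y i ^ \<alpha> i\<bar> \<le> norm_weight m y" if "(\<Sum>i\<in>UNIV. \<alpha> i) \<le> k" for \<alpha>
    proof -
      have "\<bar>\<Prod>i\<in>UNIV. vec_nth y i ^ \<alpha> i\<bar> = (\<Prod>i\<in>UNIV. \<bar>vec_nth y i\<bar> ^ \<alpha> i)"
        by (simp add: abs_prod power_abs)
      also have "\<dots> \<le> (\<Prod>i\<in>UNIV. s ^ \<alpha> i)"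
        using comp by (intro prod_mono) (auto intro: power_mono)
      also have "\<dots> = s ^ (\<Sum>i\<in>UNIV. \<alpha> i)" by (simp add: power_sum)
      also have "\<dots> \<le> s ^ (2 * m)" using s1 that assms(2) by (intro power_increasing) auto
      also have "\<dots> = norm_weight m y" by (simp add: power_mult s_def norm_weight_def)
      finally show ?thesis .
    qed
    have "\<bar>p y\<bar> \<le> (\<Sum>\<alpha> | (\<Sum>i\<in>UNIV. \<alpha> i) \<le> k. \<bar>c \<alpha> * (\<Prod>i\<in>UNIV. vec_nth y i ^ \<alpha> i)\<bar>)"
      unfolding p by (rule sum_abs)
    also have "\<dots> \<le> (\<Sum>\<alpha> | (\<Sum>i\<in>UNIV. \<alpha> i) \<le> k. \<bar>c \<alpha>\<bar> * norm_weight m y)"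
      using mono by (intro sum_mono) (auto simp: abs_mult intro!: mult_left_mono)
    finally show "\<bar>p y\<bar> \<le> K * norm_weight m y" by (simp add: K_def sum_distrib_right)
  qed
qed

context polynomial_process
begin

lemma generator_polynomial:
  assumes p: "polynomial_degree_le m p" and m: "0 < m"
  obtains g where "polynomial_degree_le m g" "\<And>y. y \<in> E \<Longrightarrow> \<G> p y = g y"
proof -
  have pol: "real_polynomial_function p" using p real_polynomial_function_iff_degree_le by blast
  have "restr E p \<in> Pol_le m E" using p Pol_le_iff by blast
  hence "restr E (\<G> p) \<in> Pol_le m E"
    using generator_Pol_le[OF m] generator_on_restr[OF pol] by auto
  then obtain g where g: "polynomial_degree_le m g" "restr E g = restr E (\<G> p)"
    using Pol_le_iff by blast
  have "\<G> p y = g y" if "y \<in> E" for y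
    using fun_cong[OF g(2), of y] that by (simp add: restr_def)
  thus ?thesis using g(1) that by blast
qed

lemma generator_polynomial_function:
  assumes "real_polynomial_function p"
  obtains g where "real_polynomial_function g" "\<And>y. y \<in> E \<Longrightarrow> \<G> p y = g y"
proof -
  obtain k where "polynomial_degree_le k p" using assms real_polynomial_function_iff_degree_le by blast
  hence "polynomial_degree_le (Suc k) p" by (rule polynomial_degree_le_mono) simp
  then obtain g where "polynomial_degree_le (Suc k) g" "\<And>y. y \<in> E \<Longrightarrow> \<G> p y = g y"
    by (rule generator_polynomial) auto
  thus ?thesis using that real_polynomial_function_iff_degree_le by blast
qed

lemma moment_bound:
  assumes p: "real_polynomial_function p" and x: "x \<in> E"
  obtains B C where "0 \<le> B" "0 < C"
    "\<And>t. 0 \<le> t \<Longrightarrow> (\<integral>\<^sup>+\<omega>. ennreal \<bar>p (X t \<omega>)\<bar> \<partial>P x) \<le> ennreal (B * exp (C * t))"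
proof -
  obtain k where k: "polynomial_degree_le k p" using p real_polynomial_function_iff_degree_le by blast
  let ?f = "norm_weight (Suc k) :: real^'d \<Rightarrow> real"
  have fdeg: "polynomial_degree_le (2 * Suc k) ?f" by (rule polynomial_degree_le_norm_weight)
  hence f: "real_polynomial_function ?f" using real_polynomial_function_iff_degree_le by blast
  obtain K where K: "0 \<le> K" "\<And>y. \<bar>p y\<bar> \<le> K * ?f y"
    by (rule polynomial_le_norm_weight[OF k, of "Suc k"]) auto
  obtain g where g: "polynomial_degree_le (2 * Suc k) g" "\<And>y. y \<in> E \<Longrightarrow> \<G> ?f y = g y"
    by (rule generator_polynomial[OF fdeg]) auto
  have g': "real_polynomial_function g" using g(1) real_polynomial_function_iff_degree_le by blast
  obtain L where L: "0 \<le> L" "\<And>y. \<bar>g y\<bar> \<le> L * ?f y"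
    by (rule polynomial_le_norm_weight[OF g(1), of "Suc k"]) auto
  have f0: "0 \<le> ?f y" for y using norm_weight_ge_1[of "Suc k" y] by linarith
  have gf: "g y \<le> (L + 1) * ?f y" for y
    using L(2)[of y] f0[of y] by (simp add: distrib_right)
  have bound: "(\<integral>\<^sup>+\<omega>. ennreal \<bar>p (X t \<omega>)\<bar> \<partial>P x) \<le> ennreal (K * ?f x * exp ((L + 1) * t))" if t: "0 \<le> t" for t
  proof -
    have meas: "(\<lambda>\<omega>. ?f (X t \<omega>)) \<in> borel_measurable (P x)"
      by (intro measurable_P[OF x] measurable_compose[OF X_measurable[OF t] polynomial_function_borel[OF f]])
    have "(\<integral>\<^sup>+\<omega>. ennreal \<bar>p (X t \<omega>)\<bar> \<partial>P x) \<le> (\<integral>\<^sup>+\<omega>. ennreal K * ennreal (?f (X t \<omega>)) \<partial>P x)"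
      using K by (intro nn_integral_mono) (simp add: ennreal_mult'[symmetric] ennreal_leI)
    also have "\<dots> = ennreal K * (\<integral>\<^sup>+\<omega>. ennreal (?f (X t \<omega>)) \<partial>P x)"
      using meas by (intro nn_integral_cmult) measurable
    also have "\<dots> \<le> ennreal K * ennreal (?f x * exp ((L + 1) * t))"
      by (intro mult_left_mono exponential_moment_bound[OF f g' g(2) f0 gf _ x t]) (use L in auto)
    also have "\<dots> = ennreal (K * ?f x * exp ((L + 1) * t))"
      using K f0 by (simp add: ennreal_mult'[symmetric] mult.assoc)
    finally show ?thesis .
  qed
  show ?thesis
    by (rule that[of "K * ?f x" "L + 1"]) (use K L f0 bound in auto)
qed

lemma X_polynomial_measurable:
  "real_polynomial_function p \<Longrightarrow> x \<in> E \<Longrightarrow> 0 \<le> t \<Longrightarrow> (\<lambda>\<omega>. p (X t \<omega>)) \<in> borel_measurable (P x)"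
  by (intro measurable_P measurable_compose[OF X_measurable polynomial_function_borel])

lemma moment_integrable:
  assumes p: "real_polynomial_function p" and x: "x \<in> E" and t: "0 \<le> t"
  shows "integrable (P x) (\<lambda>\<omega>. p (X t \<omega>))"
proof -
  obtain B C where "(\<integral>\<^sup>+\<omega>. ennreal \<bar>p (X t \<omega>)\<bar> \<partial>P x) \<le> ennreal (B * exp (C * t))"
    using moment_bound[OF p x] t by metis
  also have "\<dots> < \<infinity>" by simp
  finally show ?thesis
    using X_polynomial_measurable[OF assms] by (intro integrableI_bounded) auto
qed

lemma occupation_integrable:
  assumes p: "real_polynomial_function p" and x: "x \<in> E" and t: "0 \<le> t"
  shows "integrable (lborel \<Otimes>\<^sub>M P x) (\<lambda>(s, \<omega>). indicator {0..t} s * p (X (max 0 s) \<omega>))"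
proof -
  interpret Px: prob_space "P x" by (rule prob_space_P[OF x])
  interpret pair: pair_sigma_finite lborel "P x" by standard
  obtain B C where BC: "0 \<le> B" "0 < C"
    "\<And>t. 0 \<le> t \<Longrightarrow> (\<integral>\<^sup>+\<omega>. ennreal \<bar>p (X t \<omega>)\<bar> \<partial>P x) \<le> ennreal (B * exp (C * t))"
    using moment_bound[OF p x] by blast
  have abs_le: "(\<integral>\<omega>. \<bar>p (X s \<omega>)\<bar> \<partial>P x) \<le> B * exp (C * t)" if "0 \<le> s" "s \<le> t" for s
  proof -
    have "ennreal (\<integral>\<omega>. \<bar>p (X s \<omega>)\<bar> \<partial>P x) = (\<integral>\<^sup>+\<omega>. ennreal \<bar>p (X s \<omega>)\<bar> \<partial>P x)"
      by (rule nn_integral_eq_integral[symmetric]) (use moment_integrable[OF p x that(1)] in auto)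
    also have "\<dots> \<le> ennreal (B * exp (C * s))" by (rule BC(3)[OF that(1)])
    also have "\<dots> \<le> ennreal (B * exp (C * t))"
      using BC that by (intro ennreal_leI mult_left_mono) auto
    finally show ?thesis using BC by (subst (asm) ennreal_le_iff) auto
  qed
  show ?thesis
  proof (rule pair.Fubini_integrable)
    have "(\<lambda>(s, \<omega>). p (X (max 0 s) \<omega>)) \<in> borel_measurable (lborel \<Otimes>\<^sub>M P x)"
      using measurable_pair_P[OF x measurable_compose[OF X_jointly_measurable polynomial_function_borel[OF p]]]
      by (simp add: case_prod_beta')
    thus meas: "(\<lambda>(s, \<omega>). indicator {0..t} s * p (X (max 0 s) \<omega>)) \<in> borel_measurable (lborel \<Otimes>\<^sub>M P x)"
      by measurable
    show "AE s in lborel. integrable (P x) (\<lambda>\<omega>. case (s, \<omega>) of (s, \<omega>) \<Rightarrow> indicator {0..t} s * p (X (max 0 s) \<omega>))"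
      using moment_integrable[OF p x] by (intro AE_I2) simp
    have "(\<lambda>s. \<integral>\<omega>. norm (indicator {0..t} s * p (X (max 0 s) \<omega>)) \<partial>P x) \<in> borel_measurable lborel"
      using meas by (intro Px.borel_measurable_lebesgue_integral) (simp add: case_prod_beta')
    moreover have "norm (\<integral>\<omega>. norm (indicator {0..t} s * p (X (max 0 s) \<omega>)) \<partial>P x)
        \<le> norm (indicator {0..t} s *\<^sub>R (B * exp (C * t)))" for s
      using abs_le[of s] BC by (auto simp: indicator_def)
    ultimately show "integrable lborel (\<lambda>s. \<integral>\<omega>. norm (case (s, \<omega>) of (s, \<omega>) \<Rightarrow> indicator {0..t} s * p (X (max 0 s) \<omega>)) \<partial>P x)"
      by (intro Bochner_Integration.integrable_bound[OF borel_integrable_compact[of "{0..t}" "\<lambda>_. B * exp (C * t)"]]) auto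
  qed
qed

text \<open>Fubini's theorem for time and randomness, applied to \<open>occupation_integrable\<close>.\<close>

lemma time_integral_expectation:
  assumes p: "real_polynomial_function p" and x: "x \<in> E" and t: "0 \<le> t"
  shows "integrable (P x) (time_integral p t)" "integrable (P x) (time_integral (\<lambda>y. \<bar>p y\<bar>) t)"
    "set_integrable lborel {0..t} (\<lambda>s. \<integral>\<omega>. p (X s \<omega>) \<partial>P x)"
    "(\<integral>\<omega>. time_integral p t \<omega> \<partial>P x) = (LBINT s:{0..t}. (\<integral>\<omega>. p (X s \<omega>) \<partial>P x))"
proof -
  interpret Px: prob_space "P x" by (rule prob_space_P[OF x])
  interpret pair: pair_sigma_finite lborel "P x" by standard
  let ?f = "\<lambda>s \<omega>. indicator {0..t} s * p (X (max 0 s) \<omega>)"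
  have int: "integrable (lborel \<Otimes>\<^sub>M P x) (case_prod ?f)" by (rule occupation_integrable[OF assms])
  show "integrable (P x) (time_integral p t)"
    using pair.integrable_snd[OF int] by (simp add: time_integral_eq[abs_def])
  have "(\<lambda>q. \<bar>case_prod ?f q\<bar>) = (\<lambda>(s, \<omega>). indicator {0..t} s * \<bar>p (X (max 0 s) \<omega>)\<bar>)"
    by (auto simp: fun_eq_iff abs_mult)
  hence "integrable (lborel \<Otimes>\<^sub>M P x) (\<lambda>(s, \<omega>). indicator {0..t} s * \<bar>p (X (max 0 s) \<omega>)\<bar>)"
    using integrable_abs[OF int] by simp
  from pair.integrable_snd[OF this]
  show "integrable (P x) (time_integral (\<lambda>y. \<bar>p y\<bar>) t)" by (simp add: time_integral_eq[abs_def])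
  have inner: "(\<integral>\<omega>. ?f s \<omega> \<partial>P x) = indicator {0..t} s *\<^sub>R (\<integral>\<omega>. p (X s \<omega>) \<partial>P x)" for s
    by (auto simp: indicator_def)
  show "set_integrable lborel {0..t} (\<lambda>s. \<integral>\<omega>. p (X s \<omega>) \<partial>P x)"
    using pair.integrable_fst[OF int] unfolding set_integrable_def inner .
  show "(\<integral>\<omega>. time_integral p t \<omega> \<partial>P x) = (LBINT s:{0..t}. (\<integral>\<omega>. p (X s \<omega>) \<partial>P x))"
    using pair.Fubini_integral[OF int] unfolding set_lebesgue_integral_def inner time_integral_eq .
qed

text \<open>The polynomial \<open>q = \<epsilon> p\<^sup>2 - p + 1 / (4 \<epsilon>)\<close> equals \<open>(2 \<epsilon> p - 1)\<^sup>2 / (4 \<epsilon>)\<close>, so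
  \<open>supermartingale_inequality\<close> applies to it. The constant is annihilated by \<open>\<G>\<close> and cancels; what
  remains is the claim up to an error \<open>\<epsilon> a\<close>, where \<open>a\<close> is finite because the moments of \<open>p\<^sup>2\<close> are.\<close>

lemma dynkin_inequality:
  assumes p: "real_polynomial_function p" and g: "real_polynomial_function g"
    and Gp: "\<And>y. y \<in> E \<Longrightarrow> \<G> p y = g y" and x: "x \<in> E" and t: "0 \<le> t"
  shows "p x + (\<integral>\<omega>. time_integral g t \<omega> \<partial>P x) \<le> (\<integral>\<omega>. p (X t \<omega>) \<partial>P x)"
proof -
  interpret Px: prob_space "P x" by (rule prob_space_P[OF x])
  let ?sq = "\<lambda>y. p y * p y"
  have sq: "real_polynomial_function ?sq" using p p by (rule real_polynomial_function.intros(4))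
  obtain h where h: "real_polynomial_function h" "\<And>y. y \<in> E \<Longrightarrow> \<G> ?sq y = h y"
    using generator_polynomial_function[OF sq] by blast
  define a where "a = ?sq x + (\<integral>\<omega>. time_integral h t \<omega> \<partial>P x) - (\<integral>\<omega>. ?sq (X t \<omega>) \<partial>P x)"
  define b where "b = p x + (\<integral>\<omega>. time_integral g t \<omega> \<partial>P x) - (\<integral>\<omega>. p (X t \<omega>) \<partial>P x)"
  have D: "f \<in> D" if "real_polynomial_function f" for f using that polynomials_in_domain by blast
  have le: "b \<le> \<epsilon> * a" if \<epsilon>: "0 < \<epsilon>" for \<epsilon>
  proof -
    define q where "q = (\<lambda>y. \<epsilon> * ?sq y + (-1 * p y + 1 / (4 * \<epsilon>)))"
    define k where "k = (\<lambda>y. \<epsilon> * h y + -1 * g y)"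
    have \<epsilon>sq: "real_polynomial_function (\<lambda>y. \<epsilon> * ?sq y)" and mp: "real_polynomial_function (\<lambda>y. -1 * p y)"
      and c: "real_polynomial_function (\<lambda>y :: real^'d. 1 / (4 * \<epsilon>))"
      by (intro real_polynomial_function.intros(2,4) p)+
    have q: "real_polynomial_function q" unfolding q_def
      by (intro real_polynomial_function.intros(3) \<epsilon>sq mp c)
    have k: "real_polynomial_function k" unfolding k_def
      by (intro real_polynomial_function.intros(2-4) h(1) g)
    have Gq: "\<G> q y = k y" if y: "y \<in> E" for y
    proof -
      have "\<G> q y = \<G> (\<lambda>y. \<epsilon> * ?sq y) y + \<G> (\<lambda>y. -1 * p y + 1 / (4 * \<epsilon>)) y"
        unfolding q_def using \<epsilon>sq mp c y by (intro generator_add D real_polynomial_function.intros(3))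
      also have "\<G> (\<lambda>y. -1 * p y + 1 / (4 * \<epsilon>)) y = \<G> (\<lambda>y. -1 * p y) y + \<G> (\<lambda>y. 1 / (4 * \<epsilon>)) y"
        using mp c y by (intro generator_add D)
      also have "\<G> (\<lambda>y. 1 / (4 * \<epsilon>)) y = 0" by (rule generator_const[OF y])
      also have "\<G> (\<lambda>y. -1 * p y) y = -1 * \<G> p y" using p y by (intro generator_scale D)
      also have "\<G> (\<lambda>y. \<epsilon> * ?sq y) y = \<epsilon> * \<G> ?sq y" using sq y by (intro generator_scale D)
      finally show ?thesis using y by (simp add: k_def Gp h(2))
    qed
    have q0: "0 \<le> q y" for y
    proof -
      have "q y = (2 * \<epsilon> * p y - 1)\<^sup>2 / (4 * \<epsilon>)"
        using \<epsilon> by (simp add: q_def power2_eq_square field_simps)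
      thus ?thesis using \<epsilon> by simp
    qed
    have q_int: "integrable (P x) (\<lambda>\<omega>. q (X t \<omega>))" by (rule moment_integrable[OF q x t])
    have "ennreal (\<integral>\<omega>. q (X t \<omega>) \<partial>P x) = (\<integral>\<^sup>+\<omega>. q (X t \<omega>) \<partial>P x)"
      by (rule nn_integral_eq_integral[symmetric]) (use q_int q0 in auto)
    also have "\<dots> \<le> ennreal (q x + (\<integral>\<omega>. time_integral k t \<omega> \<partial>P x))"
      by (rule supermartingale_inequality(1)[OF q k Gq q0 x t time_integral_expectation(2)[OF k x t]])
    finally have *: "ennreal (\<integral>\<omega>. q (X t \<omega>) \<partial>P x) \<le> ennreal (q x + (\<integral>\<omega>. time_integral k t \<omega> \<partial>P x))" .
    have int: "integrable (P x) (\<lambda>\<omega>. ?sq (X t \<omega>))" "integrable (P x) (\<lambda>\<omega>. p (X t \<omega>))"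
      by (rule moment_integrable[OF sq x t], rule moment_integrable[OF p x t])
    have Eq: "(\<integral>\<omega>. q (X t \<omega>) \<partial>P x)
        = \<epsilon> * (\<integral>\<omega>. ?sq (X t \<omega>) \<partial>P x) + (- (\<integral>\<omega>. p (X t \<omega>) \<partial>P x) + 1 / (4 * \<epsilon>))"
      unfolding q_def using int by (simp add: Px.prob_space)
    have TI: "time_integral k t \<omega> = \<epsilon> * time_integral h t \<omega> - time_integral g t \<omega>" if "\<omega> \<in> space A" for \<omega>
    proof -
      note ih = path_integrable[OF h(1) that t] and ig = path_integrable[OF g that t]
      have "time_integral k t \<omega> = (LBINT s:{0..t}. \<epsilon> * h (X s \<omega>) - g (X s \<omega>))"
        by (simp add: time_integral_def k_def)
      also have "\<dots> = (LBINT s:{0..t}. \<epsilon> * h (X s \<omega>)) - time_integral g t \<omega>"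
        unfolding time_integral_def by (rule set_integral_diff(2)[OF set_integrable_mult_right[OF ih] ig])
      finally show ?thesis by (simp add: time_integral_def)
    qed
    have "(\<integral>\<omega>. time_integral k t \<omega> \<partial>P x) = (\<integral>\<omega>. \<epsilon> * time_integral h t \<omega> - time_integral g t \<omega> \<partial>P x)"
      by (intro Bochner_Integration.integral_cong) (auto simp: TI space_P[OF x])
    also have "\<dots> = \<epsilon> * (\<integral>\<omega>. time_integral h t \<omega> \<partial>P x) - (\<integral>\<omega>. time_integral g t \<omega> \<partial>P x)"
      using time_integral_expectation(1)[OF h(1) x t] time_integral_expectation(1)[OF g x t] by simp
    finally have ETI: "(\<integral>\<omega>. time_integral k t \<omega> \<partial>P x) = \<epsilon> * (\<integral>\<omega>. time_integral h t \<omega> \<partial>P x) - (\<integral>\<omega>. time_integral g t \<omega> \<partial>P x)" .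
    have "(\<integral>\<omega>. q (X t \<omega>) \<partial>P x) \<le> q x + (\<integral>\<omega>. time_integral k t \<omega> \<partial>P x)"
    proof (rule ennreal_le_iff[THEN iffD1, OF _ *])
      show "0 \<le> q x + (\<integral>\<omega>. time_integral k t \<omega> \<partial>P x)"
        by (rule supermartingale_inequality(2)[OF q k Gq q0 x t time_integral_expectation(2)[OF k x t]])
    qed
    moreover have qx: "q x = \<epsilon> * ?sq x + (-1 * p x + 1 / (4 * \<epsilon>))" by (simp only: q_def)
    ultimately have "\<epsilon> * (\<integral>\<omega>. ?sq (X t \<omega>) \<partial>P x) - (\<integral>\<omega>. p (X t \<omega>) \<partial>P x)
        \<le> \<epsilon> * ?sq x - p x + (\<epsilon> * (\<integral>\<omega>. time_integral h t \<omega> \<partial>P x) - (\<integral>\<omega>. time_integral g t \<omega> \<partial>P x))"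
      unfolding Eq ETI qx by linarith
    moreover have "\<epsilon> * a = \<epsilon> * ?sq x + \<epsilon> * (\<integral>\<omega>. time_integral h t \<omega> \<partial>P x) - \<epsilon> * (\<integral>\<omega>. ?sq (X t \<omega>) \<partial>P x)"
      by (simp only: a_def right_diff_distrib distrib_left)
    ultimately show ?thesis unfolding b_def by linarith
  qed
  have "b \<le> 0"
  proof (rule tendsto_lowerbound[of "\<lambda>\<epsilon>. \<epsilon> * a" 0 "at_right 0"])
    show "((\<lambda>\<epsilon>. \<epsilon> * a) \<longlongrightarrow> 0) (at_right 0)" by (auto intro!: tendsto_eq_intros)
    show "\<forall>\<^sub>F \<epsilon> in at_right 0. b \<le> \<epsilon> * a"
      using eventually_at_right_less[of "0 :: real"] by eventually_elim (rule le)
  qed simp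
  thus ?thesis by (simp add: b_def)
qed

text \<open>The inequality for \<open>p\<close> and for \<open>- p\<close>.\<close>

lemma dynkin_formula:
  assumes p: "real_polynomial_function p" and g: "real_polynomial_function g"
    and Gp: "\<And>y. y \<in> E \<Longrightarrow> \<G> p y = g y" and x: "x \<in> E" and t: "0 \<le> t"
  shows "(\<integral>\<omega>. p (X t \<omega>) \<partial>P x) = p x + (LBINT s:{0..t}. (\<integral>\<omega>. g (X s \<omega>) \<partial>P x))"
proof -
  have mp: "real_polynomial_function (\<lambda>y. -1 * p y)" and mg: "real_polynomial_function (\<lambda>y. -1 * g y)"
    by (intro real_polynomial_function.intros(2,4) p g)+
  have "\<G> (\<lambda>y. -1 * p y) y = -1 * g y" if "y \<in> E" for y
    using generator_scale[of p y "-1"] polynomials_in_domain p Gp that by auto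
  from dynkin_inequality[OF mp mg this x t]
  have "- p x + (\<integral>\<omega>. time_integral (\<lambda>y. - g y) t \<omega> \<partial>P x) \<le> - (\<integral>\<omega>. p (X t \<omega>) \<partial>P x)" by simp
  moreover have "time_integral (\<lambda>y. - g y) t \<omega> = - time_integral g t \<omega>" for \<omega>
    by (simp add: time_integral_def set_lebesgue_integral_def)
  ultimately have "(\<integral>\<omega>. p (X t \<omega>) \<partial>P x) \<le> p x + (\<integral>\<omega>. time_integral g t \<omega> \<partial>P x)" by simp
  with dynkin_inequality[OF p g Gp x t] show ?thesis
    unfolding time_integral_expectation(4)[OF g x t] by simp
qed

lemma moment_continuous:
  assumes p: "real_polynomial_function p" and x: "x \<in> E"
  shows "continuous_on {0..} (\<lambda>t. \<integral>\<omega>. p (X t \<omega>) \<partial>P x)"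
proof -
  obtain g where g: "real_polynomial_function g" "\<And>y. y \<in> E \<Longrightarrow> \<G> p y = g y"
    using generator_polynomial_function[OF p] by blast
  let ?v = "\<lambda>s. \<integral>\<omega>. g (X s \<omega>) \<partial>P x"
  have cont: "continuous_on {0..T} (\<lambda>t. \<integral>\<omega>. p (X t \<omega>) \<partial>P x)" for T
  proof (cases "0 \<le> T")
    case True
    have "continuous_on {0..T} (\<lambda>t. p x + integral {0..t} ?v)"
      using set_borel_integral_eq_integral(1)[OF time_integral_expectation(3)[OF g(1) x True]]
      by (intro continuous_intros indefinite_integral_continuous_1)
    also have "?this \<longleftrightarrow> ?thesis"
    proof (rule continuous_on_cong[OF refl])
      fix t assume "t \<in> {0..T}"
      hence t: "0 \<le> t" by simp
      show "p x + integral {0..t} ?v = (\<integral>\<omega>. p (X t \<omega>) \<partial>P x)"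
        using dynkin_formula[OF p g x t] set_borel_integral_eq_integral(2)[OF time_integral_expectation(3)[OF g(1) x t]]
        by simp
    qed
    finally show ?thesis .
  qed simp
  show ?thesis unfolding continuous_on_eq_continuous_within
  proof
    fix t :: real assume t: "t \<in> {0..}"
    have "continuous (at t within {0..t + 1}) (\<lambda>t. \<integral>\<omega>. p (X t \<omega>) \<partial>P x)"
      using cont[of "t + 1"] t unfolding continuous_on_eq_continuous_within by auto
    moreover have "at t within {0..} = at t within {0..t + 1}"
      by (rule at_within_nhd[of t "{..<t + 1}"]) auto
    ultimately show "continuous (at t within {0..}) (\<lambda>t. \<integral>\<omega>. p (X t \<omega>) \<partial>P x)" by simp
  qed
qed

text \<open>The generator of a polynomial is again a polynomial, so the integrand in Dynkin's formula is itself a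
  continuous moment function, and the fundamental theorem of calculus applies.\<close>

lemma moment_derivative:
  assumes p: "real_polynomial_function p" and g: "real_polynomial_function g"
    and Gp: "\<And>y. y \<in> E \<Longrightarrow> \<G> p y = g y" and x: "x \<in> E" and t: "0 < t"
  shows "((\<lambda>t. \<integral>\<omega>. p (X t \<omega>) \<partial>P x) has_real_derivative (\<integral>\<omega>. g (X t \<omega>) \<partial>P x)) (at t)"
proof -
  let ?v = "\<lambda>s. \<integral>\<omega>. g (X s \<omega>) \<partial>P x"
  have "continuous_on {0..t + 1} ?v"
    by (rule continuous_on_subset[OF moment_continuous[OF g x]]) auto
  hence "((\<lambda>t. integral {0..t} ?v) has_real_derivative ?v t) (at t within {0..t + 1})"
    by (rule integral_has_real_derivative) (use t in auto)
  hence "((\<lambda>t. p x + integral {0..t} ?v) has_real_derivative ?v t) (at t within {0..t + 1})"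
    by (auto intro!: derivative_eq_intros)
  moreover have "at t within {0..t + 1} = at t"
    using t by (intro at_within_interior) auto
  ultimately have "((\<lambda>t. p x + integral {0..t} ?v) has_real_derivative ?v t) (at t)" by simp
  thus ?thesis
  proof (rule has_field_derivative_transform_within_open[of _ _ _ "{0<..}"])
    show "p x + integral {0..s} ?v = (\<integral>\<omega>. p (X s \<omega>) \<partial>P x)" if "s \<in> {0<..}" for s
      using that dynkin_formula[OF p g Gp x, of s]
        set_borel_integral_eq_integral(2)[OF time_integral_expectation(3)[OF g x, of s]] by simp
  qed (use t in auto)
qed

end

section \<open>Markov cubature for large time steps\<close>

text \<open>The left inverse is \<open>(H\<^sup>T H)\<^bsup>-1\<^esup> H\<^sup>T\<close>: full column rank makes \<open>H\<close> injective, and then the Gram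
  matrix \<open>H\<^sup>T H\<close> is injective as well.\<close>

lemma left_inverse_of_full_column_rank:
  fixes H :: "real mat"
  assumes H: "H \<in> carrier_mat m n" and rank: "vec_space.rank m H = n"
  obtains L where "L \<in> carrier_mat n m" "L * H = 1\<^sub>m n"
proof -
  interpret vec_space "TYPE(real)" m .
  have inj: "v = 0\<^sub>v n" if v: "v \<in> carrier_vec n" and Hv: "H *\<^sub>v v = 0\<^sub>v m" for v
  proof (rule ccontr)
    assume "v \<noteq> 0\<^sub>v n"
    have "distinct (cols H)"
    proof -
      obtain S where S: "maximal S (\<lambda>T. T \<subseteq> set (cols H) \<and> lin_indpt T)"
        using maximal_exists[of "\<lambda>T. T \<subseteq> set (cols H) \<and> lin_indpt T" "card (set (cols H))" "{}"]
        by (meson List.finite_set card_mono empty_iff empty_subsetI finite_lin_indpt2 rev_finite_subset)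
      have "n = card S" using rank_card_indpt[OF H S] rank by simp
      also have "\<dots> \<le> card (set (cols H))" using S by (auto simp: maximal_def intro: card_mono)
      finally show ?thesis using H card_length[of "cols H"] by (intro card_distinct) simp
    qed
    thus False
      using full_rank_lin_indpt[OF H rank] lin_depI[OF H v \<open>v \<noteq> 0\<^sub>v n\<close> Hv] by blast
  qed
  let ?N = "transpose_mat H * H"
  have N: "?N \<in> carrier_mat n n" using H by simp
  have "det ?N \<noteq> 0"
  proof
    assume "det ?N = 0"
    then obtain v where v: "v \<in> carrier_vec n" "v \<noteq> 0\<^sub>v n" "?N *\<^sub>v v = 0\<^sub>v n"
      using det_0_iff_vec_prod_zero[OF N] by blast
    have Hv: "H *\<^sub>v v \<in> carrier_vec m" using H v by simp
    have "transpose_mat H *\<^sub>v (H *\<^sub>v v) = 0\<^sub>v n"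
      using v(3) H v(1) by (simp add: assoc_mult_mat_vec[of _ n m _ n])
    hence "(H *\<^sub>v v) \<bullet> (H *\<^sub>v v) = 0"
      using transpose_vec_mult_scalar[OF H v(1) Hv] v(1) by simp
    hence "H *\<^sub>v v = 0\<^sub>v m"
      using conjugate_square_eq_0_vec[OF Hv] by simp
    thus False using inj v by blast
  qed
  then obtain B where B: "B \<in> carrier_mat n n" "B * ?N = 1\<^sub>m n"
    using det_non_zero_imp_unit[OF N] by (auto simp: Units_def ring_mat_def)
  show ?thesis
  proof (rule that)
    show "B * transpose_mat H \<in> carrier_mat n m" using B H by simp
    show "B * transpose_mat H * H = 1\<^sub>m n"
      using B H by (subst assoc_mult_mat[of _ n n _ m _ n]) auto
  qed
qed

theorem theorem5p2:
  fixes A :: "'w measure" and F :: "real \<Rightarrow> 'w measure"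
    and E :: "(real^'d) set" and P :: "real^'d \<Rightarrow> 'w measure"
    and X :: "real \<Rightarrow> 'w \<Rightarrow> real^'d"
    and D :: "(real^'d \<Rightarrow> real) set" and \<G> :: "(real^'d \<Rightarrow> real) \<Rightarrow> real^'d \<Rightarrow> real"
    and n N M :: nat and h :: "nat \<Rightarrow> real^'d \<Rightarrow> real" and G :: "real mat"
    and x :: "nat \<Rightarrow> real^'d" and w :: "nat \<Rightarrow> real"
  defines "\<mu> \<equiv> \<lambda>j. asymptotic_moment E P X (h j)"
  assumes "polynomial_process A F E P X D \<G>"
    and "0 < n"
    and "N = fun_space.dim (Pol_le n E)"
    and "inj_on h {..<N}" and "fun_space.independent (h ` {..<N})"
    and "fun_space.span (h ` {..<N}) = Pol_le n E"
    and "G \<in> carrier_mat N N"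
    and "\<And>y. y \<in> E \<Longrightarrow>
           Matrix.vec N (\<lambda>j. generator_on E \<G> (h j) y)
           = transpose_mat G *\<^sub>v Matrix.vec N (\<lambda>j. h j y)"
    and "\<And>z. eigenvalue (map_mat complex_of_real G) z \<Longrightarrow> z \<noteq> 0 \<Longrightarrow> Re z < 0"
    and "Polynomial.order 0 (char_poly (map_mat complex_of_real G)) = 1"
  shows "(\<forall>y\<in>E. \<forall>j<N.
            (\<forall>t\<ge>0. integrable (P y) (\<lambda>\<omega>. h j (X t \<omega>))) \<and>
            ((\<lambda>t. \<integral>\<omega>. h j (X t \<omega>) \<partial>P y) \<longlongrightarrow> \<mu> j) at_top) \<and>
         ((\<forall>i<M. x i \<in> E) \<and> inj_on x {..<M} \<and> (\<forall>i<M. 0 < w i) \<and>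
            (\<forall>j<N. \<mu> j = (\<Sum>i<M. w i * h j (x i))) \<and>
            vec_space.rank M (Matrix.mat M N (\<lambda>(i, j). h j (x i))) = N
          \<longrightarrow> (\<forall>\<^sub>F \<Delta> in at_top.
                 \<exists>(A\<^sub>Y :: (nat \<Rightarrow> real^'d) measure) F\<^sub>Y P\<^sub>Y Y.
                   markov_cubature n E P X {real l * \<Delta> | l. 0 < l} (x ` {..<M}) A\<^sub>Y F\<^sub>Y P\<^sub>Y Y))"
proof -
  interpret polynomial_process A F E P X D \<G> by fact
  note G = \<open>G \<in> carrier_mat N N\<close>
  have in_Pol: "h j \<in> Pol_le n E" if "j < N" for j
    using that fun_space.span_base[of "h j" "h ` {..<N}"] assms(7) by auto
  \<comment> \<open>The basis functions vanish outside \<open>E\<close>; the process only sees the polynomials \<open>p j\<close> that they restrict.\<close>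
  have "\<forall>j. \<exists>p. j < N \<longrightarrow> real_polynomial_function p \<and> restr E p = h j"
    using in_Pol unfolding Pol_le_iff by (meson real_polynomial_function_iff_degree_le)
  then obtain p where p: "\<And>j. j < N \<Longrightarrow> real_polynomial_function (p j)" "\<And>j. j < N \<Longrightarrow> restr E (p j) = h j"
    by metis
  have hp: "h j y = p j y" if "j < N" "y \<in> E" for j y
    using fun_cong[OF p(2)[OF that(1)], of y] that(2) by (simp add: restr_def)
  have Gp: "\<G> (p j) y = (\<Sum>i<N. G $$ (i, j) * p i y)" if j: "j < N" and y: "y \<in> E" for j y
  proof -
    have "\<G> (p j) y = generator_on E \<G> (h j) y"
      using generator_on_restr[OF p(1)[OF j]] y unfolding p(2)[OF j] by (simp add: restr_def)
    also have "\<dots> = (transpose_mat G *\<^sub>v Matrix.vec N (\<lambda>j. h j y)) $ j"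
      using assms(9)[OF y] j by (metis index_vec)
    also have "\<dots> = (\<Sum>i<N. G $$ (i, j) * h i y)"
      using j G by (auto simp: scalar_prod_def atLeast0LessThan intro!: sum.cong)
    also have "\<dots> = (\<Sum>i<N. G $$ (i, j) * p i y)"
      using y by (intro sum.cong) (auto simp: hp)
    finally show ?thesis .
  qed
  have Gp_poly: "real_polynomial_function (\<lambda>y. \<Sum>i<N. G $$ (i, j) * p i y)" for j
    by (intro real_polynomial_function_sum real_polynomial_function.intros(2,4) p(1)) auto
  define u where "u y j t = (\<integral>\<omega>. p j (X t \<omega>) \<partial>P y)" for y j t
  have int: "integrable (P y) (\<lambda>\<omega>. p j (X t \<omega>))" if "j < N" "y \<in> E" "0 \<le> t" for y j t
    using moment_integrable[OF p(1)] that by blast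
  have h_p: "h j (X t \<omega>) = p j (X t \<omega>)" if "j < N" "y \<in> E" "0 \<le> t" "\<omega> \<in> space (P y)" for y j t \<omega>
    using that by (intro hp state_space) (auto simp: space_P)
  have h_int: "integrable (P y) (\<lambda>\<omega>. h j (X t \<omega>))" if "j < N" "y \<in> E" "0 \<le> t" for y j t
    using int[OF that] by (rule Bochner_Integration.integrable_cong[THEN iffD2, rotated 2]) (use h_p that in auto)
  have h_u: "(\<integral>\<omega>. h j (X t \<omega>) \<partial>P y) = u y j t" if "j < N" "y \<in> E" "0 \<le> t" for y j t
    unfolding u_def using h_p that by (intro Bochner_Integration.integral_cong) auto
  have u_cont: "continuous_on {0..} (u y j)" if "j < N" "y \<in> E" for y j
    unfolding u_def using moment_continuous[OF p(1)] that by blast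
  have u_deriv: "(u y j has_real_derivative (\<Sum>i<N. G $$ (i, j) * u y i t)) (at t)"
    if "j < N" "y \<in> E" "0 < t" for y j t
  proof -
    have "(u y j has_real_derivative (\<integral>\<omega>. (\<Sum>i<N. G $$ (i, j) * p i (X t \<omega>)) \<partial>P y)) (at t)"
      unfolding u_def using that by (intro moment_derivative p(1) Gp_poly Gp)
    also have "(\<integral>\<omega>. (\<Sum>i<N. G $$ (i, j) * p i (X t \<omega>)) \<partial>P y) = (\<Sum>i<N. G $$ (i, j) * u y i t)"
      unfolding u_def using that int by (subst Bochner_Integration.integral_sum) auto
    finally show ?thesis .
  qed
  have u_0: "u y j 0 = h j y" if "j < N" "y \<in> E" for y j
  proof -
    interpret Py: prob_space "P y" by (rule prob_space_P[OF that(2)])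
    have "AE \<omega> in P y. p j (X 0 \<omega>) = p j y" using start[OF that(2)] by eventually_elim simp
    hence "u y j 0 = (\<integral>\<omega>. p j y \<partial>P y)"
      unfolding u_def using int[OF that, of 0] by (intro integral_cong_AE) auto
    thus ?thesis using that by (simp add: Py.prob_space hp)
  qed
  have one_in: "restr E (\<lambda>_. 1) \<in> Pol_le n E"
    unfolding Pol_le_iff using polynomial_degree_le_monomial[of "\<lambda>_. 0" n 1] by auto
  have coords: "\<exists>a. \<forall>y\<in>E. f y = (\<Sum>j<N. a j * h j y)" if "f \<in> Pol_le n E" for f
  proof -
    have "f \<in> fun_space.span (h ` {..<N})" using that assms(7) by simp
    then obtain b where "f = (\<Sum>v\<in>h ` {..<N}. (\<lambda>y. b v * v y))"
      using fun_space.span_finite[of "h ` {..<N}"] by auto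
    hence "f = (\<Sum>j<N. (\<lambda>y. b (h j) * h j y))"
      by (simp add: sum.reindex[OF assms(5)])
    moreover have "(\<Sum>j\<in>J. g j) y = (\<Sum>j\<in>J. g j y)" for J :: "nat set" and g :: "nat \<Rightarrow> real^'d \<Rightarrow> real" and y
      by (induction J rule: infinite_finite_induct) auto
    ultimately have "f y = (\<Sum>j<N. b (h j) * h j y)" for y by simp
    thus ?thesis by (intro exI[of _ "\<lambda>j. b (h j)"]) blast
  qed
  obtain c where c: "\<And>y. y \<in> E \<Longrightarrow> (\<Sum>j<N. c j * h j y) = 1"
    using coords[OF one_in] by (auto simp: restr_def)
  have c_u: "(\<Sum>j<N. c j * u y j t) = 1" if y: "y \<in> E" and t: "0 \<le> t" for y t
  proof -
    interpret Py: prob_space "P y" by (rule prob_space_P[OF y])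
    have "(\<Sum>j<N. c j * u y j t) = (\<integral>\<omega>. (\<Sum>j<N. c j * h j (X t \<omega>)) \<partial>P y)"
      using h_int[OF _ y t] h_u[OF _ y t] by (subst Bochner_Integration.integral_sum) auto
    also have "\<dots> = (\<integral>\<omega>. 1 \<partial>P y)"
      using y t by (intro Bochner_Integration.integral_cong refl c state_space) (auto simp: space_P)
    finally show ?thesis by (simp add: Py.prob_space)
  qed
  obtain \<kappa> \<alpha> :: "nat \<Rightarrow> complex" where lim:
    "\<forall>u. (\<forall>j<N. continuous_on {0..} (u j) \<and>
       (\<forall>t>0. (u j has_real_derivative (\<Sum>i<N. G $$ (i, j) * u i t)) (at t))) \<longrightarrow>
    (\<forall>j<N. ((\<lambda>t. complex_of_real (u j t)) \<longlongrightarrow> \<kappa> j * (\<Sum>i<N. \<alpha> i * of_real (u i 0))) at_top)"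
    using linear_system_tendsto_rank_one[OF G assms(10,11)] by blast
  \<comment> \<open>The limit is \<open>\<kappa> j\<close> times a number \<open>\<beta>\<close> that depends on \<open>y\<close>. Summing against \<open>c\<close> shows \<open>s * \<beta> = 1\<close>, so \<open>\<beta>\<close> is the same for all \<open>y\<close>.\<close>
  define s where "s = (\<Sum>j<N. of_real (c j) * \<kappa> j)"
  have u_lim: "(u y j \<longlongrightarrow> Re (\<kappa> j / s)) at_top" if j: "j < N" and y: "y \<in> E" for y j
  proof -
    define \<beta> where "\<beta> = (\<Sum>i<N. \<alpha> i * of_real (u y i 0))"
    have L: "((\<lambda>t. complex_of_real (u y j t)) \<longlongrightarrow> \<kappa> j * \<beta>) at_top" if "j < N" for j
      unfolding \<beta>_def using lim[THEN spec, of "u y"] u_cont[OF _ y] u_deriv[OF _ y] that by blast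
    have "((\<lambda>t. \<Sum>j<N. of_real (c j) * complex_of_real (u y j t)) \<longlongrightarrow> (\<Sum>j<N. of_real (c j) * (\<kappa> j * \<beta>))) at_top"
      by (intro tendsto_intros L) auto
    also have "(\<Sum>j<N. of_real (c j) * (\<kappa> j * \<beta>)) = s * \<beta>"
      by (simp add: s_def sum_distrib_right mult.assoc)
    finally have "((\<lambda>t. \<Sum>j<N. of_real (c j) * complex_of_real (u y j t)) \<longlongrightarrow> s * \<beta>) at_top" .
    moreover have "\<forall>\<^sub>F t in at_top. (\<Sum>j<N. of_real (c j) * complex_of_real (u y j t)) = 1"
    proof (rule eventually_mono[OF eventually_ge_at_top[of 0]])
      fix t :: real assume "0 \<le> t"
      have "(\<Sum>j<N. of_real (c j) * complex_of_real (u y j t)) = of_real (\<Sum>j<N. c j * u y j t)" by simp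
      thus "(\<Sum>j<N. of_real (c j) * complex_of_real (u y j t)) = 1"
        unfolding c_u[OF y \<open>0 \<le> t\<close>] by simp
    qed
    ultimately have "((\<lambda>t. 1) \<longlongrightarrow> s * \<beta>) (at_top :: real filter)"
      by (rule Lim_transform_eventually)
    hence "s * \<beta> = 1" using tendsto_unique[OF trivial_limit_at_top_linorder _ tendsto_const] by metis
    hence "\<beta> = 1 / s" by (metis mult_zero_left nonzero_mult_div_cancel_left zero_neq_one)
    hence "((\<lambda>t. complex_of_real (u y j t)) \<longlongrightarrow> \<kappa> j / s) at_top" using L[OF j] by simp
    from tendsto_Re[OF this] show ?thesis by simp
  qed
  have h_lim: "((\<lambda>t. \<integral>\<omega>. h j (X t \<omega>) \<partial>P y) \<longlongrightarrow> Re (\<kappa> j / s)) at_top" if "j < N" "y \<in> E" for j y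
  proof (rule Lim_transform_eventually[OF u_lim[OF that]])
    show "\<forall>\<^sub>F t in at_top. u y j t = (\<integral>\<omega>. h j (X t \<omega>) \<partial>P y)"
      using h_u[OF that] by (intro eventually_mono[OF eventually_ge_at_top[of 0]]) simp
  qed
  have \<mu>: "\<mu> j = Re (\<kappa> j / s)" if j: "j < N" and y: "y \<in> E" for j y
    unfolding \<mu>_def asymptotic_moment_def
  proof (rule the_equality)
    show "\<forall>y\<in>E. ((\<lambda>t. \<integral>\<omega>. h j (X t \<omega>) \<partial>P y) \<longlongrightarrow> Re (\<kappa> j / s)) at_top"
      using h_lim[OF j] by blast
    show "m = Re (\<kappa> j / s)" if "\<forall>y\<in>E. ((\<lambda>t. \<integral>\<omega>. h j (X t \<omega>) \<partial>P y) \<longlongrightarrow> m) at_top" for m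
      using that y by (intro tendsto_unique[OF trivial_limit_at_top_linorder _ h_lim[OF j y]]) blast
  qed
  have part1: "\<forall>y\<in>E. \<forall>j<N. (\<forall>t\<ge>0. integrable (P y) (\<lambda>\<omega>. h j (X t \<omega>))) \<and>
            ((\<lambda>t. \<integral>\<omega>. h j (X t \<omega>) \<partial>P y) \<longlongrightarrow> \<mu> j) at_top"
    using h_int h_lim \<mu> by auto
  have part2: "\<forall>\<^sub>F \<Delta> in at_top.
                 \<exists>(A\<^sub>Y :: (nat \<Rightarrow> real^'d) measure) F\<^sub>Y P\<^sub>Y Y.
                   markov_cubature n E P X {real l * \<Delta> | l. 0 < l} (x ` {..<M}) A\<^sub>Y F\<^sub>Y P\<^sub>Y Y"
    if xE: "\<And>i. i < M \<Longrightarrow> x i \<in> E" and inj: "inj_on x {..<M}" and w: "\<And>i. i < M \<Longrightarrow> 0 < w i"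
      and \<mu>w: "\<And>j. j < N \<Longrightarrow> \<mu> j = (\<Sum>i<M. w i * h j (x i))"
      and rank: "vec_space.rank M (Matrix.mat M N (\<lambda>(i, j). h j (x i))) = N"
  proof -
    define H where "H = Matrix.mat M N (\<lambda>(i, j). h j (x i))"
    have H: "H \<in> carrier_mat M N" by (simp add: H_def)
    obtain L where L: "L \<in> carrier_mat N M" "L * H = 1\<^sub>m N"
      using left_inverse_of_full_column_rank[OF H] rank unfolding H_def by blast
    have LH: "(\<Sum>k<M. L $$ (j', k) * h j (x k)) = (if j' = j then 1 else 0)" if "j' < N" "j < N" for j' j
    proof -
      have "(L * H) $$ (j', j) = (\<Sum>k<M. L $$ (j', k) * h j (x k))"
        using L(1) that by (auto simp: H_def scalar_prod_def atLeast0LessThan intro!: sum.cong)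
      thus ?thesis using L(2) that by simp
    qed
    have N0: "0 < N"
    proof -
      let ?\<chi> = "char_poly (map_mat complex_of_real G)"
      have "map_mat complex_of_real G \<in> carrier_mat N N" using G by simp
      from degree_monic_char_poly[OF this] have deg: "degree ?\<chi> = N" and "coeff ?\<chi> N = 1" by simp_all
      hence "?\<chi> \<noteq> 0" by auto
      from order_degree[OF this, of 0] show ?thesis unfolding deg assms(11) by simp
    qed
    have M0: "0 < M"
    proof (rule ccontr)
      assume "\<not> 0 < M"
      thus False using LH[OF N0 N0] by simp
    qed
    \<comment> \<open>The matrix \<open>1 w\<^sup>T + (U \<Delta> - 1 \<mu>\<^sup>T) L\<close>, where \<open>U \<Delta>\<close> has the entries \<open>u (x i) j \<Delta>\<close>.\<close>
    define q where "q \<Delta> i k = w k + (\<Sum>j<N. (u (x i) j \<Delta> - \<mu> j) * L $$ (j, k))" for \<Delta> i k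
    have q_h: "(\<Sum>k<M. q \<Delta> i k * h j (x k)) = u (x i) j \<Delta>" if "j < N" for \<Delta> i j
    proof -
      have "(\<Sum>k<M. q \<Delta> i k * h j (x k))
          = \<mu> j + (\<Sum>k<M. \<Sum>j'<N. (u (x i) j' \<Delta> - \<mu> j') * (L $$ (j', k) * h j (x k)))"
        using that by (simp add: q_def \<mu>w distrib_right sum.distrib sum_distrib_right mult.assoc)
      also have "(\<Sum>k<M. \<Sum>j'<N. (u (x i) j' \<Delta> - \<mu> j') * (L $$ (j', k) * h j (x k)))
          = (\<Sum>j'<N. (u (x i) j' \<Delta> - \<mu> j') * (\<Sum>k<M. L $$ (j', k) * h j (x k)))"
        by (subst sum.swap) (simp add: sum_distrib_left)
      also have "\<dots> = (\<Sum>j'<N. if j' = j then u (x i) j' \<Delta> - \<mu> j' else 0)"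
        using that by (intro sum.cong) (auto simp: LH)
      finally show ?thesis using that by simp
    qed
    have q_lim: "((\<lambda>\<Delta>. q \<Delta> i k) \<longlongrightarrow> w k) at_top" if "i < M" for i k
    proof -
      have "((\<lambda>\<Delta>. q \<Delta> i k) \<longlongrightarrow> w k + (\<Sum>j<N. (\<mu> j - \<mu> j) * L $$ (j, k))) at_top"
        unfolding q_def using u_lim[OF _ xE[OF that]] \<mu>[OF _ xE[OF that]]
        by (intro tendsto_intros) auto
      thus ?thesis by simp
    qed
    have "\<forall>\<^sub>F \<Delta> in at_top. \<forall>i\<in>{..<M}. \<forall>k\<in>{..<M}. 0 < q \<Delta> i k"
      using order_tendstoD(1)[OF q_lim w] by (intro eventually_ball_finite ballI) auto
    thus ?thesis using eventually_gt_at_top[of 0]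
    proof eventually_elim
      case (elim \<Delta>)
      have q_pos: "0 < q \<Delta> i k" if "i < M" "k < M" for i k using elim(1) that by auto
      define idx where "idx = inv_into {..<M} x"
      have idx: "idx (x i) = i" if "i < M" for i
        unfolding idx_def using inj that by (simp add: inv_into_f_f)
      define S where "S = x ` {..<M}"
      define r where "r y z = q \<Delta> (idx y) (idx z)" for y z
      have r_sum: "(\<Sum>z\<in>S. r (x i) z * f z) = (\<Sum>k<M. q \<Delta> i k * f (x k))" if "i < M" for i and f :: "_ \<Rightarrow> real"
        unfolding S_def using that by (subst sum.reindex[OF inj]) (auto simp: r_def idx intro!: sum.cong)
      have q_sum: "(\<Sum>k<M. q \<Delta> i k) = 1" if i: "i < M" for i
      proof -
        have "(\<Sum>k<M. q \<Delta> i k) = (\<Sum>k<M. q \<Delta> i k * (\<Sum>j<N. c j * h j (x k)))"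
          by (intro sum.cong) (auto simp: c xE)
        also have "\<dots> = (\<Sum>j<N. c j * (\<Sum>k<M. q \<Delta> i k * h j (x k)))"
          by (simp add: sum_distrib_left, subst sum.swap) (simp add: mult_ac)
        also have "\<dots> = (\<Sum>j<N. c j * u (x i) j \<Delta>)"
          by (intro sum.cong) (auto simp: q_h)
        also have "\<dots> = 1" using c_u[OF xE[OF i]] elim(2) by simp
        finally show ?thesis .
      qed
      have stoch: "finite_stochastic_matrix S r"
      proof
        show "finite S" "S \<noteq> {}" using M0 by (auto simp: S_def)
        show "0 \<le> r y z" if "y \<in> S" "z \<in> S" for y z
          using that q_pos by (auto simp: S_def r_def idx less_imp_le)
        show "(\<Sum>z\<in>S. r y z) = 1" if "y \<in> S" for y
          using that r_sum[of _ "\<lambda>_. 1"] q_sum by (auto simp: S_def)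
      qed
      interpret chain: finite_stochastic_matrix S r by (rule stoch)
      have power: "(chain.transition ^^ l) (h j) (x i) = u (x i) j (real l * \<Delta>)"
        if "j < N" "i < M" for l j i
        using that
      proof (induction l arbitrary: i)
        case 0
        thus ?case using u_0 xE by simp
      next
        case (Suc l)
        define v where "v j t = (\<Sum>k<M. q \<Delta> i k * u (x k) j t)" for j t
        \<comment> \<open>Both sides solve the moment equation in \<open>t\<close> with initial value \<open>u (x i) j \<Delta>\<close>.\<close>
        have shift: "u (x i) j (real l * \<Delta> + \<Delta>) = v j (real l * \<Delta>)"
        proof (rule linear_system_unique[of N "\<lambda>j t. u (x i) j (t + \<Delta>)" v "\<lambda>i j. G $$ (i, j)"])
          fix j assume j: "j < N"
          show "continuous_on {0..} (\<lambda>t. u (x i) j (t + \<Delta>))"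
            using elim(2) by (intro continuous_on_compose2[OF u_cont[OF j xE[OF Suc.prems(2)]]] continuous_intros) auto
          show "continuous_on {0..} (v j)"
            unfolding v_def using u_cont[OF j] xE by (intro continuous_intros) auto
          show "u (x i) j (0 + \<Delta>) = v j 0"
            unfolding v_def using q_h[OF j, of \<Delta> i] u_0[OF j] xE by simp
          fix t :: real assume t: "0 < t"
          have "(u (x i) j has_real_derivative (\<Sum>i'<N. G $$ (i', j) * u (x i) i' (t + \<Delta>))) (at (t + \<Delta>))"
            using elim(2) t by (intro u_deriv[OF j xE[OF Suc.prems(2)]]) simp
          thus "((\<lambda>t. u (x i) j (t + \<Delta>)) has_real_derivative (\<Sum>i'<N. G $$ (i', j) * u (x i) i' (t + \<Delta>))) (at t)"
            by (simp only: DERIV_shift)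
          have "(v j has_real_derivative (\<Sum>k<M. q \<Delta> i k * (\<Sum>i'<N. G $$ (i', j) * u (x k) i' t))) (at t)"
            unfolding v_def by (intro DERIV_sum DERIV_cmult u_deriv[OF j _ t] xE) auto
          also have "(\<Sum>k<M. q \<Delta> i k * (\<Sum>i'<N. G $$ (i', j) * u (x k) i' t)) = (\<Sum>i'<N. G $$ (i', j) * v i' t)"
            unfolding v_def by (simp add: sum_distrib_left, subst sum.swap) (simp add: mult_ac)
          finally show "(v j has_real_derivative (\<Sum>i'<N. G $$ (i', j) * v i' t)) (at t)" .
        qed (use Suc.prems elim(2) in auto)
        have "(chain.transition ^^ Suc l) (h j) (x i) = (\<Sum>k<M. q \<Delta> i k * (chain.transition ^^ l) (h j) (x k))"
          using r_sum[OF Suc.prems(2)] by (simp add: chain.transition_def)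
        also have "\<dots> = v j (real l * \<Delta>)"
          unfolding v_def using Suc.IH[OF Suc.prems(1)] by (intro sum.cong) simp_all
        also have "\<dots> = u (x i) j (real l * \<Delta> + \<Delta>)" by (rule shift[symmetric])
        also have "real l * \<Delta> + \<Delta> = real (Suc l) * \<Delta>" by (simp add: distrib_right)
        finally show ?case .
      qed
      obtain A\<^sub>Y :: "(nat \<Rightarrow> real^'d) measure" and F\<^sub>Y P\<^sub>Y Y where Y:
        "markov_process A\<^sub>Y F\<^sub>Y (insert 0 {real l * \<Delta> | l. 0 < l}) S P\<^sub>Y Y"
        "\<And>x l (f :: real^'d \<Rightarrow> real). x \<in> S \<Longrightarrow> integrable (P\<^sub>Y x) (\<lambda>\<omega>. f (Y (real l * \<Delta>) \<omega>))"
        "\<And>x l f. x \<in> S \<Longrightarrow> (\<integral>\<omega>. f (Y (real l * \<Delta>) \<omega>) \<partial>P\<^sub>Y x) = (chain.transition ^^ l) f x"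
        using markov_process_of_stochastic_matrix[OF stoch elim(2)] by blast
      interpret Y: markov_process A\<^sub>Y F\<^sub>Y "insert 0 {real l * \<Delta> | l. 0 < l}" S P\<^sub>Y Y by (rule Y(1))
      have "markov_cubature n E P X {real l * \<Delta> | l. 0 < l} S A\<^sub>Y F\<^sub>Y P\<^sub>Y Y"
        unfolding markov_cubature_def
      proof (intro conjI ballI)
        show "finite S" "S \<subseteq> E" using xE by (auto simp: S_def)
        show "markov_process A\<^sub>Y F\<^sub>Y (insert 0 {real l * \<Delta> | l. 0 < l}) S P\<^sub>Y Y" by (rule Y(1))
        fix y t f assume y: "y \<in> S" and t: "t \<in> {real l * \<Delta> | l. 0 < l}" and f: "f \<in> Pol_le n E"
        obtain i where i: "i < M" "y = x i" using y by (auto simp: S_def)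
        have yE: "y \<in> E" using i xE by simp
        obtain l where l: "t = real l * \<Delta>" "0 < l" using t by blast
        have t0: "0 \<le> t" using l elim(2) by simp
        obtain a where a: "\<And>y. y \<in> E \<Longrightarrow> f y = (\<Sum>j<N. a j * h j y)"
          using coords[OF f] by blast
        have fX: "f (X t \<omega>) = (\<Sum>j<N. a j * h j (X t \<omega>))" if "\<omega> \<in> space (P y)" for \<omega>
          using that t0 yE by (intro a state_space) (auto simp: space_P)
        have sum_int: "integrable (P y) (\<lambda>\<omega>. \<Sum>j<N. a j * h j (X t \<omega>))"
          using h_int[OF _ yE t0] by auto
        show "integrable (P y) (\<lambda>\<omega>. f (X t \<omega>))"
          using sum_int by (rule Bochner_Integration.integrable_cong[THEN iffD2, rotated 2]) (auto simp: fX)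
        show "integrable (P\<^sub>Y y) (\<lambda>\<omega>. f (Y t \<omega>))" unfolding l by (rule Y(2)[OF y])
        have "(\<integral>\<omega>. f (X t \<omega>) \<partial>P y) = (\<integral>\<omega>. (\<Sum>j<N. a j * h j (X t \<omega>)) \<partial>P y)"
          by (intro Bochner_Integration.integral_cong refl fX)
        also have "\<dots> = (\<Sum>j<N. a j * u y j t)"
          using h_int[OF _ yE t0] h_u[OF _ yE t0] by (subst Bochner_Integration.integral_sum) auto
        also have "\<dots> = (\<Sum>j<N. a j * (\<integral>\<omega>. h j (Y t \<omega>) \<partial>P\<^sub>Y y))"
          unfolding l Y(3)[OF y] using i by (intro sum.cong) (auto simp: power)
        also have "\<dots> = (\<integral>\<omega>. (\<Sum>j<N. a j * h j (Y t \<omega>)) \<partial>P\<^sub>Y y)"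
          unfolding l using Y(2)[OF y] by (subst Bochner_Integration.integral_sum) auto
        also have "\<dots> = (\<integral>\<omega>. f (Y t \<omega>) \<partial>P\<^sub>Y y)"
        proof (rule Bochner_Integration.integral_cong[OF refl])
          fix \<omega> assume "\<omega> \<in> space (P\<^sub>Y y)"
          hence "\<omega> \<in> space A\<^sub>Y" using sets_eq_imp_space_eq[OF Y.sets_P[OF y]] by simp
          hence "Y t \<omega> \<in> S" using t by (intro Y.state_space) auto
          thus "(\<Sum>j<N. a j * h j (Y t \<omega>)) = f (Y t \<omega>)" using xE by (intro a[symmetric]) (auto simp: S_def)
        qed
        finally show "(\<integral>\<omega>. f (X t \<omega>) \<partial>P y) = (\<integral>\<omega>. f (Y t \<omega>) \<partial>P\<^sub>Y y)" .
      qed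
      thus ?case unfolding S_def by blast
    qed
  qed
  show ?thesis using part1 part2 by blast
qed

end
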